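(* Let $n\ge1$ be an integer, let $F\in\mathbb{C}[x_1,\ldots,x_s]$ be an irreducible polynomial and $X=\mathbf{V}(F)\subset\mathbb{C}^s$. Suppose $X$ is normal. Let $(\mathrm{Nash}_n(X),\pi_n)$ be the higher Nash blowup of order $n$ of $X$. Then $\pi_n$ is an isomorphism if and only if $X$ is non-singular.
   Context: For an irreducible algebraic variety $X\subset\mathbb{C}^s$ of dimension $d$ with ring of regular functions $R$, and $p\in X$, let $(R_p,\mathfrak{m}_p)$ be the localization of $R$ at $p$ and $T^n_pX:=(\mathfrak{m}_p/\mathfrak{m}_p^{n+1})^\vee$, a vector space over $R_p/\mathfrak{m}_p\cong\mathbb{C}$, of dimension $D=\binom{d+n}{d}-1$ whenever $p$ is non-singular. Since $X\subset\mathbb{C}^s$, one has $T^n_pX\subset T^n_p\mathbb{C}^s\cong\mathbb{C}^E$ with $E=\binom{s+n}{s}-1$, where $T^n_p\mathbb{C}^s=(\mathfrak{a}_p/\mathfrak{a}_p^{n+1})^\vee$ ($\mathfrak{a}_p$ the maximal ideal of $p$ in $\mathbb{C}[x_1,\ldots,x_s]$) is identified with $\mathbb{C}^E$ by means of the isomorphism $\mathfrak{a}_p/\mathfrak{a}_p^{n+1}\cong\mathbb{C}^E$ given by the Taylor coefficients $f\mapsto(\frac{\partial^\alpha f}{\alpha!}(p)\mid1\le|\alpha|\le n)$. Let $S(X)$ be the singular locus and consider the Gauss map $G_n:X\setminus S(X)\to Gr(D,\mathbb{C}^E)$, $p\mapsto T^n_pX$. $\mathrm{Nash}_n(X)$ is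 the Zariski closure of the graph of $G_n$ in $X\times Gr(D,\mathbb{C}^E)$, and $\pi_n:\mathrm{Nash}_n(X)\to X$ is the restriction of the projection $X\times Gr(D,\mathbb{C}^E)\to X$. *)

theory Defs
  imports "HOL-Analysis.Analysis" "HOL-Library.Poly_Mapping" "HOL-Library.Function_Algebras"
begin

section \<open>Polynomials over the complex numbers\<close>

text \<open>Polynomials in variables of type \<open>'v\<close>: finitely supported functions from monomials
  (finitely supported exponent functions) to coefficients. The ring structure is the one
  from \<^theory>\<open>HOL-Library.Poly_Mapping\<close>. Affine space of dimension \<open>CARD('s)\<close> is the type
  \<open>'s \<Rightarrow> complex\<close>, for \<open>'s\<close> finite.\<close>

type_synonym 'v mpoly = "('v \<Rightarrow>\<^sub>0 nat) \<Rightarrow>\<^sub>0 complex"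

definition meval :: "('v \<Rightarrow>\<^sub>0 nat) \<Rightarrow> ('v \<Rightarrow> complex) \<Rightarrow> complex" where
  "meval m x = (\<Prod>v\<in>Poly_Mapping.keys m. x v ^ Poly_Mapping.lookup m v)"

definition peval :: "'v mpoly \<Rightarrow> ('v \<Rightarrow> complex) \<Rightarrow> complex" where
  "peval P x = (\<Sum>m\<in>Poly_Mapping.keys P. Poly_Mapping.lookup P m * meval m x)"

definition pconst :: "complex \<Rightarrow> 'v mpoly" where
  "pconst c = Poly_Mapping.single 0 c"

lemma meval_superset:
  assumes "finite K" "Poly_Mapping.keys m \<subseteq> K"
  shows "meval m x = (\<Prod>v\<in>K. x v ^ Poly_Mapping.lookup m v)"
  unfolding meval_def using assms
  by (intro prod.mono_neutral_left) (auto simp: in_keys_iff)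

lemma meval_add: "meval (m + m') x = meval m x * meval m' x"
proof -
  let ?K = "Poly_Mapping.keys m \<union> Poly_Mapping.keys m'"
  have f: "finite ?K" by simp
  have "meval (m + m') x = (\<Prod>v\<in>?K. x v ^ Poly_Mapping.lookup (m + m') v)"
    by (rule meval_superset[OF f Poly_Mapping.keys_add])
  also have "\<dots> = (\<Prod>v\<in>?K. x v ^ Poly_Mapping.lookup m v) * (\<Prod>v\<in>?K. x v ^ Poly_Mapping.lookup m' v)"
    by (simp add: lookup_add power_add prod.distrib)
  finally show ?thesis
    using meval_superset[OF f, of m x] meval_superset[OF f, of m' x] by simp
qed

lemma peval_superset:
  assumes "finite K" "Poly_Mapping.keys P \<subseteq> K"
  shows "peval P x = (\<Sum>m\<in>K. Poly_Mapping.lookup P m * meval m x)"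
  unfolding peval_def using assms
  by (intro sum.mono_neutral_left) (auto simp: in_keys_iff)

lemma peval_add: "peval (P + Q) x = peval P x + peval Q x"
proof -
  let ?K = "Poly_Mapping.keys P \<union> Poly_Mapping.keys Q"
  have f: "finite ?K" by simp
  have "peval (P + Q) x = (\<Sum>m\<in>?K. Poly_Mapping.lookup (P + Q) m * meval m x)"
    by (rule peval_superset[OF f Poly_Mapping.keys_add])
  then show ?thesis
    using peval_superset[OF f, of P x] peval_superset[OF f, of Q x]
    by (simp add: lookup_add sum.distrib distrib_right)
qed

lemma peval_zero [simp]: "peval 0 x = 0"
  by (simp add: peval_def)

lemma peval_single [simp]: "peval (Poly_Mapping.single m c) x = c * meval m x"
  by (simp add: peval_def)

lemma peval_const [simp]: "peval (pconst c) x = c"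
  by (simp add: pconst_def meval_def)

lemma peval_one [simp]: "peval 1 x = 1"
  using peval_single[of 0 1 x] by (simp add: meval_def)

lemma peval_sum: "peval (sum f A) x = (\<Sum>i\<in>A. peval (f i) x)"
  by (induction A rule: infinite_finite_induct) (auto simp: peval_add)

lemma poly_mapping_sum_single:
  "(\<Sum>m\<in>Poly_Mapping.keys P. Poly_Mapping.single m (Poly_Mapping.lookup P m)) = P"
  by (rule poly_mapping_eqI)
     (auto simp: lookup_sum lookup_single when_def in_keys_iff sum.delta)

lemma peval_mult: "peval (P * Q) x = peval P x * peval Q x"
proof -
  let ?L = Poly_Mapping.lookup and ?K = Poly_Mapping.keys
  have "P * Q = (\<Sum>m\<in>?K P. Poly_Mapping.single m (?L P m)) * (\<Sum>m\<in>?K Q. Poly_Mapping.single m (?L Q m))"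
    by (simp only: poly_mapping_sum_single)
  also have "\<dots> = (\<Sum>m\<in>?K P. \<Sum>m'\<in>?K Q. Poly_Mapping.single (m + m') (?L P m * ?L Q m'))"
    by (simp add: sum_product mult_single)
  finally have "peval (P * Q) x = (\<Sum>m\<in>?K P. \<Sum>m'\<in>?K Q. ?L P m * ?L Q m' * (meval m x * meval m' x))"
    by (simp add: peval_sum meval_add)
  then show ?thesis
    by (simp add: peval_def sum_product mult_ac)
qed

definition zero_set :: "'v mpoly set \<Rightarrow> ('v \<Rightarrow> complex) set" where
  "zero_set S = {x. \<forall>f\<in>S. peval f x = 0}"

definition vanishing_ideal :: "('v \<Rightarrow> complex) set \<Rightarrow> 'v mpoly set" where
  "vanishing_ideal X = {f. \<forall>x\<in>X. peval f x = 0}"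

definition mdeg :: "('v::finite \<Rightarrow>\<^sub>0 nat) \<Rightarrow> nat" where
  "mdeg \<alpha> = (\<Sum>v\<in>UNIV. Poly_Mapping.lookup \<alpha> v)"

text \<open>The value at \<open>p\<close> of the partial derivative of multi-order \<open>\<alpha>\<close>; the inner product is the
  falling factorial, which vanishes if \<open>\<alpha> v\<close> exceeds the exponent \<open>m v\<close>.\<close>

definition pderiv_at :: "('s::finite \<Rightarrow>\<^sub>0 nat) \<Rightarrow> 's mpoly \<Rightarrow> ('s \<Rightarrow> complex) \<Rightarrow> complex" where
  "pderiv_at \<alpha> f p = (\<Sum>m\<in>Poly_Mapping.keys f. Poly_Mapping.lookup f m *
     (\<Prod>v\<in>UNIV. (\<Prod>i<Poly_Mapping.lookup \<alpha> v. of_nat (Poly_Mapping.lookup m v) - of_nat i)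
        * p v ^ (Poly_Mapping.lookup m v - Poly_Mapping.lookup \<alpha> v)))"

definition taylor_coeff :: "('s::finite \<Rightarrow>\<^sub>0 nat) \<Rightarrow> 's mpoly \<Rightarrow> ('s \<Rightarrow> complex) \<Rightarrow> complex" where
  "taylor_coeff \<alpha> f p = pderiv_at \<alpha> f p / (\<Prod>v\<in>UNIV. fact (Poly_Mapping.lookup \<alpha> v))"


section \<open>Affine varieties: normality, dimension\<close>

text \<open>The coordinate ring of \<open>X\<close> is the polynomial ring modulo \<open>vanishing_ideal X\<close>; for irreducible
  \<open>X\<close> it is a domain \<open>R\<close>. Normality says that \<open>R\<close> is integrally closed in its fraction field: if
  \<open>a/b\<close> satisfies \<open>(a/b)^m + (\<Sum>i<m. c i * (a/b)^i) = 0\<close>, then \<open>a/b\<close> lies in \<open>R\<close>. Both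
  equations have their denominators cleared.\<close>

definition normal_variety :: "('s \<Rightarrow> complex) set \<Rightarrow> bool" where
  "normal_variety X \<longleftrightarrow>
     (\<forall>a b c m. b \<notin> vanishing_ideal X \<and>
        a ^ m + (\<Sum>i<m. c i * a ^ i * b ^ (m - i)) \<in> vanishing_ideal X \<longrightarrow>
        (\<exists>q. a - q * b \<in> vanishing_ideal X))"

definition alg_indep_on :: "('s \<Rightarrow> complex) set \<Rightarrow> nat \<Rightarrow> (nat \<Rightarrow> 's mpoly) \<Rightarrow> bool" where
  "alg_indep_on X k g \<longleftrightarrow>
     (\<forall>P :: nat mpoly. (\<forall>m\<in>Poly_Mapping.keys P. Poly_Mapping.keys m \<subseteq> {..<k}) \<and>
        (\<forall>x\<in>X. peval P (\<lambda>i. peval (g i) x) = 0) \<longrightarrow> P = 0)"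

text \<open>The dimension of an irreducible variety: the transcendence degree of its coordinate ring.\<close>

definition variety_dim :: "('s \<Rightarrow> complex) set \<Rightarrow> nat" where
  "variety_dim X = (GREATEST k. \<exists>g. alg_indep_on X k g)"


section \<open>Higher-order tangent spaces\<close>

definition max_ideal_at :: "('s \<Rightarrow> complex) \<Rightarrow> 's mpoly set" where
  "max_ideal_at p = {f. peval f p = 0}"

definition ideal_power :: "'a::comm_ring_1 set \<Rightarrow> nat \<Rightarrow> 'a set" where
  "ideal_power A k = module.span (*) {prod_list fs |fs. set fs \<subseteq> A \<and> length fs = k}"

text \<open>An element of the local ring \<open>R\<^sub>p\<close> is a fraction \<open>a/b\<close> of polynomials with \<open>b(p) \<noteq> 0\<close>. Such a
  fraction lies in the \<open>k\<close>-th power of the maximal ideal iff, for some \<open>h\<close> with \<open>h(p) \<noteq> 0\<close>, the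
  polynomial \<open>h * a\<close> agrees modulo \<open>vanishing_ideal X\<close> with an element of the \<open>k\<close>-th power of
  \<open>max_ideal_at p\<close>. The denominator \<open>b\<close> is a unit and plays no role.\<close>

definition in_local_power :: "('s \<Rightarrow> complex) set \<Rightarrow> ('s \<Rightarrow> complex) \<Rightarrow> nat \<Rightarrow> 's mpoly \<Rightarrow> bool" where
  "in_local_power X p k a \<longleftrightarrow>
     (\<exists>h t. h \<notin> max_ideal_at p \<and> t \<in> ideal_power (max_ideal_at p) k \<and> h * a - t \<in> vanishing_ideal X)"

text \<open>Linear functionals on \<open>\<mm>\<^sub>p / \<mm>\<^sub>p^(n+1)\<close>, as functions \<open>\<phi> a b\<close> of the fraction \<open>a/b\<close> with
  \<open>a(p) = 0\<close> and \<open>b(p) \<noteq> 0\<close>. Independence of the chosen representative of \<open>a/b\<close> follows, because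
  two representatives of one fraction differ by a fraction that is zero in \<open>R\<^sub>p\<close>.\<close>

definition jet_functional ::
  "nat \<Rightarrow> ('s \<Rightarrow> complex) set \<Rightarrow> ('s \<Rightarrow> complex) \<Rightarrow> ('s mpoly \<Rightarrow> 's mpoly \<Rightarrow> complex) \<Rightarrow> bool" where
  "jet_functional n X p \<phi> \<longleftrightarrow>
     (\<forall>a\<in>max_ideal_at p. \<forall>b\<in>- max_ideal_at p. \<forall>a'\<in>max_ideal_at p. \<forall>b'\<in>- max_ideal_at p.
        \<phi> (a * b' + a' * b) (b * b') = \<phi> a b + \<phi> a' b') \<and>
     (\<forall>c. \<forall>a\<in>max_ideal_at p. \<forall>b\<in>- max_ideal_at p. \<phi> (pconst c * a) b = c * \<phi> a b) \<and>
     (\<forall>a\<in>max_ideal_at p. \<forall>b\<in>- max_ideal_at p. in_local_power X p (n + 1) a \<longrightarrow> \<phi> a b = 0)"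

definition multi_indices :: "nat \<Rightarrow> ('s::finite \<Rightarrow>\<^sub>0 nat) set" where
  "multi_indices n = {\<alpha>. 1 \<le> mdeg \<alpha> \<and> mdeg \<alpha> \<le> n}"

text \<open>The coordinate space with index set \<open>I\<close>: functions vanishing outside \<open>I\<close>.\<close>

definition coord_space :: "'i set \<Rightarrow> ('i \<Rightarrow> complex) set" where
  "coord_space I = {v. \<forall>i. i \<notin> I \<longrightarrow> v i = 0}"

definition fun_scale :: "complex \<Rightarrow> ('i \<Rightarrow> complex) \<Rightarrow> 'i \<Rightarrow> complex" where
  "fun_scale c v = (\<lambda>i. c * v i)"

interpretation fun_space: vector_space fun_scale
  by unfold_locales (auto simp: fun_scale_def fun_eq_iff algebra_simps)

text \<open>A functional on \<open>\<mm>\<^sub>p / \<mm>\<^sub>p^(n+1)\<close> is regarded, by composition with \<open>f \<mapsto> f/1\<close>, as a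
  functional on \<open>\<aa>\<^sub>p / \<aa>\<^sub>p^(n+1)\<close>, where \<open>\<aa>\<^sub>p\<close> is \<open>max_ideal_at p\<close>, and this in turn as the vector
  \<open>v\<close> that represents it in the Taylor coordinates.\<close>

definition higher_tangent ::
  "nat \<Rightarrow> ('s::finite \<Rightarrow> complex) set \<Rightarrow> ('s \<Rightarrow> complex) \<Rightarrow> (('s \<Rightarrow>\<^sub>0 nat) \<Rightarrow> complex) set" where
  "higher_tangent n X p =
     {v \<in> coord_space (multi_indices n).
        \<exists>\<phi>. jet_functional n X p \<phi> \<and>
          (\<forall>f\<in>max_ideal_at p. \<phi> f 1 = (\<Sum>\<alpha>\<in>multi_indices n. v \<alpha> * taylor_coeff \<alpha> f p))}"

text \<open>A point is non-singular iff the local ring there is regular, i.e. the dimension of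
  \<open>\<mm>\<^sub>p / \<mm>\<^sub>p\<^sup>2\<close> (equivalently, of its dual) is the dimension of \<open>X\<close>.\<close>

definition singular_locus :: "('s::finite \<Rightarrow> complex) set \<Rightarrow> ('s \<Rightarrow> complex) set" where
  "singular_locus X = {p \<in> X. fun_space.dim (higher_tangent 1 X p) \<noteq> variety_dim X}"

abbreviation nonsingular :: "('s::finite \<Rightarrow> complex) set \<Rightarrow> bool" where
  "nonsingular X \<equiv> singular_locus X = {}"


section \<open>Zariski topology, regular functions and morphisms\<close>

text \<open>An ambient algebraic space is given by an atlas: a set of pairs of an affine chart domain and
  its coordinates. The coordinates identify the domain with a Zariski closed subset of an affine
  space, and different charts are related by rational changes of coordinates. Open sets and regular
  functions are described in the charts.\<close>

type_synonym ('p, 'v) atlas = "('p set \<times> ('p \<Rightarrow> 'v \<Rightarrow> complex)) set"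

definition zariski_open :: "('p, 'v) atlas \<Rightarrow> 'p set \<Rightarrow> bool" where
  "zariski_open A U \<longleftrightarrow> U \<subseteq> \<Union> (fst ` A) \<and>
     (\<forall>(D, c)\<in>A. \<exists>S. \<forall>p\<in>D. p \<in> U \<longleftrightarrow> c p \<notin> zero_set S)"

definition zariski :: "('p, 'v) atlas \<Rightarrow> 'p topology" where
  "zariski A = topology (zariski_open A)"

lemma istopology_zariski_open: "istopology (zariski_open A)"
  unfolding istopology_def
proof (intro conjI allI impI)
  fix U V assume U: "zariski_open A U" and V: "zariski_open A V"
  show "zariski_open A (U \<inter> V)"
    unfolding zariski_open_def
  proof (intro conjI ballI, goal_cases)
    case 1
    then show ?case using U by (auto simp: zariski_open_def)
  next
    case (2 x)
    obtain D c where x: "x = (D, c)" by fastforce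
    obtain S where S: "\<And>p. p \<in> D \<Longrightarrow> p \<in> U \<longleftrightarrow> c p \<notin> zero_set S"
      using U 2 x unfolding zariski_open_def by fastforce
    obtain T where T: "\<And>p. p \<in> D \<Longrightarrow> p \<in> V \<longleftrightarrow> c p \<notin> zero_set T"
      using V 2 x unfolding zariski_open_def by fastforce
    have "\<forall>p\<in>D. p \<in> U \<inter> V \<longleftrightarrow> c p \<notin> zero_set {f * g |f g. f \<in> S \<and> g \<in> T}"
      using S T by (fastforce simp: zero_set_def peval_mult)
    then show ?case using x by blast
  qed
next
  fix \<U> assume \<U>: "\<forall>U\<in>\<U>. zariski_open A U"
  show "zariski_open A (\<Union> \<U>)"
    unfolding zariski_open_def
  proof (intro conjI ballI, goal_cases)
    case 1
    then show ?case using \<U> by (auto simp: zariski_open_def)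
  next
    case (2 x)
    obtain D c where x: "x = (D, c)" by fastforce
    have "\<forall>U\<in>\<U>. \<exists>S. \<forall>p\<in>D. p \<in> U \<longleftrightarrow> c p \<notin> zero_set S"
      using \<U> 2 x unfolding zariski_open_def by fastforce
    then obtain S where S: "\<And>U p. U \<in> \<U> \<Longrightarrow> p \<in> D \<Longrightarrow> p \<in> U \<longleftrightarrow> c p \<notin> zero_set (S U)"
      by metis
    have "\<forall>p\<in>D. p \<in> \<Union> \<U> \<longleftrightarrow> c p \<notin> zero_set (\<Union> (S ` \<U>))"
      using S by (fastforce simp: zero_set_def)
    then show ?case using x by blast
  qed
qed

lemma openin_zariski: "openin (zariski A) = zariski_open A"
  by (simp add: zariski_def istopology_zariski_open)

text \<open>\<open>regular_on A V U f\<close>: on the open subset \<open>U\<close> of the variety \<open>V\<close>, the function \<open>f\<close> is locally a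
  quotient of polynomials in the coordinates of a chart.\<close>

definition regular_on :: "('p, 'v) atlas \<Rightarrow> 'p set \<Rightarrow> 'p set \<Rightarrow> ('p \<Rightarrow> complex) \<Rightarrow> bool" where
  "regular_on A V U f \<longleftrightarrow>
     (\<forall>p\<in>U. \<exists>(D, c)\<in>A. \<exists>N P Q. openin (subtopology (zariski A) V) N \<and> p \<in> N \<and> N \<subseteq> U \<inter> D \<and>
        (\<forall>q\<in>N. peval Q (c q) \<noteq> 0 \<and> f q = peval P (c q) / peval Q (c q)))"

definition is_morphism ::
  "('p, 'v) atlas \<Rightarrow> 'p set \<Rightarrow> ('q, 'w) atlas \<Rightarrow> 'q set \<Rightarrow> ('p \<Rightarrow> 'q) \<Rightarrow> bool" where
  "is_morphism A V B W \<phi> \<longleftrightarrow>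
     continuous_map (subtopology (zariski A) V) (subtopology (zariski B) W) \<phi> \<and>
     (\<forall>U f. openin (subtopology (zariski B) W) U \<and> regular_on B W U f \<longrightarrow>
        regular_on A V (V \<inter> \<phi> -` U) (f \<circ> \<phi>))"

definition is_isomorphism ::
  "('p, 'v) atlas \<Rightarrow> 'p set \<Rightarrow> ('q, 'w) atlas \<Rightarrow> 'q set \<Rightarrow> ('p \<Rightarrow> 'q) \<Rightarrow> bool" where
  "is_isomorphism A V B W \<phi> \<longleftrightarrow> is_morphism A V B W \<phi> \<and>
     (\<exists>\<psi>. is_morphism B W A V \<psi> \<and> (\<forall>p\<in>V. \<psi> (\<phi> p) = p) \<and> (\<forall>q\<in>W. \<phi> (\<psi> q) = q))"

definition affine_atlas :: "('s \<Rightarrow> complex, 's) atlas" where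
  "affine_atlas = {(UNIV, \<lambda>x. x)}"


section \<open>Grassmannians and the higher Nash blowup\<close>

definition grassmannian :: "'i set \<Rightarrow> nat \<Rightarrow> ('i \<Rightarrow> complex) set set" where
  "grassmannian I k = {W. W \<subseteq> coord_space I \<and> fun_space.subspace W \<and> fun_space.dim W = k}"

text \<open>The standard charts of the Grassmannian: for a \<open>k\<close>-element set \<open>J\<close> of indices, the subspaces
  which project isomorphically onto the coordinates in \<open>J\<close>. Such a \<open>W\<close> has a unique basis \<open>w\<^sub>j\<close>
  (\<open>j \<in> J\<close>) projecting to the standard basis, and the coordinates of \<open>W\<close> are the entries
  \<open>w\<^sub>j i\<close>. Coordinates with \<open>j \<notin> J\<close>, \<open>i \<in> J\<close> or \<open>i \<notin> I\<close> are constant on the chart.\<close>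

definition grass_chart_dom :: "'i set \<Rightarrow> nat \<Rightarrow> 'i set \<Rightarrow> ('i \<Rightarrow> complex) set set" where
  "grass_chart_dom I k J = {W \<in> grassmannian I k. \<forall>u. \<exists>!w. w \<in> W \<and> (\<forall>j\<in>J. w j = u j)}"

definition grass_coord :: "'i set \<Rightarrow> ('i \<Rightarrow> complex) set \<Rightarrow> 'i \<times> 'i \<Rightarrow> complex" where
  "grass_coord J W = (\<lambda>(j, i). (THE w. w \<in> W \<and> (\<forall>l\<in>J. w l = (if l = j then 1 else 0))) i)"

definition affine_grass_atlas ::
  "'i set \<Rightarrow> nat \<Rightarrow> (('s \<Rightarrow> complex) \<times> ('i \<Rightarrow> complex) set, 's + 'i \<times> 'i) atlas" where
  "affine_grass_atlas I k =
     {(UNIV \<times> grass_chart_dom I k J, \<lambda>(x, W). case_sum x (grass_coord J W)) |J.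
        J \<subseteq> I \<and> card J = k}"

definition nash_rank :: "nat \<Rightarrow> ('s \<Rightarrow> complex) set \<Rightarrow> nat" where
  "nash_rank n X = (variety_dim X + n choose variety_dim X) - 1"

definition nash_atlas ::
  "nat \<Rightarrow> ('s::finite \<Rightarrow> complex) set \<Rightarrow>
     (('s \<Rightarrow> complex) \<times> (('s \<Rightarrow>\<^sub>0 nat) \<Rightarrow> complex) set, 's + ('s \<Rightarrow>\<^sub>0 nat) \<times> ('s \<Rightarrow>\<^sub>0 nat)) atlas" where
  "nash_atlas n X = affine_grass_atlas (multi_indices n) (nash_rank n X)"

definition gauss_graph ::
  "nat \<Rightarrow> ('s::finite \<Rightarrow> complex) set \<Rightarrow> (('s \<Rightarrow> complex) \<times> (('s \<Rightarrow>\<^sub>0 nat) \<Rightarrow> complex) set) set" where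
  "gauss_graph n X = (\<lambda>p. (p, higher_tangent n X p)) ` (X - singular_locus X)"

definition nash_blowup ::
  "nat \<Rightarrow> ('s::finite \<Rightarrow> complex) set \<Rightarrow> (('s \<Rightarrow> complex) \<times> (('s \<Rightarrow>\<^sub>0 nat) \<Rightarrow> complex) set) set" where
  "nash_blowup n X =
     subtopology (zariski (nash_atlas n X)) (X \<times> grassmannian (multi_indices n) (nash_rank n X))
       closure_of gauss_graph n X"

definition nash_projection ::
  "('s \<Rightarrow> complex) \<times> (('s \<Rightarrow>\<^sub>0 nat) \<Rightarrow> complex) set \<Rightarrow> ('s \<Rightarrow> complex)" where
  "nash_projection = fst"

end

theory Submission
  imports Defs "HOL-Computational_Algebra.Fundamental_Theorem_Algebra" "Jordan_Normal_Form.Determinant"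
begin

text \<open>
Write \<open>s\<close> for the number of variables. At a point \<open>q\<close> of \<open>X\<close> the higher tangent space consists of the
vectors annihilated by the rows of a matrix \<open>jac\<close>, whose row \<open>\<beta>\<close> (\<open>|\<beta>| < n\<close>) lists the Taylor
coefficients of \<open>(x - q)\<^sup>\<beta> F\<close> (\<open>higher_tangent_hypersurface\<close>). Its entries are polynomials in \<open>q\<close>, namely
Hasse derivatives of \<open>F\<close>. For a variable \<open>v\<close>, the columns \<open>\<alpha>\<close> with \<open>\<alpha>\<^sub>v \<ge> 1\<close> form a square submatrix which
on \<open>X\<close> becomes triangular, with \<open>\<partial>F/\<partial>v\<close> on the diagonal, after ordering rows and columns suitably.
Hence the matrix has full rank where the gradient does not vanish. As \<open>X\<close> has dimension \<open>s - 1\<close>, the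
case \<open>n = 1\<close> identifies the singular points with the points where the gradient vanishes
(\<open>singular_locus_hypersurface\<close>).

If \<open>X\<close> is non-singular, then by Cramer's rule the kernel of the matrix has rational coordinates in
every chart of the Grassmannian, and the condition that a subspace lies in the kernel is closed.
So the Nash blowup is the graph of a morphism on \<open>X\<close>, and the projection is an isomorphism.

Conversely, let the projection have an inverse and let \<open>p\<close> be a singular point. Near \<open>p\<close> the inverse
provides a subspace \<open>W\<^sub>q\<close> of the kernel with regular coordinates in one chart \<open>J\<close>. Since \<open>W\<^sub>q\<close> is
annihilated, the columns in \<open>J\<close> are regular combinations of the others; so all maximal minors are
regular multiples of a single one, the minor \<open>f\<close> of the columns outside \<open>J\<close>. In particular \<open>f\<close> divides a
power of each \<open>\<partial>F/\<partial>v\<close> in the local ring at \<open>p\<close>, while \<open>f(p) = 0\<close> because the rows with \<open>|\<beta>| = n - 1\<close>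
vanish at \<open>p\<close> (\<open>isomorphism_imp_divisibility\<close>, \<open>jac_minor_singular\<close>). So the hypersurface \<open>f = 0\<close> of \<open>X\<close>
consists of singular points near \<open>p\<close>.

A normal variety has no such hypersurface; here this is proved directly
(\<open>normal_hypersurface_no_singular_divisor\<close>). The ascending chain condition gives a prime ideal \<open>P\<close> of
the form \<open>((f, F) : a)\<close> which contains all partial derivatives of \<open>F\<close>. The fraction \<open>a/f\<close> is not
regular. If \<open>a/f\<close> mapped \<open>P\<close> into itself it would be integral, against normality; so some \<open>g\<close> in \<open>P\<close> is
sent outside \<open>P\<close>, and then \<open>g\<close> and \<open>F\<close> generate \<open>P\<close> locally. As the derivatives of \<open>F\<close> lie in \<open>P\<close>, every
derivation that maps \<open>g\<close> into \<open>P\<close> maps \<open>P\<close> into itself. If all \<open>\<partial>g/\<partial>v\<close> lie in \<open>P\<close>, all partial derivatives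
are such; otherwise, for one \<open>w\<close> with \<open>\<partial>g/\<partial>w\<close> outside \<open>P\<close>, the combinations \<open>g\<^sub>w \<partial>\<^sub>u - g\<^sub>u \<partial>\<^sub>w\<close> are. In both
cases a nonzero ideal of a polynomial ring (in all variables, or in all but \<open>w\<close>) is stable under all
partial derivatives, so by lowering degrees it contains \<open>1\<close>, which is absurd. That the ideal in
fewer variables is nonzero is elimination theory: an irreducible \<open>F\<close> that involves \<open>w\<close> and a \<open>G\<close> not
divisible by \<open>F\<close> have a nonzero combination free of \<open>w\<close> (\<open>eliminate_variable\<close>). The same fact gives the
Nullstellensatz for \<open>F\<close>.
\<close>

abbreviation "lookup \<equiv> Poly_Mapping.lookup"
abbreviation "keys \<equiv> Poly_Mapping.keys"
abbreviation "single \<equiv> Poly_Mapping.single"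

section \<open>A monomial order given by prime weights\<close>

text \<open>Attaching distinct primes to the variables turns monomials into natural numbers, injectively and
multiplicatively. Comparing these numbers is a monomial order of type \<open>\<nat>\<close>, so that arguments by
leading terms become ordinary inductions.\<close>

definition var_prime :: "'v::countable \<Rightarrow> nat" where
  "var_prime v = enumerate {p. prime p} (to_nat v)"

definition mweight :: "('v::countable \<Rightarrow>\<^sub>0 nat) \<Rightarrow> nat" where
  "mweight m = (\<Prod>v\<in>keys m. var_prime v ^ lookup m v)"

lemma prime_var_prime: "prime (var_prime v)"
  using enumerate_in_set[OF primes_infinite, of "to_nat v"] by (simp add: var_prime_def)

lemma var_prime_pos [simp]: "0 < var_prime v"
  using prime_var_prime by (rule prime_gt_0_nat)

lemma inj_var_prime: "inj var_prime"
proof (rule injI)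
  fix v w :: 'a assume "var_prime v = var_prime w"
  then have "to_nat v = to_nat w"
    using strict_mono_enumerate[OF primes_infinite] unfolding var_prime_def
    by (metis strict_mono_eq)
  then show "v = w" by simp
qed

lemma mweight_superset:
  assumes "finite K" "keys m \<subseteq> K"
  shows "mweight m = (\<Prod>v\<in>K. var_prime v ^ lookup m v)"
  unfolding mweight_def using assms
  by (intro prod.mono_neutral_left) (auto simp: in_keys_iff)

lemma mweight_add: "mweight (m + m') = mweight m * mweight m'"
proof -
  let ?K = "keys m \<union> keys m'"
  have f: "finite ?K" by simp
  show ?thesis
    using mweight_superset[OF f Poly_Mapping.keys_add] mweight_superset[OF f, of m]
      mweight_superset[OF f, of m'] by (simp add: lookup_add power_add prod.distrib)
qed

lemma mweight_pos [simp]: "0 < mweight m"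
  unfolding mweight_def by (intro prod_pos) simp

lemma mweight_inj: "mweight m = mweight m' \<longleftrightarrow> m = m'"
proof
  assume eq: "mweight m = mweight m'"
  let ?K = "keys m \<union> keys m'"
  have rep: "mweight k = (\<Prod>p\<in>var_prime ` ?K. p ^ lookup k (inv_into UNIV var_prime p))"
    if "keys k \<subseteq> ?K" for k :: "'a \<Rightarrow>\<^sub>0 nat"
    using mweight_superset[OF _ that]
    by (subst prod.reindex) (auto intro: inj_on_subset[OF inj_var_prime] simp: inv_f_f[OF inj_var_prime])
  have mult: "multiplicity (var_prime v) (mweight k) = lookup k v"
    if "keys k \<subseteq> ?K" "v \<in> ?K" for k v
    unfolding rep[OF that(1)]
    using that(2) prime_var_prime
    by (subst multiplicity_prod_prime_powers) (auto simp: inv_f_f[OF inj_var_prime])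
  show "m = m'"
  proof (rule poly_mapping_eqI)
    fix v show "lookup m v = lookup m' v"
    proof (cases "v \<in> ?K")
      case True
      then show ?thesis using mult[of m v] mult[of m' v] eq by auto
    qed (auto simp: in_keys_iff)
  qed
qed simp

lemma lookup_le_log_weight: "2 ^ lookup m v \<le> mweight m"
proof (cases "v \<in> keys m")
  case True
  have "2 ^ lookup m v \<le> var_prime v ^ lookup m v"
    using prime_ge_2_nat[OF prime_var_prime] by (intro power_mono) auto
  also have "\<dots> \<le> mweight m"
    unfolding mweight_def using True
    by (subst prod.remove[of _ v]) (auto simp: Suc_le_eq intro!: prod_pos)
  finally show ?thesis .
qed (auto simp: in_keys_iff Suc_le_eq)

text \<open>The inserted \<open>0\<close> is the value for the zero polynomial; nonzero polynomials have positive weight.\<close>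

definition pweight :: "'v::countable mpoly \<Rightarrow> nat" where
  "pweight P = Max (insert 0 (mweight ` keys P))"

definition lead_mon :: "'v::countable mpoly \<Rightarrow> ('v \<Rightarrow>\<^sub>0 nat)" where
  "lead_mon P = (SOME m. m \<in> keys P \<and> mweight m = pweight P)"

lemma mweight_le_pweight: "m \<in> keys P \<Longrightarrow> mweight m \<le> pweight P"
  by (simp add: pweight_def)

lemma pweight_le: "(\<And>m. m \<in> keys P \<Longrightarrow> mweight m \<le> b) \<Longrightarrow> pweight P \<le> b"
  by (auto simp: pweight_def)

lemma pweight_0 [simp]: "pweight 0 = 0"
  by (simp add: pweight_def)

lemma lead_mon:
  assumes "P \<noteq> 0"
  shows "lead_mon P \<in> keys P" "mweight (lead_mon P) = pweight P"
proof -
  have "pweight P \<in> insert 0 (mweight ` keys P)"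
    unfolding pweight_def by (rule Max_in) auto
  moreover have "pweight P \<noteq> 0"
  proof -
    obtain m where "m \<in> keys P" using assms by fastforce
    then show ?thesis using mweight_le_pweight[of m P] mweight_pos[of m] by linarith
  qed
  ultimately have "\<exists>m. m \<in> keys P \<and> mweight m = pweight P" by auto
  from someI_ex[OF this] show "lead_mon P \<in> keys P" "mweight (lead_mon P) = pweight P"
    by (auto simp: lead_mon_def)
qed

lemma lead_coeff_nz: "P \<noteq> 0 \<Longrightarrow> lookup P (lead_mon P) \<noteq> 0"
  using lead_mon(1)[of P] by (simp add: in_keys_iff)

lemma pweight_pos: "P \<noteq> 0 \<Longrightarrow> 0 < pweight P"
  using lead_mon(2)[of P] mweight_pos[of "lead_mon P"] by simp

lemma mpoly_mult_expand:
  "P * Q = (\<Sum>m\<in>keys P. \<Sum>m'\<in>keys Q.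
     single (m + m') (lookup P m * lookup Q m'))"
  for P Q :: "'v mpoly"
proof -
  have "P * Q = (\<Sum>m\<in>keys P. single m (lookup P m))
      * (\<Sum>m\<in>keys Q. single m (lookup Q m))"
    by (simp only: poly_mapping_sum_single)
  then show ?thesis by (simp add: sum_product mult_single)
qed

lemma keys_mult_mpoly:
  "m \<in> keys (P * Q) \<Longrightarrow>
    \<exists>a\<in>keys P. \<exists>b\<in>keys Q. m = a + b" for P Q :: "'v mpoly"
  using Poly_Mapping.keys_mult[of P Q] by fastforce

text \<open>Weights multiply, so a product of two monomials reaches the maximal weight only if both factors
do.\<close>

lemma lookup_mult_lead:
  fixes P Q :: "'v::countable mpoly"
  assumes "P \<noteq> 0" "Q \<noteq> 0"
  shows "lookup (P * Q) (lead_mon P + lead_mon Q)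
    = lookup P (lead_mon P) * lookup Q (lead_mon Q)"
proof -
  let ?s = "lead_mon P + lead_mon Q"
  have only: "m = lead_mon P \<and> m' = lead_mon Q"
    if "m \<in> keys P" "m' \<in> keys Q" "m + m' = ?s" for m m'
  proof -
    have le: "mweight m \<le> mweight (lead_mon P)" "mweight m' \<le> mweight (lead_mon Q)"
      using that mweight_le_pweight lead_mon(2) assms by metis+
    have eq: "mweight m * mweight m' = mweight (lead_mon P) * mweight (lead_mon Q)"
      using that(3) by (metis mweight_add)
    have "mweight m = mweight (lead_mon P)"
    proof (rule ccontr)
      assume "mweight m \<noteq> mweight (lead_mon P)"
      then have "mweight m * mweight m' < mweight (lead_mon P) * mweight (lead_mon Q)"
        using le by (intro mult_less_le_imp_less) auto
      then show False using eq by simp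
    qed
    then show ?thesis using that(3) by (simp add: mweight_inj)
  qed
  have "lookup (P * Q) ?s = (\<Sum>m\<in>keys P. \<Sum>m'\<in>keys Q.
     (if m = lead_mon P then if m' = lead_mon Q then lookup P m * lookup Q m' else 0 else 0))"
    unfolding mpoly_mult_expand lookup_sum lookup_single when_def
    by (intro sum.cong refl) (use only in auto)
  also have "\<dots> = (\<Sum>m\<in>keys P. if m = lead_mon P then
      \<Sum>m'\<in>keys Q. if m' = lead_mon Q then lookup P m * lookup Q m' else 0 else 0)"
    by (intro sum.cong refl) simp
  finally show ?thesis using lead_mon(1)[OF assms(1)] lead_mon(1)[OF assms(2)]
    by (simp add: sum.delta)
qed

lemma mpoly_mult_eq_0: "P * Q = 0 \<longleftrightarrow> P = 0 \<or> Q = 0" for P Q :: "'v::countable mpoly"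
proof (cases "P = 0 \<or> Q = 0")
  case False
  then have "lookup (P * Q) (lead_mon P + lead_mon Q) \<noteq> 0"
    using lookup_mult_lead[of P Q] lead_coeff_nz[of P] lead_coeff_nz[of Q] by simp
  then have "P * Q \<noteq> 0" by (metis lookup_zero)
  then show ?thesis using False by simp
qed auto

lemma mpoly_mult_left_cancel: "P \<noteq> 0 \<Longrightarrow> P * Q = P * R \<longleftrightarrow> Q = R" for P :: "'v::countable mpoly"
proof -
  assume "P \<noteq> 0"
  moreover have "P * Q = P * R \<longleftrightarrow> P * (Q - R) = 0" by (simp add: algebra_simps)
  ultimately show ?thesis by (simp add: mpoly_mult_eq_0)
qed

lemma pweight_mult: "pweight (P * Q) = pweight P * pweight Q" for P Q :: "'v::countable mpoly"
proof (cases "P = 0 \<or> Q = 0")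
  case False
  then have nz: "P \<noteq> 0" "Q \<noteq> 0" by auto
  have "lead_mon P + lead_mon Q \<in> keys (P * Q)"
    using lookup_mult_lead[OF nz] lead_coeff_nz[OF nz(1)] lead_coeff_nz[OF nz(2)] by (simp add: in_keys_iff)
  then have "pweight P * pweight Q \<le> pweight (P * Q)"
    using mweight_le_pweight[of "lead_mon P + lead_mon Q" "P * Q"] lead_mon(2)[OF nz(1)] lead_mon(2)[OF nz(2)]
    by (simp add: mweight_add)
  moreover have "pweight (P * Q) \<le> pweight P * pweight Q"
    by (rule pweight_le) (auto dest!: keys_mult_mpoly simp: mweight_add intro!: mult_mono mweight_le_pweight)
  ultimately show ?thesis by simp
qed auto

text \<open>The division step: the coefficient \<open>c\<close> makes the leading terms cancel, and no monomial of greater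
weight appears.\<close>

lemma lead_cancel:
  fixes P Q :: "'v::countable mpoly"
  assumes "P \<noteq> 0" "Q \<noteq> 0" "lead_mon P = k + lead_mon Q"
  obtains c where "pweight (P - single k c * Q) < pweight P"
proof -
  define c where "c = lookup P (lead_mon P) / lookup Q (lead_mon Q)"
  let ?S = "single k c"
  have "c \<noteq> 0" using lead_coeff_nz[OF assms(1)] lead_coeff_nz[OF assms(2)] by (simp add: c_def)
  then have Snz: "?S \<noteq> 0" and ks: "keys ?S = {k}" by (metis lookup_single_eq lookup_zero, simp)
  have lS: "lead_mon ?S = k" using lead_mon(1)[OF Snz] unfolding ks by blast
  have wS: "pweight ?S = mweight k" using lead_mon(2)[OF Snz] unfolding lS by (rule sym)
  have w: "pweight (?S * Q) = pweight P"
    unfolding pweight_mult wS lead_mon(2)[OF assms(1), symmetric] assms(3) mweight_add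
    by (simp only: lead_mon(2)[OF assms(2)])
  have "lookup (?S * Q) (lead_mon P) = c * lookup Q (lead_mon Q)"
    using lookup_mult_lead[OF Snz assms(2)] unfolding lS assms(3) by simp
  then have l: "lookup (P - ?S * Q) (lead_mon P) = 0"
    using lead_coeff_nz[OF assms(2)] by (simp add: lookup_minus c_def)
  have "pweight (P - ?S * Q) < pweight P"
  proof (cases "P - ?S * Q = 0")
    case True then show ?thesis using pweight_pos[OF assms(1)] by simp
  next
    case False
    let ?D = "P - ?S * Q"
    have k: "lead_mon ?D \<in> keys ?D" by (rule lead_mon(1)[OF False])
    then have "lead_mon ?D \<in> keys P \<union> keys (?S * Q)"
      by (rule subsetD[OF Poly_Mapping.keys_diff])
    then have "mweight (lead_mon ?D) \<le> pweight P"
      using mweight_le_pweight[of "lead_mon ?D" P] mweight_le_pweight[of "lead_mon ?D" "?S * Q"]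
      unfolding w by (elim UnE) simp_all
    moreover have "lead_mon ?D \<noteq> lead_mon P" using l k by (auto simp: in_keys_iff)
    then have "mweight (lead_mon ?D) \<noteq> mweight (lead_mon P)" unfolding mweight_inj .
    ultimately show ?thesis unfolding lead_mon(2)[OF False] lead_mon(2)[OF assms(1)] by linarith
  qed
  then show ?thesis by (rule that)
qed

text \<open>Substituting for each variable the \<open>T\<close>-th power of its prime makes the monomial \<open>m\<close> equal to
\<open>mweight m ^ T\<close>. As \<open>T\<close> grows, the leading term outweighs the sum of all others.\<close>

lemma peval_identity:
  fixes P :: "'v::countable mpoly"
  assumes "\<And>x. peval P x = 0"
  shows "P = 0"
proof (rule ccontr)
  assume nz: "P \<noteq> 0"
  let ?l = "lookup P" and ?w = "real (pweight P)" and ?M = "lead_mon P"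
  let ?K = "keys P - {?M}"
  define C where "C = (\<Sum>m\<in>?K. cmod (?l m))"
  have w1: "pweight P \<ge> 1" using pweight_pos[OF nz] by simp
  have bound: "cmod (?l ?M) * ?w ^ T \<le> C * (?w - 1) ^ T" for T
  proof -
    let ?x = "\<lambda>v. of_nat (var_prime v ^ T) :: complex"
    have me: "meval m ?x = of_nat (mweight m ^ T)" for m :: "'v \<Rightarrow>\<^sub>0 nat"
      by (simp add: meval_def mweight_def prod_power_distrib power_mult [symmetric] mult.commute)
    have "0 = peval P ?x" by (simp only: assms)
    also have "\<dots> = ?l ?M * meval ?M ?x + (\<Sum>m\<in>?K. ?l m * meval m ?x)"
      unfolding peval_def using lead_mon(1)[OF nz] by (subst sum.remove[of _ ?M]) auto
    finally have e: "?l ?M * meval ?M ?x = - (\<Sum>m\<in>?K. ?l m * meval m ?x)"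
      by (simp add: add_eq_0_iff2)
    have "cmod (?l ?M) * ?w ^ T = cmod (?l ?M * meval ?M ?x)"
      unfolding me using lead_mon(2)[OF nz] by (simp add: norm_mult norm_power)
    also have "\<dots> \<le> (\<Sum>m\<in>?K. cmod (?l m * meval m ?x))"
      unfolding e norm_minus_cancel by (rule norm_sum)
    also have "\<dots> \<le> (\<Sum>m\<in>?K. cmod (?l m) * (?w - 1) ^ T)"
    proof (rule sum_mono)
      fix m assume m: "m \<in> ?K"
      then have "mweight m \<le> pweight P" using mweight_le_pweight[of m P] by simp
      moreover have "mweight m \<noteq> mweight ?M" unfolding mweight_inj using m by simp
      then have "mweight m \<noteq> pweight P" unfolding lead_mon(2)[OF nz] .
      ultimately have "mweight m < pweight P" by simp
      then have "real (mweight m) \<le> ?w - 1" by linarith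
      then have "real (mweight m) ^ T \<le> (?w - 1) ^ T" by (intro power_mono) auto
      then show "cmod (?l m * meval m ?x) \<le> cmod (?l m) * (?w - 1) ^ T"
        unfolding me by (simp add: norm_mult norm_power mult_left_mono)
    qed
    finally show ?thesis by (simp add: C_def sum_distrib_right)
  qed
  have lpos: "cmod (?l ?M) > 0" using lead_coeff_nz[OF nz] by simp
  show False
  proof (cases "pweight P = 1")
    case True
    then show False using bound[of 1] lpos by simp
  next
    case False
    then have w2: "?w > 1" using w1 by linarith
    define r where "r = ?w / (?w - 1)"
    have r1: "r > 1" using w2 by (simp add: r_def)
    obtain T where T: "C / cmod (?l ?M) < r ^ T" using real_arch_pow[OF r1] by blast
    have "C < cmod (?l ?M) * r ^ T" using T lpos by (simp add: field_simps)
    then have "C * (?w - 1) ^ T < cmod (?l ?M) * r ^ T * (?w - 1) ^ T"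
      using w2 by (intro mult_strict_right_mono) auto
    also have "\<dots> = cmod (?l ?M) * ?w ^ T" using w2 by (simp add: r_def power_divide)
    finally show False using bound[of T] by simp
  qed
qed

lemma peval_minus: "peval (P - Q) x = peval P x - peval Q x"
  using peval_add[of "P - Q" Q x] by simp

lemma peval_uminus: "peval (- P) x = - peval P x"
  using peval_minus[of 0 P x] by simp

lemma peval_power: "peval (P ^ k) x = peval P x ^ k"
  by (induction k) (auto simp: peval_mult)

lemma peval_eqI: "(\<And>x. peval P x = peval Q x) \<Longrightarrow> P = Q" for P Q :: "'v::countable mpoly"
  using peval_identity[of "P - Q"] by (simp add: peval_minus)

lemma peval_nonzero: "P \<noteq> 0 \<Longrightarrow> \<exists>x. peval P x \<noteq> 0" for P :: "'v::countable mpoly"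
  using peval_identity by blast

section \<open>The ascending chain condition\<close>

text \<open>Dickson's lemma, by passing for one variable after the other to a subsequence on which the
exponent of that variable is weakly increasing.\<close>

lemma dickson_seq:
  fixes f :: "nat \<Rightarrow> 'v::finite \<Rightarrow> nat"
  shows "\<exists>i j. i < j \<and> (\<forall>v. f i v \<le> f j v)"
proof -
  have "\<exists>g :: nat \<Rightarrow> nat. strict_mono g \<and> (\<forall>v\<in>V. \<forall>i j. i \<le> j \<longrightarrow> f (g i) v \<le> f (g j) v)"
    if "finite V" for V
    using that
  proof (induction V)
    case empty
    show ?case by (rule exI[of _ id]) (simp add: strict_mono_def)
  next
    case (insert v V)
    from insert.IH obtain g :: "nat \<Rightarrow> nat" where g: "strict_mono g"
      "\<forall>v\<in>V. \<forall>i j. i \<le> j \<longrightarrow> f (g i) v \<le> f (g j) v" by (elim exE conjE)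
    \<comment> \<open>\<open>A k\<close> is a place from \<open>k\<close> onwards where the exponent of \<open>v\<close> is minimal.\<close>
    define A where "A k = (SOME i. i \<ge> k \<and> (\<forall>j\<ge>k. f (g i) v \<le> f (g j) v))" for k
    have A: "A k \<ge> k" "\<And>j. j \<ge> k \<Longrightarrow> f (g (A k)) v \<le> f (g j) v" for k
    proof -
      have "\<exists>i. i \<ge> k \<and> (\<forall>j. j \<ge> k \<longrightarrow> f (g i) v \<le> f (g j) v)"
        using ex_has_least_nat[of "\<lambda>i. i \<ge> k" k "\<lambda>i. f (g i) v"] by auto
      from someI_ex[OF this] show "A k \<ge> k" "\<And>j. j \<ge> k \<Longrightarrow> f (g (A k)) v \<le> f (g j) v"
        by (auto simp: A_def)
    qed
    define h where "h = rec_nat (A 0) (\<lambda>_ i. A (Suc i))"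
    have h0: "h 0 = A 0" and hS: "h (Suc i) = A (Suc (h i))" for i by (auto simp: h_def)
    have sm: "strict_mono h" unfolding strict_mono_Suc_iff hS using A(1) Suc_le_lessD by blast
    have min: "f (g (h i)) v \<le> f (g j) v" if "j \<ge> h i" for i j
    proof (cases i)
      case 0 then show ?thesis using A(2)[of 0 j] by (simp add: h0)
    next
      case (Suc i')
      have "Suc (h i') \<le> h i" unfolding Suc hS by (rule A(1))
      then have "j \<ge> Suc (h i')" using that by linarith
      then show ?thesis using A(2)[of "Suc (h i')" j] by (simp add: Suc hS)
    qed
    have "strict_mono (g \<circ> h)" using g(1) sm by (simp add: strict_mono_def)
    moreover have "\<forall>u\<in>insert v V. \<forall>i j. i \<le> j \<longrightarrow> f ((g \<circ> h) i) u \<le> f ((g \<circ> h) j) u"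
      using g(2) min strict_mono_less_eq[OF sm] by auto
    ultimately show ?case by blast
  qed
  from this[of UNIV] obtain g :: "nat \<Rightarrow> nat" where "strict_mono g" "\<forall>v. \<forall>i j. i \<le> j \<longrightarrow> f (g i) v \<le> f (g j) v" by auto
  then have "g 0 < g 1" "\<forall>v. f (g 0) v \<le> f (g 1) v" by (auto simp: strict_mono_def)
  then show ?thesis by blast
qed

lemma mon_le_split:
  assumes "\<And>v. lookup m v \<le> lookup m' v"
  obtains k :: "'v \<Rightarrow>\<^sub>0 nat" where "m' = k + m"
proof
  show "m' = (m' - m) + m"
    by (rule poly_mapping_eqI) (use assms in \<open>simp add: lookup_add lookup_minus\<close>)
qed

text \<open>Hilbert's basis theorem as a statement on sequences. If it failed, choose in each coset of \<open>h k\<close>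
modulo its predecessors an element \<open>r k\<close> of least weight; by Dickson's lemma one leading monomial
divides a later one, and the division step contradicts minimality.\<close>

lemma noetherian_seq:
  fixes h :: "nat \<Rightarrow> 's::finite mpoly"
  shows "\<exists>k c. h k = (\<Sum>i<k. c i * h i)"
proof (rule ccontr)
  assume "\<nexists>k c. h k = (\<Sum>i<k. c i * h i)"
  then have ne: "h k - (\<Sum>i<k. c i * h i) \<noteq> 0" for k c by auto
  define c where "c k = (ARG_MIN (\<lambda>c. pweight (h k - (\<Sum>i<k. c i * h i))) c. True)" for k
  define r where "r k = h k - (\<Sum>i<k. c k i * h i)" for k
  have rmin: "pweight (r k) \<le> pweight (h k - (\<Sum>i<k. b i * h i))" for k b
    unfolding r_def c_def using arg_min_nat_le[of "\<lambda>_. True" b] by simp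
  have rnz: "r k \<noteq> 0" for k unfolding r_def by (rule ne)
  obtain i j where ij: "i < j" "\<forall>v. lookup (lead_mon (r i)) v \<le> lookup (lead_mon (r j)) v"
    using dickson_seq[of "\<lambda>k. lookup (lead_mon (r k))"] by blast
  obtain m where "lead_mon (r j) = m + lead_mon (r i)" using mon_le_split ij(2) by metis
  from lead_cancel[OF rnz rnz this] obtain a where
    a: "pweight (r j - single m a * r i) < pweight (r j)" by blast
  let ?s = "single m a"
  \<comment> \<open>The coefficients of \<open>r j - ?s * r i\<close>, which lies in the coset of \<open>h j\<close> because \<open>i < j\<close>.\<close>
  define b where "b l = c j l + (if l = i then ?s else if l < i then - ?s * c i l else 0)" for l
  have "(\<Sum>l<j. b l * h l) = (\<Sum>l<j. c j l * h l)
      + (\<Sum>l<j. (if l = i then ?s else if l < i then - ?s * c i l else 0) * h l)"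
    by (simp add: b_def algebra_simps sum.distrib)
  also have "(\<Sum>l<j. (if l = i then ?s else if l < i then - ?s * c i l else 0) * h l)
      = (\<Sum>l<Suc i. (if l = i then ?s else if l < i then - ?s * c i l else 0) * h l)"
    using ij(1) by (intro sum.mono_neutral_right) auto
  also have "\<dots> = ?s * r i"
    by (simp add: r_def algebra_simps sum_distrib_left sum_negf)
  finally have "h j - (\<Sum>l<j. b l * h l) = r j - ?s * r i" by (simp add: r_def)
  then show False using rmin[of j b] a by simp
qed

section \<open>Unique factorization and elimination of a variable\<close>

definition vars_in :: "'v set \<Rightarrow> 'v mpoly \<Rightarrow> bool" where
  "vars_in V P \<longleftrightarrow> (\<forall>m\<in>keys P. keys m \<subseteq> V)"

text \<open>The coefficient of \<open>y\<^sup>k\<close> when \<open>P\<close> is read as a polynomial in \<open>y\<close> over the other variables.\<close>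

definition ycoeff :: "'v \<Rightarrow> nat \<Rightarrow> 'v mpoly \<Rightarrow> 'v mpoly" where
  "ycoeff y k P = (\<Sum>m\<in>keys P. if lookup m y = k
     then single (m - single y k) (lookup P m) else 0)"

lemma lookup_ycoeff:
  "lookup (ycoeff y k P) m =
     (if lookup m y = 0 then lookup P (m + single y k) else 0)"
proof -
  have iff: "lookup m' y = k \<and> m' - single y k = m \<longleftrightarrow>
      lookup m y = 0 \<and> m' = m + single y k" for m'
  proof
    assume a: "lookup m' y = k \<and> m' - single y k = m"
    have "m' = m + single y k"
      by (rule poly_mapping_eqI) (use a in \<open>auto simp: lookup_add lookup_minus lookup_single when_def\<close>)
    then show "lookup m y = 0 \<and> m' = m + single y k"
      using a by (auto simp: lookup_add)
  next
    assume a: "lookup m y = 0 \<and> m' = m + single y k"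
    then show "lookup m' y = k \<and> m' - single y k = m"
      by (simp add: lookup_add)
  qed
  have "lookup (ycoeff y k P) m = (\<Sum>m'\<in>keys P.
      if lookup m' y = k \<and> m' - single y k = m then lookup P m' else 0)"
    unfolding ycoeff_def lookup_sum by (intro sum.cong refl) (auto simp: lookup_single when_def)
  also have "\<dots> = (\<Sum>m'\<in>keys P.
      if m' = m + single y k then if lookup m y = 0 then lookup P m' else 0 else 0)"
    unfolding iff by (intro sum.cong refl) auto
  finally show ?thesis by (simp add: sum.delta in_keys_iff)
qed

lemma ycoeff_add: "ycoeff y k (P + Q) = ycoeff y k P + ycoeff y k Q"
  by (rule poly_mapping_eqI) (simp add: lookup_ycoeff lookup_add)

lemma ycoeff_minus: "ycoeff y k (P - Q) = ycoeff y k P - ycoeff y k Q"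
  by (rule poly_mapping_eqI) (simp add: lookup_ycoeff lookup_minus)

lemma ycoeff_0 [simp]: "ycoeff y k 0 = 0"
  by (rule poly_mapping_eqI) (simp add: lookup_ycoeff)

lemma ycoeff_sum: "ycoeff y k (sum f A) = (\<Sum>i\<in>A. ycoeff y k (f i))"
  by (induction A rule: infinite_finite_induct) (auto simp: ycoeff_add)

lemma ycoeff_single: "ycoeff y k (single m c) =
   (if lookup m y = k then single (m - single y k) c else 0)"
  by (simp add: ycoeff_def)

lemma minus_add_split:
  assumes "lookup m y = i" "lookup m' y = j"
  shows "m + m' - single y (i + j) =
    (m - single y i) + (m' - single y (j::nat))"
  by (rule poly_mapping_eqI) (use assms in \<open>auto simp: lookup_add lookup_minus lookup_single when_def\<close>)

lemma ycoeff_mult: "ycoeff y k (P * Q) = (\<Sum>i\<le>k. ycoeff y i P * ycoeff y (k - i) Q)"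
proof -
  have s: "ycoeff y k (single (m + m') (a * b)) =
     (\<Sum>i\<le>k. ycoeff y i (single m a) * ycoeff y (k - i) (single m' b))" for m m' and a b :: complex
  proof -
    let ?i = "lookup m y" and ?j = "lookup m' y"
    have "(\<Sum>i\<le>k. ycoeff y i (single m a) * ycoeff y (k - i) (single m' b)) =
       (\<Sum>i\<le>k. if i = ?i then (if ?j = k - i then single (m - single y i) a *
          single (m' - single y (k - i)) b else 0) else 0)"
      by (intro sum.cong refl) (simp add: ycoeff_single)
    also have "\<dots> = (if ?i + ?j = k then single (m + m' - single y k) (a * b) else 0)"
      using minus_add_split[of m y ?i m' ?j] by (auto simp: sum.delta mult_single)
    finally show ?thesis by (simp add: ycoeff_single lookup_add)
  qed
  have r: "ycoeff y i P = (\<Sum>m\<in>keys P. ycoeff y i (single m (lookup P m)))" for i and P :: "'a mpoly"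
    by (subst poly_mapping_sum_single[of P, symmetric]) (rule ycoeff_sum)
  have "ycoeff y k (P * Q) = (\<Sum>m\<in>keys P. \<Sum>m'\<in>keys Q.
      \<Sum>i\<le>k. ycoeff y i (single m (lookup P m)) *
              ycoeff y (k - i) (single m' (lookup Q m')))"
    by (simp add: mpoly_mult_expand ycoeff_sum s)
  also have "\<dots> = (\<Sum>i\<le>k. \<Sum>m\<in>keys P. \<Sum>m'\<in>keys Q.
      ycoeff y i (single m (lookup P m)) *
              ycoeff y (k - i) (single m' (lookup Q m')))"
    by (simp only: sum.swap[where B = "{..k}"])
  also have "\<dots> = (\<Sum>i\<le>k. ycoeff y i P * ycoeff y (k - i) Q)"
    by (intro sum.cong refl) (simp add: r[of _ P] r[of _ Q] sum_product)
  finally show ?thesis .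
qed

definition ydeg :: "'v \<Rightarrow> 'v mpoly \<Rightarrow> nat" where
  "ydeg y P = Max (insert 0 ((\<lambda>m. lookup m y) ` keys P))"

lemma lookup_le_ydeg: "m \<in> keys P \<Longrightarrow> lookup m y \<le> ydeg y P"
  by (simp add: ydeg_def)

lemma ycoeff_gt_ydeg: "ydeg y P < k \<Longrightarrow> ycoeff y k P = 0"
proof (rule poly_mapping_eqI)
  fix m assume k: "ydeg y P < k"
  have "m + single y k \<notin> keys P"
  proof
    assume "m + single y k \<in> keys P"
    from lookup_le_ydeg[OF this, of y] show False using k by (simp add: lookup_add)
  qed
  then show "lookup (ycoeff y k P) m = lookup 0 m"
    by (simp add: lookup_ycoeff in_keys_iff)
qed

lemma ycoeff_lookup_nz: "m \<in> keys P \<Longrightarrow> ycoeff y (lookup m y) P \<noteq> 0"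
proof
  assume m: "m \<in> keys P" and 0: "ycoeff y (lookup m y) P = 0"
  let ?k = "lookup m y"
  have "(m - single y ?k) + single y ?k = m"
    by (rule poly_mapping_eqI) (auto simp: lookup_add lookup_minus lookup_single when_def)
  then have "lookup (ycoeff y ?k P) (m - single y ?k) = lookup P m"
    by (simp add: lookup_ycoeff lookup_minus)
  then show False using 0 m by (simp add: in_keys_iff)
qed

lemma ycoeff_ydeg_nz:
  assumes "P \<noteq> 0" shows "ycoeff y (ydeg y P) P \<noteq> 0"
proof -
  have "ydeg y P \<in> insert 0 ((\<lambda>m. lookup m y) ` keys P)"
    unfolding ydeg_def by (rule Max_in) auto
  moreover have "keys P \<noteq> {}" using assms by simp
  then obtain m where m: "m \<in> keys P" by (meson ex_in_conv)
  ultimately consider (z) "ydeg y P = 0" | (p) m where "m \<in> keys P" "ydeg y P = lookup m y"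
    by (elim insertE imageE) simp_all
  then show ?thesis
  proof cases
    case z then show ?thesis using lookup_le_ydeg[OF m, of y] ycoeff_lookup_nz[OF m, of y] by simp
  next
    case p then show ?thesis using ycoeff_lookup_nz by metis
  qed
qed

lemma ycoeff_ext: "(\<And>k. ycoeff y k P = ycoeff y k Q) \<Longrightarrow> P = Q"
  using ycoeff_ydeg_nz[of "P - Q" y] by (auto simp: ycoeff_minus)

lemma ydeg_less:
  assumes "P \<noteq> 0" "\<And>k. k \<ge> n \<Longrightarrow> ycoeff y k P = 0" shows "ydeg y P < n"
  using assms ycoeff_ydeg_nz[of P y] by (meson not_le)

lemma vars_in_lookup: "vars_in V P \<Longrightarrow> m \<in> keys P \<Longrightarrow> u \<notin> V \<Longrightarrow> lookup m u = 0"
  unfolding vars_in_def by (metis in_keys_iff subsetD)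

lemma vars_in_ydeg: "vars_in V P \<longleftrightarrow> (\<forall>u. u \<notin> V \<longrightarrow> ydeg u P = 0)"
proof
  assume "vars_in V P"
  then have "lookup m u = 0" if "u \<notin> V" "m \<in> keys P" for u m
    using vars_in_lookup that by metis
  moreover have "ydeg u P \<in> insert 0 ((\<lambda>m. lookup m u) ` keys P)" for u
    unfolding ydeg_def by (rule Max_in) auto
  ultimately show "\<forall>u. u \<notin> V \<longrightarrow> ydeg u P = 0" by (metis imageE insertE)
next
  assume a: "\<forall>u. u \<notin> V \<longrightarrow> ydeg u P = 0"
  show "vars_in V P" unfolding vars_in_def
  proof (intro ballI subsetI)
    fix m u assume m: "m \<in> keys P" and u: "u \<in> keys m"
    show "u \<in> V"
    proof (rule ccontr)
      assume "u \<notin> V"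
      then have "lookup m u = 0" using a lookup_le_ydeg[OF m, of u] by simp
      then show False using u by (simp add: in_keys_iff)
    qed
  qed
qed

lemma vars_in_mono: "vars_in V P \<Longrightarrow> V \<subseteq> W \<Longrightarrow> vars_in W P"
  by (auto simp: vars_in_ydeg)

lemma vars_in_UNIV [simp]: "vars_in UNIV P"
  by (simp add: vars_in_def)

lemma vars_in_0 [simp]: "vars_in V 0"
  by (simp add: vars_in_def)

lemma vars_in_single: "keys m \<subseteq> V \<Longrightarrow> vars_in V (single m c)"
  by (simp add: vars_in_def)

lemma vars_in_add: "vars_in V P \<Longrightarrow> vars_in V Q \<Longrightarrow> vars_in V (P + Q)"
  unfolding vars_in_def using Poly_Mapping.keys_add[of P Q] by (meson UnE subsetD)

lemma vars_in_minus: "vars_in V P \<Longrightarrow> vars_in V Q \<Longrightarrow> vars_in V (P - Q)"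
  unfolding vars_in_def using Poly_Mapping.keys_diff[of P Q] by (meson UnE subsetD)

lemma vars_in_mult: "vars_in V P \<Longrightarrow> vars_in V Q \<Longrightarrow> vars_in V (P * Q)"
  unfolding vars_in_def
proof (intro ballI)
  fix m assume P: "\<forall>m\<in>keys P. keys m \<subseteq> V" and Q: "\<forall>m\<in>keys Q. keys m \<subseteq> V"
    and m: "m \<in> keys (P * Q)"
  obtain a b where ab: "a \<in> keys P" "b \<in> keys Q" "m = a + b" using keys_mult_mpoly[OF m] by auto
  show "keys m \<subseteq> V"
    unfolding ab(3) by (rule subset_trans[OF Poly_Mapping.keys_add]) (use P Q ab in auto)
qed

lemma ydeg_mult:
  fixes P Q :: "'v::countable mpoly"
  assumes "P \<noteq> 0" "Q \<noteq> 0" shows "ydeg y P + ydeg y Q \<le> ydeg y (P * Q)"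
proof -
  let ?a = "ydeg y P" and ?b = "ydeg y Q"
  have "ycoeff y (?a + ?b) (P * Q) = (\<Sum>i\<le>?a + ?b. if i = ?a then ycoeff y ?a P * ycoeff y ?b Q else 0)"
    unfolding ycoeff_mult
  proof (intro sum.cong refl)
    fix i assume "i \<in> {..?a + ?b}"
    consider "i = ?a" | "i > ?a" | "?a + ?b - i > ?b" using \<open>i \<in> {..?a + ?b}\<close> by fastforce
    then show "ycoeff y i P * ycoeff y (?a + ?b - i) Q = (if i = ?a then ycoeff y ?a P * ycoeff y ?b Q else 0)"
      by cases (auto simp: ycoeff_gt_ydeg)
  qed
  also have "\<dots> \<noteq> 0" using ycoeff_ydeg_nz[OF assms(1), of y] ycoeff_ydeg_nz[OF assms(2), of y]
    by (simp add: mpoly_mult_eq_0)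
  finally show ?thesis using ycoeff_gt_ydeg[of y "P * Q"] by (meson not_le)
qed

lemma vars_in_factor:
  fixes P Q :: "'v::countable mpoly"
  assumes "vars_in V (P * Q)" "P \<noteq> 0" "Q \<noteq> 0" shows "vars_in V P" "vars_in V Q"
  using assms(1) ydeg_mult[OF assms(2,3)] unfolding vars_in_ydeg by (metis add_is_0 le_0_eq)+

lemma ycoeff_vars: "vars_in (insert y V) P \<Longrightarrow> y \<notin> V \<Longrightarrow> vars_in V (ycoeff y k P)"
  unfolding vars_in_def
proof (intro ballI subsetI)
  fix m v assume P: "\<forall>m\<in>keys P. keys m \<subseteq> insert y V" and y: "y \<notin> V"
   and m: "m \<in> keys (ycoeff y k P)" and v: "v \<in> keys m"
  have m0: "lookup m y = 0" and k: "m + single y k \<in> keys P"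
    using m by (auto simp: in_keys_iff lookup_ycoeff split: if_splits)
  have "v \<in> keys (m + single y k)" using v by (simp add: in_keys_iff lookup_add)
  then have "v \<in> insert y V" using P k by (meson subsetD)
  moreover have "v \<noteq> y" using v m0 by (auto simp: in_keys_iff)
  ultimately show "v \<in> V" by simp
qed

lemma ycoeff_vars': "vars_in (- {y}) (ycoeff y k P)"
proof -
  have "insert y (- {y}) = UNIV" by auto
  then show ?thesis by (intro ycoeff_vars) simp_all
qed

lemma ycoeff_free: "vars_in V P \<Longrightarrow> y \<notin> V \<Longrightarrow> ycoeff y k P = (if k = 0 then P else 0)"
proof (rule poly_mapping_eqI)
  fix m assume P: "vars_in V P" "y \<notin> V"
  have 0: "lookup P m = 0" if "lookup m y \<noteq> 0" for m
    using vars_in_lookup[OF P(1) _ P(2)] that by (metis in_keys_iff)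
  show "lookup (ycoeff y k P) m = lookup (if k = 0 then P else 0) m"
    using 0[of m] 0[of "m + single y k"] by (auto simp: lookup_ycoeff lookup_add)
qed

lemma ycoeff_mult_free: "vars_in V c \<Longrightarrow> y \<notin> V \<Longrightarrow> ycoeff y k (c * P) = c * ycoeff y k P"
  by (simp add: ycoeff_mult ycoeff_free if_distrib if_distribR sum.delta cong: if_cong)

lemma ycoeff_mult_Y: "ycoeff y k (single (single y j) 1 * P) = (if j \<le> k then ycoeff y (k - j) P else 0)"
  (is "ycoeff y k (?Y * P) = _")
proof -
  have "ycoeff y k (?Y * P) = (\<Sum>i\<le>k. if i = j then ycoeff y (k - i) P else 0)"
    unfolding ycoeff_mult by (intro sum.cong refl) (simp add: ycoeff_single)
  then show ?thesis by simp
qed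

lemma ycoeff_expand: "P = (\<Sum>i\<le>ydeg y P. single (single y i) 1 * ycoeff y i P)"
proof (rule ycoeff_ext[of y])
  fix k
  have c: "ycoeff y j (ycoeff y i P) = (if j = 0 then ycoeff y i P else 0)" for i j
    by (rule ycoeff_free[OF ycoeff_vars']) simp
  have "ycoeff y k (\<Sum>i\<le>ydeg y P. single (single y i) 1 * ycoeff y i P)
    = (\<Sum>i\<le>ydeg y P. if i = k then ycoeff y k P else 0)"
    unfolding ycoeff_sum ycoeff_mult_Y c by (intro sum.cong refl) auto
  also have "\<dots> = ycoeff y k P" using ycoeff_gt_ydeg[of y P k] by simp
  finally show "ycoeff y k P = ycoeff y k (\<Sum>i\<le>ydeg y P. single (single y i) 1 * ycoeff y i P)" by simp
qed

lemma mweight_eq_1: "mweight m = 1 \<longleftrightarrow> m = 0"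
  using mweight_inj[of m 0] by (simp add: mweight_def[of 0])

text \<open>Weights are multiplicative, and the only monomial of weight \<open>1\<close> is the constant one.\<close>

lemma is_unit_mpoly: "P dvd 1 \<longleftrightarrow> pweight P = 1" for P :: "'v::countable mpoly"
proof
  have one: "pweight (1 :: 'v mpoly) = 1" by (simp add: pweight_def mweight_def)
  assume "P dvd 1"
  then obtain Q where "1 = P * Q" by (rule dvdE)
  then have "pweight P * pweight Q = 1" using one pweight_mult by metis
  then show "pweight P = 1" by simp
next
  assume w: "pweight P = 1"
  then have nz: "P \<noteq> 0" by auto
  have k: "m = 0" if "m \<in> keys P" for m
  proof -
    have "mweight m = 1" using mweight_le_pweight[OF that] w mweight_pos[of m] by linarith
    then show ?thesis unfolding mweight_eq_1 .
  qed
  let ?c = "lookup P 0"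
  have P: "P = single 0 ?c"
    by (rule poly_mapping_eqI) (use k in \<open>auto simp: lookup_single when_def in_keys_iff\<close>)
  have c: "?c \<noteq> 0" using P nz by (metis single_zero)
  have "P * single 0 (inverse ?c) = 1"
    by (subst P) (simp add: mult_single c)
  then show "P dvd 1" by (metis dvdI)
qed

lemma irreducible_not_unit_mpoly: "irreducible P \<Longrightarrow> pweight P \<noteq> 1" for P :: "'v::countable mpoly"
  using is_unit_mpoly irreducible_not_unit by blast

lemma ex_irreducible_factor:
  fixes c :: "'v::countable mpoly"
  assumes "c \<noteq> 0" "\<not> c dvd 1" shows "\<exists>p. irreducible p \<and> p dvd c"
  using assms
proof (induction "pweight c" arbitrary: c rule: less_induct)
  case less
  show ?case
  proof (cases "irreducible c")
    case False
    then obtain a b where ab: "c = a * b" "\<not> a dvd 1" "\<not> b dvd 1"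
      using less.prems by (auto simp: irreducible_def)
    then have nz: "a \<noteq> 0" "b \<noteq> 0" using less.prems by auto
    have "pweight b > 1" using ab(3) pweight_pos[OF nz(2)] by (simp add: is_unit_mpoly)
    then have "pweight a < pweight c" using pweight_pos[OF nz(1)] by (simp add: ab(1) pweight_mult)
    from less.hyps[OF this nz(1) ab(2)] show ?thesis unfolding ab(1) by (meson dvd_mult2)
  qed auto
qed

text \<open>Unique factorization for the polynomials in the variables \<open>V\<close>, phrased inside the full polynomial
ring in order to allow induction on \<open>V\<close>.\<close>

definition primes_within :: "'v set \<Rightarrow> bool" where
  "primes_within V \<longleftrightarrow> (\<forall>F G H :: 'v mpoly. irreducible F \<and> vars_in V F \<and> vars_in V G \<and> vars_in V H \<and>
     F dvd G * H \<longrightarrow> F dvd G \<or> F dvd H)"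

context
  fixes V :: "'v::countable set" and y :: 'v
  assumes PV: "primes_within V" and yV: "y \<notin> V"
begin

text \<open>Gauss: if \<open>F\<close> divides neither \<open>G\<close> nor \<open>H\<close>, look at the first coefficient of each that it does not
divide; their product is, modulo \<open>F\<close>, a coefficient of \<open>G H\<close>.\<close>

lemma gauss_lemma:
  assumes F: "irreducible F" "vars_in V F" and G: "vars_in (insert y V) G" and H: "vars_in (insert y V) H"
    and dvd: "F dvd G * H"
  shows "F dvd G \<or> F dvd H"
proof (rule ccontr)
  assume n: "\<not> (F dvd G \<or> F dvd H)"
  have ex: "\<exists>i. \<not> F dvd ycoeff y i P" if "\<not> F dvd P" for P
  proof (rule ccontr)
    assume "\<nexists>i. \<not> F dvd ycoeff y i P"
    then have "\<forall>i. \<exists>q. ycoeff y i P = F * q" by (auto simp: dvd_def)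
    then obtain q where q: "\<And>i. ycoeff y i P = F * q i" by metis
    have "P = (\<Sum>i\<le>ydeg y P. single (single y i) 1 * ycoeff y i P)" by (rule ycoeff_expand)
    also have "F dvd \<dots>" unfolding q by (intro dvd_sum) (simp add: mult.left_commute)
    finally show False using that by simp
  qed
  define i where "i = (LEAST i. \<not> F dvd ycoeff y i G)"
  define j where "j = (LEAST j. \<not> F dvd ycoeff y j H)"
  have i: "\<not> F dvd ycoeff y i G" "\<And>k. k < i \<Longrightarrow> F dvd ycoeff y k G"
    unfolding i_def using LeastI_ex[OF ex[of G]] n not_less_Least by blast+
  have j: "\<not> F dvd ycoeff y j H" "\<And>k. k < j \<Longrightarrow> F dvd ycoeff y k H"
    unfolding j_def using LeastI_ex[OF ex[of H]] n not_less_Least by blast+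
  obtain K where "G * H = F * K" using dvd by (rule dvdE)
  then have d1: "F dvd ycoeff y (i + j) (G * H)" by (simp add: ycoeff_mult_free[OF F(2) yV])
  have "ycoeff y (i + j) (G * H) = ycoeff y i G * ycoeff y j H + (\<Sum>k\<in>{..i+j} - {i}. ycoeff y k G * ycoeff y (i + j - k) H)"
    unfolding ycoeff_mult by (subst sum.remove[of _ i]) auto
  moreover have "F dvd (\<Sum>k\<in>{..i+j} - {i}. ycoeff y k G * ycoeff y (i + j - k) H)"
  proof (rule dvd_sum)
    fix k assume "k \<in> {..i+j} - {i}"
    then have "k < i \<or> i + j - k < j" by auto
    then show "F dvd ycoeff y k G * ycoeff y (i + j - k) H" using i(2) j(2) by (auto intro: dvd_mult dvd_mult2)
  qed
  ultimately have "F dvd ycoeff y i G * ycoeff y j H" using d1 by (simp add: dvd_add_left_iff)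
  then have "F dvd ycoeff y i G \<or> F dvd ycoeff y j H"
    using PV F ycoeff_vars[OF G yV] ycoeff_vars[OF H yV] unfolding primes_within_def by blast
  then show False using i(1) j(1) by blast
qed

text \<open>The irreducible factors of \<open>c\<close> are free of \<open>y\<close>, hence prime by Gauss, and none of them divides \<open>F\<close>; they
can be cancelled one at a time.\<close>

lemma cancel_free:
  assumes F: "irreducible F" "\<not> vars_in V F" "vars_in (insert y V) F"
    and c: "vars_in V c" "c \<noteq> 0" and H: "vars_in (insert y V) H" and dvd: "F dvd c * H"
  shows "F dvd H"
  using c dvd
proof (induction "pweight c" arbitrary: c rule: less_induct)
  case less
  show ?case
  proof (cases "c dvd 1")
    case True
    then obtain u where "1 = c * u" by (rule dvdE)
    then have "H = (c * H) * u" by (metis mult.commute mult.left_commute mult_1_right)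
    then show ?thesis using less.prems(3) by (metis dvd_mult2)
  next
    case False
    from ex_irreducible_factor[OF less.prems(2) False] obtain p where p: "irreducible p" "p dvd c" by blast
    then obtain c' where c': "c = p * c'" by (auto elim: dvdE)
    then have nz: "p \<noteq> 0" "c' \<noteq> 0" using less.prems(2) by auto
    have v: "vars_in V p" "vars_in V c'" using vars_in_factor[of V p c'] less.prems(1) c' nz by auto
    have mono: "vars_in (insert y V) P" if "vars_in V P" for P using vars_in_mono[OF that] by blast
    obtain K where K: "c * H = F * K" using less.prems(3) by (rule dvdE)
    have F0: "F \<noteq> 0" using F(1) by auto
    have Kv: "vars_in (insert y V) K"
    proof (cases "K = 0")
      case False
      have "vars_in (insert y V) (F * K)" unfolding K[symmetric] by (intro vars_in_mult mono less.prems H)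
      from vars_in_factor(2)[OF this F0 False] show ?thesis .
    qed simp
    have "p dvd F * K" unfolding K[symmetric] c' by simp
    then have "p dvd F \<or> p dvd K" using gauss_lemma[OF p(1) v(1) F(3) Kv] by blast
    moreover have "\<not> p dvd F"
    proof
      assume "p dvd F"
      then obtain u where u: "F = p * u" by (rule dvdE)
      then have "u dvd 1" using F(1) p(1) unfolding irreducible_def by blast
      then have "F dvd p" unfolding u by (metis dvd_refl mult_1_right mult_dvd_mono)
      then obtain w where w: "p = F * w" by (rule dvdE)
      then have "w \<noteq> 0" using nz by auto
      then have "vars_in V F" using vars_in_factor(1)[of V F w] v(1) F0 w by simp
      then show False using F(2) by simp
    qed
    ultimately obtain K' where K': "K = p * K'" by (auto elim: dvdE)
    have "p * (c' * H) = p * (F * K')" using K unfolding c' K' by (simp add: ac_simps)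
    then have "F dvd c' * H" using mpoly_mult_left_cancel[OF nz(1)] by simp
    moreover have "pweight p > 1" using irreducible_not_unit_mpoly[OF p(1)] pweight_pos[OF nz(1)] by simp
    then have "pweight c' < pweight c" unfolding c' pweight_mult using pweight_pos[OF nz(2)] by simp
    ultimately show ?thesis using less.hyps v(2) nz(2) by blast
  qed
qed

text \<open>Cancelling the prime factors of \<open>c\<close> one at a time, each from \<open>d\<close> or from \<open>Q\<close>, leaves a divisor \<open>d1\<close> of \<open>F\<close>;
what was removed from \<open>d\<close> is \<open>b\<close>.\<close>

lemma strip_free:
  assumes "vars_in V c" "c \<noteq> 0" "c * F = d * Q" "F \<noteq> 0" "vars_in (insert y V) F"
  shows "\<exists>d1 b. d = d1 * b \<and> vars_in V b \<and> d1 dvd F"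
  using assms
proof (induction "pweight c" arbitrary: c d Q rule: less_induct)
  case less
  show ?case
  proof (cases "c dvd 1")
    case True
    then obtain u where "1 = c * u" by (rule dvdE)
    then have "F = (c * F) * u" by (metis mult.commute mult.left_commute mult_1_right)
    then have "F = d * (Q * u)" unfolding less.prems(3) by (simp add: ac_simps)
    then have "d dvd F" by (metis dvdI)
    moreover have "vars_in V 1" by (simp add: vars_in_def)
    ultimately show ?thesis by (metis mult_1_right)
  next
    case False
    from ex_irreducible_factor[OF less.prems(2) False] obtain p where p: "irreducible p" "p dvd c" by blast
    then obtain c' where c': "c = p * c'" by (auto elim: dvdE)
    then have nz: "p \<noteq> 0" "c' \<noteq> 0" using less.prems(2) by auto
    have v: "vars_in V p" "vars_in V c'" using vars_in_factor[of V p c'] less.prems(1) c' nz by auto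
    have mono: "vars_in (insert y V) P" if "vars_in V P" for P using vars_in_mono[OF that] by blast
    have "c * F \<noteq> 0" using mpoly_mult_eq_0[of c F] less.prems(2,4) by blast
    then have dq: "d \<noteq> 0" "Q \<noteq> 0" unfolding less.prems(3) by auto
    have "vars_in (insert y V) (d * Q)" unfolding less.prems(3)[symmetric] by (intro vars_in_mult mono less.prems)
    note dqv = vars_in_factor[OF this dq]
    have "p dvd d * Q" unfolding less.prems(3)[symmetric] c' by (simp add: mult.assoc)
    then have "p dvd d \<or> p dvd Q" using gauss_lemma[OF p(1) v(1) dqv] by blast
    have "pweight p > 1" using irreducible_not_unit_mpoly[OF p(1)] pweight_pos[OF nz(1)] by simp
    then have w: "pweight c' < pweight c" unfolding c' pweight_mult using pweight_pos[OF nz(2)] by simp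
    from \<open>p dvd d \<or> p dvd Q\<close> show ?thesis
    proof
      assume "p dvd d"
      then obtain d' where d': "d = p * d'" by (rule dvdE)
      have "p * (c' * F) = p * (d' * Q)" using less.prems(3) unfolding c' d' by (simp add: ac_simps)
      then have "c' * F = d' * Q" using mpoly_mult_left_cancel[OF nz(1)] by simp
      from less.hyps[OF w v(2) nz(2) this less.prems(4,5)]
      obtain d1 b where "d' = d1 * b" "vars_in V b" "d1 dvd F" by blast
      then have "d = d1 * (p * b) \<and> vars_in V (p * b) \<and> d1 dvd F" by (simp add: d' ac_simps vars_in_mult v)
      then show ?thesis by blast
    next
      assume "p dvd Q"
      then obtain Q' where Q': "Q = p * Q'" by (rule dvdE)
      have "p * (c' * F) = p * (d * Q')" using less.prems(3) unfolding c' Q' by (simp add: ac_simps)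
      then have "c' * F = d * Q'" using mpoly_mult_left_cancel[OF nz(1)] by simp
      from less.hyps[OF w v(2) nz(2) this less.prems(4,5)] show ?thesis .
    qed
  qed
qed

text \<open>Let \<open>d\<close> be a nonzero combination of \<open>F\<close> and \<open>G\<close> of least degree in \<open>y\<close>. Pseudo-division shows that \<open>d\<close>
divides \<open>c F\<close> and \<open>c' G\<close> with \<open>c\<close>, \<open>c'\<close> free of \<open>y\<close>. Were \<open>y\<close> to occur in \<open>d\<close>, then \<open>F\<close> would divide \<open>d\<close> and
therefore \<open>G\<close>.\<close>

lemma elimination:
  assumes F: "irreducible F" "\<not> vars_in V F" "vars_in (insert y V) F"
    and G: "vars_in (insert y V) G" "\<not> F dvd G"
  shows "\<exists>a b. vars_in (insert y V) a \<and> vars_in (insert y V) b \<and> a * F + b * G \<noteq> 0 \<and> vars_in V (a * F + b * G)"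
proof -
  let ?T = "vars_in (insert y V)"
  have F0: "F \<noteq> 0" using F(1) by auto
  have one: "?T 1" by (simp add: vars_in_def)
  define I where "I = {a * F + b * G |a b. ?T a \<and> ?T b}"
  have IT: "?T P" if "P \<in> I" for P
    using that unfolding I_def by (auto intro!: vars_in_add vars_in_mult F G)
  have "1 * F + 0 * G \<in> I" "0 * F + 1 * G \<in> I" unfolding I_def using one vars_in_0[of "insert y V"] by blast+
  then have FI: "F \<in> I" and GI: "G \<in> I" by simp_all
  have Icl: "u * P - v * Q \<in> I" if PQ: "P \<in> I" "Q \<in> I" and uv: "?T u" "?T v" for P Q u v
  proof -
    obtain a b where P: "P = a * F + b * G" "?T a" "?T b" using PQ(1) unfolding I_def by blast
    obtain a' b' where Q: "Q = a' * F + b' * G" "?T a'" "?T b'" using PQ(2) unfolding I_def by blast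
    have "u * P - v * Q = (u * a - v * a') * F + (u * b - v * b') * G" by (simp add: P(1) Q(1) algebra_simps)
    moreover have "?T (u * a - v * a')" "?T (u * b - v * b')" by (intro vars_in_minus vars_in_mult uv P Q)+
    ultimately show ?thesis unfolding I_def by blast
  qed
  obtain d where d: "d \<in> I" "d \<noteq> 0" "\<And>P. P \<in> I \<Longrightarrow> P \<noteq> 0 \<Longrightarrow> ydeg y d \<le> ydeg y P"
    using ex_has_least_nat[of "\<lambda>P. P \<in> I \<and> P \<noteq> 0" F "ydeg y"] FI F0 by blast
  let ?e = "ydeg y d" let ?l = "ycoeff y ?e d"
  have lnz: "?l \<noteq> 0" by (rule ycoeff_ydeg_nz[OF d(2)])
  have lv: "vars_in V ?l" by (rule ycoeff_vars[OF IT[OF d(1)] yV])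
  have mono: "?T P" if "vars_in V P" for P using vars_in_mono[OF that] by blast
  have pdiv: "\<exists>c Q. vars_in V c \<and> c \<noteq> 0 \<and> c * P = d * Q" if "P \<in> I" for P
    using that
  proof (induction "ydeg y P" arbitrary: P rule: less_induct)
    case less
    show ?case
    proof (cases "P = 0")
      case True
      have "vars_in V ?l \<and> ?l \<noteq> 0 \<and> ?l * P = d * 0" using lv lnz True by simp
      then show ?thesis by blast
    next
      case False
      let ?n = "ydeg y P" let ?p = "ycoeff y ?n P" let ?Y = "single (single y (?n - ?e)) 1 :: 'v mpoly"
      have en: "?e \<le> ?n" using d(3) less.prems False by blast
      have pv: "vars_in V ?p" by (rule ycoeff_vars[OF IT[OF less.prems] yV])
      have Yv: "?T ?Y" by (rule vars_in_single) (auto split: if_splits)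
      define P' where "P' = ?l * P - (?p * ?Y) * d"
      have P'I: "P' \<in> I" unfolding P'_def
        by (intro Icl less.prems d vars_in_mult mono pv lv Yv)
      have cfP': "ycoeff y k P' = ?l * ycoeff y k P - ?p * (if ?n - ?e \<le> k then ycoeff y (k - (?n - ?e)) d else 0)" for k
        unfolding P'_def ycoeff_minus mult.assoc ycoeff_mult_free[OF lv yV] ycoeff_mult_free[OF pv yV] ycoeff_mult_Y ..
      have z: "ycoeff y k P' = 0" if "k \<ge> ?n" for k
      proof (cases "k = ?n")
        case True
        then show ?thesis using en by (simp add: cfP' mult.commute)
      next
        case False
        then have "k > ?n" "k - (?n - ?e) > ?e" using that en by auto
        then show ?thesis by (simp add: cfP' ycoeff_gt_ydeg)
      qed
      have "\<exists>c Q. vars_in V c \<and> c \<noteq> 0 \<and> c * P' = d * Q"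
      proof (cases "P' = 0")
        case True
        have "vars_in V ?l \<and> ?l \<noteq> 0 \<and> ?l * P' = d * 0" using lv lnz True by simp
        then show ?thesis by blast
      next
        case False
        show ?thesis by (rule less.hyps[OF ydeg_less[OF False z] P'I])
      qed
      then obtain c Q where c: "vars_in V c" "c \<noteq> 0" "c * P' = d * Q" by blast
      have "(c * ?l) * P = d * (Q + c * ?p * ?Y)"
        using c(3) by (simp add: P'_def algebra_simps)
      moreover have "vars_in V (c * ?l)" "c * ?l \<noteq> 0" using c lv lnz by (auto intro: vars_in_mult simp: mpoly_mult_eq_0)
      ultimately show ?thesis by blast
    qed
  qed
  have "vars_in V d"
  proof -
    obtain c Q where c: "vars_in V c" "c \<noteq> 0" "c * F = d * Q" using pdiv[OF FI] by blast
    obtain d1 b where d1: "d = d1 * b" "vars_in V b" "d1 dvd F" using strip_free[OF c F0 F(3)] by blast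
    obtain w where w: "F = d1 * w" using d1(3) by (rule dvdE)
    then have "d1 dvd 1 \<or> w dvd 1" using F(1) unfolding irreducible_def by blast
    then show ?thesis
    proof
      assume "d1 dvd 1"
      then have "pweight d1 = 1" by (simp add: is_unit_mpoly)
      have "vars_in V d1" unfolding vars_in_def
      proof
        fix m assume "m \<in> keys d1"
        then have "mweight m = 1" using mweight_le_pweight[of m d1] \<open>pweight d1 = 1\<close> mweight_pos[of m] by linarith
        then have "m = 0" unfolding mweight_eq_1 .
        then show "keys m \<subseteq> V" by simp
      qed
      then show ?thesis unfolding d1(1) using d1(2) by (rule vars_in_mult)
    next
      assume "w dvd 1"
      then have "F dvd d1" unfolding w by (metis dvd_refl mult_1_right mult_dvd_mono)
      then have Fd: "F dvd d" unfolding d1(1) by simp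
      obtain c' Q' where c': "vars_in V c'" "c' \<noteq> 0" "c' * G = d * Q'" using pdiv[OF GI] by blast
      have "F dvd c' * G" unfolding c'(3) using Fd by simp
      then have "F dvd G" by (rule cancel_free[OF F c'(1,2) G(1)])
      then show ?thesis using G(2) by simp
    qed
  qed
  then show ?thesis using d(1,2) unfolding I_def by blast
qed

text \<open>If \<open>F\<close> involves \<open>y\<close> and does not divide \<open>G\<close>, then \<open>F\<close> divides the product of \<open>H\<close> with the eliminant of \<open>F\<close> and
\<open>G\<close>, which can be cancelled.\<close>

lemma primes_within_insert: "primes_within (insert y V)"
  unfolding primes_within_def
proof (intro allI impI, elim conjE)
  fix F G H :: "'v mpoly"
  assume F: "irreducible F" "vars_in (insert y V) F" and G: "vars_in (insert y V) G" and H: "vars_in (insert y V) H"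
    and dvd: "F dvd G * H"
  show "F dvd G \<or> F dvd H"
  proof (cases "vars_in V F")
    case True
    then show ?thesis using gauss_lemma[OF F(1) True G H dvd] by simp
  next
    case False
    show ?thesis
    proof (cases "F dvd G")
      case nd: False
      obtain a b where ab: "a * F + b * G \<noteq> 0" "vars_in V (a * F + b * G)"
        using elimination[OF F(1) False F(2) G nd] by blast
      have "F dvd (a * F + b * G) * H"
        using dvd by (simp add: distrib_right mult.assoc)
      then have "F dvd H" by (rule cancel_free[OF F(1) False F(2) ab(2,1) H])
      then show ?thesis ..
    qed simp
  qed
qed

end

lemma primes_within_finite: "finite V \<Longrightarrow> primes_within V" for V :: "'v::countable set"
proof (induction V rule: finite_induct)
  case empty
  have "\<not> irreducible F" if "vars_in {} F" for F :: "'v mpoly"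
  proof
    assume i: "irreducible F"
    have "keys F \<subseteq> {0}" using that by (auto simp: vars_in_def)
    then have "mweight ` keys F \<subseteq> {1}" by (auto simp: mweight_def)
    moreover have "pweight F \<in> mweight ` keys F"
      using lead_mon[of F] i by (metis image_eqI irreducible_def)
    ultimately have "pweight F = 1" by auto
    then show False using irreducible_not_unit_mpoly[OF i] by simp
  qed
  then show ?case by (auto simp: primes_within_def)
next
  case (insert y V)
  then show ?case using primes_within_insert by blast
qed

theorem irreducible_prime:
  fixes F :: "'s::finite mpoly"
  assumes "irreducible F" "F dvd G * H" shows "F dvd G \<or> F dvd H"
  using primes_within_finite[OF finite[of UNIV]] assms vars_in_UNIV unfolding primes_within_def by blast

theorem eliminate_variable:
  fixes F :: "'s::finite mpoly"
  assumes "irreducible F" "\<not> vars_in (- {y}) F" "\<not> F dvd G"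
  shows "\<exists>a b. a * F + b * G \<noteq> 0 \<and> vars_in (- {y}) (a * F + b * G)"
proof -
  have "insert y (- {y}) = UNIV" by auto
  then show ?thesis
    using elimination[OF primes_within_finite[of "- {y}"], of y F G] assms by (metis ComplD finite insertI1 vars_in_UNIV)
qed

section \<open>The ideal of an irreducible hypersurface\<close>

lemma peval_vars_cong:
  assumes "vars_in V P" "\<And>v. v \<in> V \<Longrightarrow> x v = x' v"
  shows "peval P x = peval P x'"
proof -
  have "x v = x' v" if "m \<in> keys P" "v \<in> keys m" for m v
    using assms that unfolding vars_in_def by blast
  then show ?thesis
    unfolding peval_def meval_def by (intro sum.cong refl arg_cong2[of _ _ _ _ "(*)"] prod.cong) simp
qed

lemma peval_fun_upd:
  "peval P (x(y := t)) = (\<Sum>i\<le>ydeg y P. peval (ycoeff y i P) x * t ^ i)"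
proof -
  have "peval (ycoeff y i P) (x(y := t)) = peval (ycoeff y i P) x" for i
    by (rule peval_vars_cong[OF ycoeff_vars']) auto
  moreover have "meval (single y i) (x(y := t)) = t ^ i" for i
    by (cases "i = 0") (simp_all add: meval_def)
  ultimately show ?thesis
    by (subst ycoeff_expand[of P y]) (simp add: peval_sum peval_mult mult.commute)
qed

text \<open>The fundamental theorem of algebra on the line through \<open>x\<close> in direction \<open>y\<close>, on which \<open>P\<close> keeps its
degree.\<close>

lemma ex_zero_on_line:
  fixes P :: "'v::countable mpoly"
  assumes "ydeg y P > 0" "peval (ycoeff y (ydeg y P) P) x \<noteq> 0"
  shows "\<exists>t. peval P (x(y := t)) = 0"
proof -
  define p where "p = (\<Sum>i\<le>ydeg y P. monom (peval (ycoeff y i P) x) i)"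
  have p: "poly p t = peval P (x(y := t))" for t
    by (simp add: p_def poly_sum poly_monom peval_fun_upd)
  have "coeff p (ydeg y P) = peval (ycoeff y (ydeg y P) P) x"
    by (simp add: p_def coeff_sum)
  then have "degree p > 0" using assms le_degree[of p "ydeg y P"] by simp
  then have "\<not> constant (poly p)" by (simp add: constant_degree)
  then show ?thesis using fundamental_theorem_of_algebra[of p] by (simp add: p)
qed

lemma irreducible_involves_variable:
  fixes F :: "'s::finite mpoly"
  assumes "irreducible F" shows "\<exists>y. \<not> vars_in (- {y}) F"
proof (rule ccontr)
  assume "\<nexists>y. \<not> vars_in (- {y}) F"
  then have "keys m = {}" if "m \<in> keys F" for m
    using that unfolding vars_in_def by blast
  then have "mweight m \<le> 1" if "m \<in> keys F" for m
    using that by (metis mweight_eq_1 keys_eq_empty order_refl)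
  then have "pweight F \<le> 1" by (rule pweight_le)
  then show False using irreducible_not_unit_mpoly[OF assms] pweight_pos[of F] assms
    by (auto simp: irreducible_def)
qed

text \<open>The Nullstellensatz for one irreducible polynomial. If \<open>F\<close> does not divide \<open>G\<close>, some combination \<open>d\<close> of
the two is nonzero and free of a variable \<open>y\<close> that occurs in \<open>F\<close>. Over a point of the remaining
coordinates where neither \<open>d\<close> nor the leading coefficient of \<open>F\<close> in \<open>y\<close> vanishes there is a zero of \<open>F\<close>,
and \<open>G\<close> does not vanish there.\<close>

theorem vanishing_ideal_hypersurface:
  fixes F :: "'s::finite mpoly"
  assumes F: "irreducible F"
  shows "vanishing_ideal (zero_set {F}) = {G. F dvd G}"
proof (intro equalityI subsetI)
  fix G assume "G \<in> {G. F dvd G}"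
  then show "G \<in> vanishing_ideal (zero_set {F})"
    by (auto simp: vanishing_ideal_def zero_set_def peval_mult elim!: dvdE)
next
  fix G assume G: "G \<in> vanishing_ideal (zero_set {F})"
  obtain y where y: "\<not> vars_in (- {y}) F" using irreducible_involves_variable[OF F] by blast
  have F0: "F \<noteq> 0" using F by auto
  have n: "ydeg y F > 0"
  proof (rule ccontr)
    assume "\<not> ydeg y F > 0"
    then have "vars_in (- {y}) F" unfolding vars_in_ydeg by simp
    then show False using y by simp
  qed
  show "G \<in> {G. F dvd G}"
  proof (rule ccontr)
    assume "G \<notin> {G. F dvd G}"
    then obtain a b where ab: "a * F + b * G \<noteq> 0" "vars_in (- {y}) (a * F + b * G)"
      using eliminate_variable[OF F y, of G] by blast
    let ?d = "a * F + b * G" and ?c = "ycoeff y (ydeg y F) F"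
    have "?d * ?c \<noteq> 0" using ab(1) ycoeff_ydeg_nz[OF F0, of y] by (simp add: mpoly_mult_eq_0)
    then obtain x where x: "peval (?d * ?c) x \<noteq> 0" using peval_nonzero by blast
    then have "peval ?c x \<noteq> 0" by (simp add: peval_mult)
    then obtain t where t: "peval F (x(y := t)) = 0" using ex_zero_on_line[OF n] by blast
    then have "peval G (x(y := t)) = 0" using G by (simp add: vanishing_ideal_def zero_set_def)
    then have "peval ?d (x(y := t)) = 0" using t by (simp add: peval_add peval_mult)
    moreover have "peval ?d (x(y := t)) = peval ?d x"
      by (rule peval_vars_cong[OF ab(2)]) auto
    ultimately show False using x by (simp add: peval_mult)
  qed
qed

section \<open>Hasse derivatives\<close>

text \<open>The Taylor coefficient \<open>taylor_coeff \<alpha> f p\<close> as a polynomial in the point \<open>p\<close> (\<open>peval_hasse\<close>).\<close>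

definition hasse :: "('s::finite \<Rightarrow>\<^sub>0 nat) \<Rightarrow> 's mpoly \<Rightarrow> 's mpoly" where
  "hasse \<alpha> f = (\<Sum>m\<in>keys f. single (m - \<alpha>) (lookup f m *
     of_nat (\<Prod>v\<in>UNIV. lookup m v choose lookup \<alpha> v)))"

definition taylor_mon :: "('s::finite \<Rightarrow>\<^sub>0 nat) \<Rightarrow> ('s \<Rightarrow>\<^sub>0 nat) \<Rightarrow> ('s \<Rightarrow> complex) \<Rightarrow> complex" where
  "taylor_mon \<alpha> m p = (\<Prod>v\<in>UNIV. of_nat (lookup m v choose lookup \<alpha> v) *
     p v ^ (lookup m v - lookup \<alpha> v))"

lemma taylor_coeff_mon:
  "taylor_coeff \<alpha> f p = (\<Sum>m\<in>keys f. lookup f m * taylor_mon \<alpha> m p)"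
proof -
  have g: "(\<Prod>i<k. of_nat m - of_nat i :: complex) / fact k = of_nat (m choose k)" for m k :: nat
    by (simp add: binomial_gbinomial gbinomial_prod_rev lessThan_atLeast0)
  have e: "(\<Prod>v\<in>UNIV. (\<Prod>i<lookup \<alpha> v. of_nat (lookup m v) - of_nat i)
        * p v ^ (lookup m v - lookup \<alpha> v)) / (\<Prod>v\<in>UNIV. fact (lookup \<alpha> v))
     = taylor_mon \<alpha> m p" for m
    unfolding taylor_mon_def prod_dividef[symmetric] by (intro prod.cong refl) (simp only: g[symmetric] times_divide_eq_left)
  show ?thesis
    unfolding taylor_coeff_def pderiv_at_def sum_divide_distrib
    by (simp only: times_divide_eq_right[symmetric] e)
qed

lemma meval_UNIV: "meval m p = (\<Prod>v\<in>UNIV. p v ^ lookup m v)" for m :: "'s::finite \<Rightarrow>\<^sub>0 nat"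
  by (rule meval_superset) auto

lemma peval_hasse: "peval (hasse \<alpha> f) p = taylor_coeff \<alpha> f p"
  unfolding taylor_coeff_mon hasse_def peval_sum peval_single taylor_mon_def meval_UNIV
  by (simp add: prod.distrib lookup_minus mult.assoc)

lemma pconst_mult:
  "pconst c * f = (\<Sum>m\<in>keys f. single m (c * lookup f m))"
  by (subst poly_mapping_sum_single[of f, symmetric], simp only: pconst_def sum_distrib_left mult_single, simp)

lemma taylor_superset:
  assumes "finite K" "keys f \<subseteq> K"
  shows "taylor_coeff \<alpha> f p = (\<Sum>m\<in>K. lookup f m * taylor_mon \<alpha> m p)"
  unfolding taylor_coeff_mon using assms
  by (intro sum.mono_neutral_left) (auto simp: in_keys_iff)

lemma taylor_add: "taylor_coeff \<alpha> (f + g) p = taylor_coeff \<alpha> f p + taylor_coeff \<alpha> g p"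
proof -
  let ?K = "keys f \<union> keys g"
  have f: "finite ?K" by simp
  show ?thesis
    using taylor_superset[OF f Poly_Mapping.keys_add] taylor_superset[OF f, of f] taylor_superset[OF f, of g]
    by (simp add: lookup_add sum.distrib distrib_right)
qed

lemma taylor_zero [simp]: "taylor_coeff \<alpha> 0 p = 0"
  by (simp add: taylor_coeff_mon)

lemma taylor_sum: "taylor_coeff \<alpha> (sum f A) p = (\<Sum>i\<in>A. taylor_coeff \<alpha> (f i) p)"
  by (induction A rule: infinite_finite_induct) (auto simp: taylor_add)

lemma taylor_minus: "taylor_coeff \<alpha> (f - g) p = taylor_coeff \<alpha> f p - taylor_coeff \<alpha> g p"
  using taylor_add[of \<alpha> "f - g" g p] by simp

lemma taylor_single: "taylor_coeff \<alpha> (single m c) p = c * taylor_mon \<alpha> m p"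
  by (simp add: taylor_coeff_mon)

lemma taylor_mon_0: "taylor_mon 0 m p = meval m p"
  by (simp add: taylor_mon_def meval_UNIV)

lemma taylor_0: "taylor_coeff 0 f p = peval f p"
  by (simp add: taylor_coeff_mon taylor_mon_0 peval_def)

definition below :: "('s \<Rightarrow>\<^sub>0 nat) \<Rightarrow> ('s \<Rightarrow>\<^sub>0 nat) set" where
  "below \<alpha> = {\<beta>. \<forall>v. lookup \<beta> v \<le> lookup \<alpha> v}"

lemma bij_below: "bij_betw lookup (below \<alpha>) (PiE UNIV (\<lambda>v. {..lookup \<alpha> v}))"
  for \<alpha> :: "'s::finite \<Rightarrow>\<^sub>0 nat"
proof (rule bij_betwI')
  fix y assume "y \<in> PiE UNIV (\<lambda>v. {..lookup \<alpha> v})"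
  then have "\<forall>v. y v \<le> lookup \<alpha> v" by auto
  then have "Abs_poly_mapping y \<in> below \<alpha>" "lookup (Abs_poly_mapping y) = y" by (simp_all add: below_def)
  then show "\<exists>x\<in>below \<alpha>. y = lookup x" by metis
qed (auto simp: below_def poly_mapping_eqI)

lemma finite_below [simp]: "finite (below \<alpha>)" for \<alpha> :: "'s::finite \<Rightarrow>\<^sub>0 nat"
  using bij_betw_finite[OF bij_below[of \<alpha>]] by (simp add: finite_PiE)

lemma binomial_split:
  "of_nat (a + b choose k) * t ^ (a + b - k) =
    (\<Sum>j\<le>k. (of_nat (a choose j) * t ^ (a - j)) * (of_nat (b choose (k - j)) * t ^ (b - (k - j))))"
  for t :: complex
proof -
  have "(of_nat (a choose j) * t ^ (a - j)) * (of_nat (b choose (k - j)) * t ^ (b - (k - j)))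
      = of_nat ((a choose j) * (b choose (k - j))) * t ^ (a + b - k)" if "j \<le> k" for j
  proof (cases "j \<le> a \<and> k - j \<le> b")
    case True
    then have "a + b - k = (a - j) + (b - (k - j))" using that by linarith
    then show ?thesis by (simp add: power_add)
  next
    case False then show ?thesis by (auto simp: binomial_eq_0)
  qed
  then have "(\<Sum>j\<le>k. (of_nat (a choose j) * t ^ (a - j)) * (of_nat (b choose (k - j)) * t ^ (b - (k - j))))
      = (\<Sum>j\<le>k. of_nat ((a choose j) * (b choose (k - j))) * t ^ (a + b - k))"
    by (intro sum.cong) auto
  also have "\<dots> = of_nat (\<Sum>j\<le>k. (a choose j) * (b choose (k - j))) * t ^ (a + b - k)"
    by (simp only: of_nat_sum sum_distrib_right)
  finally show ?thesis by (simp only: vandermonde)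
qed

text \<open>Vandermonde's identity in each variable; expanding the product over the variables gives the sum
over \<open>below \<alpha>\<close>.\<close>

lemma taylor_mon_add: "taylor_mon \<alpha> (m + m') p = (\<Sum>\<beta>\<in>below \<alpha>. taylor_mon \<beta> m p * taylor_mon (\<alpha> - \<beta>) m' p)"
proof -
  let ?l = lookup
  have "taylor_mon \<alpha> (m + m') p = (\<Prod>v\<in>UNIV. \<Sum>j\<le>?l \<alpha> v. (of_nat (?l m v choose j) * p v ^ (?l m v - j)) *
       (of_nat (?l m' v choose (?l \<alpha> v - j)) * p v ^ (?l m' v - (?l \<alpha> v - j))))"
    unfolding taylor_mon_def lookup_add binomial_split ..
  also have "\<dots> = (\<Sum>h\<in>PiE UNIV (\<lambda>v. {..?l \<alpha> v}). \<Prod>v\<in>UNIV. (of_nat (?l m v choose h v) * p v ^ (?l m v - h v)) *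
       (of_nat (?l m' v choose (?l \<alpha> v - h v)) * p v ^ (?l m' v - (?l \<alpha> v - h v))))"
    by (rule prod_sum_PiE) auto
  also have "\<dots> = (\<Sum>\<beta>\<in>below \<alpha>. \<Prod>v\<in>UNIV. (of_nat (?l m v choose ?l \<beta> v) * p v ^ (?l m v - ?l \<beta> v)) *
       (of_nat (?l m' v choose (?l \<alpha> v - ?l \<beta> v)) * p v ^ (?l m' v - (?l \<alpha> v - ?l \<beta> v))))"
    by (rule sum.reindex_bij_betw[OF bij_below, symmetric])
  finally show ?thesis by (simp add: taylor_mon_def prod.distrib lookup_minus)
qed

theorem taylor_leibniz:
  "taylor_coeff \<alpha> (f * g) p = (\<Sum>\<beta>\<in>below \<alpha>. taylor_coeff \<beta> f p * taylor_coeff (\<alpha> - \<beta>) g p)"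
proof -
  let ?l = lookup
  have "taylor_coeff \<alpha> (f * g) p = (\<Sum>m\<in>keys f. \<Sum>m'\<in>keys g.
      \<Sum>\<beta>\<in>below \<alpha>. (?l f m * taylor_mon \<beta> m p) * (?l g m' * taylor_mon (\<alpha> - \<beta>) m' p))"
    by (simp add: mpoly_mult_expand taylor_sum taylor_single taylor_mon_add sum_distrib_left ac_simps)
  also have "\<dots> = (\<Sum>\<beta>\<in>below \<alpha>. \<Sum>m\<in>keys f. \<Sum>m'\<in>keys g.
      (?l f m * taylor_mon \<beta> m p) * (?l g m' * taylor_mon (\<alpha> - \<beta>) m' p))"
    by (simp only: sum.swap[where B = "below \<alpha>"])
  also have "\<dots> = (\<Sum>\<beta>\<in>below \<alpha>. taylor_coeff \<beta> f p * taylor_coeff (\<alpha> - \<beta>) g p)"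
    by (simp add: taylor_coeff_mon sum_product)
  finally show ?thesis .
qed

section \<open>Partial derivatives\<close>

abbreviation evec :: "'s \<Rightarrow> ('s \<Rightarrow>\<^sub>0 nat)" where
  "evec v \<equiv> single v (Suc 0)"

abbreviation pd :: "'s::finite \<Rightarrow> 's mpoly \<Rightarrow> 's mpoly" where
  "pd v \<equiv> hasse (evec v)"

lemma below_evec: "below (evec v) = {0, evec v}" for v :: "'s::finite"
proof (intro equalityI subsetI)
  fix \<beta> assume b: "\<beta> \<in> below (evec v)"
  then have le: "lookup \<beta> u \<le> (if u = v then 1 else 0)" for u
    by (auto simp: below_def lookup_single when_def split: if_splits elim: allE[of _ u])
  have "\<beta> = single v (lookup \<beta> v)"
  proof (rule poly_mapping_eqI)
    fix u show "lookup \<beta> u = lookup (single v (lookup \<beta> v)) u"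
      using le[of u] by (cases "u = v") (auto simp: lookup_single when_def)
  qed
  moreover have "lookup \<beta> v = 0 \<or> lookup \<beta> v = 1" using le[of v] by auto
  ultimately show "\<beta> \<in> {0, evec v}" by (metis One_nat_def insertCI single_zero)
qed (auto simp: below_def)

lemma pd_mult: "pd v (f * g) = pd v f * g + f * pd v g"
proof (rule peval_eqI)
  have "evec v \<noteq> 0" by (metis lookup_single_eq lookup_zero nat.distinct(1))
  then show "peval (pd v (f * g)) x = peval (pd v f * g + f * pd v g) x" for x
    by (simp add: peval_hasse taylor_leibniz below_evec peval_add peval_mult taylor_0)
qed

lemma pd_add: "pd v (f + g) = pd v f + pd v g"
  by (rule peval_eqI) (simp add: peval_hasse taylor_add peval_add)

lemma lookup_hasse:
  "lookup (hasse \<alpha> f) m = lookup f (m + \<alpha>) *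
     of_nat (\<Prod>v\<in>UNIV. (lookup m v + lookup \<alpha> v) choose lookup \<alpha> v)"
proof -
  let ?l = lookup
  let ?C = "\<lambda>m. \<Prod>v\<in>UNIV. ?l m v choose ?l \<alpha> v"
  have "?l (hasse \<alpha> f) m = (\<Sum>m'\<in>keys f. if m' = m + \<alpha> then ?l f m' * of_nat (?C m') else 0)"
    unfolding hasse_def lookup_sum
  proof (intro sum.cong refl)
    fix m'
    show "?l (single (m' - \<alpha>) (?l f m' * of_nat (?C m'))) m =
        (if m' = m + \<alpha> then ?l f m' * of_nat (?C m') else 0)"
    proof (cases "\<forall>v. ?l \<alpha> v \<le> ?l m' v")
      case True
      then have "m' - \<alpha> + \<alpha> = m'" by (intro poly_mapping_eqI) (simp add: lookup_add lookup_minus)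
      then have "m' - \<alpha> = m \<longleftrightarrow> m' = m + \<alpha>" by auto
      then show ?thesis by (simp add: lookup_single when_def)
    next
      case False
      then obtain v where v: "?l m' v < ?l \<alpha> v" by (meson not_le)
      then have "?C m' = 0" by (auto simp: binomial_eq_0 intro!: bexI[of _ v])
      then show ?thesis by (simp only: of_nat_0 mult_zero_right single_zero lookup_zero if_cancel)
    qed
  qed
  then show ?thesis by (simp add: sum.delta in_keys_iff lookup_add)
qed

lemma lookup_pd: "lookup (pd v f) m =
   lookup f (m + evec v) * of_nat (lookup m v + 1)"
proof -
  have "(\<Prod>u\<in>UNIV. (lookup m u + lookup (evec v) u) choose lookup (evec v) u)
     = (\<Prod>u\<in>UNIV. if u = v then lookup m v + 1 else 1)"
    by (intro prod.cong) (auto simp: lookup_single when_def)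
  then show ?thesis unfolding lookup_hasse by simp
qed

lemma pd_keys: "m \<in> keys (pd v f) \<Longrightarrow> m + evec v \<in> keys f"
  unfolding in_keys_iff lookup_pd by auto

lemma pd_vars_in: "vars_in V f \<Longrightarrow> vars_in V (pd v f)"
  unfolding vars_in_def
proof (intro ballI subsetI)
  fix m u assume f: "\<forall>m\<in>keys f. keys m \<subseteq> V" and m: "m \<in> keys (pd v f)" "u \<in> keys m"
  have "u \<in> keys (m + evec v)" using m(2) by (simp add: in_keys_iff lookup_add)
  then show "u \<in> V" using f pd_keys[OF m(1)] by (meson subsetD)
qed

lemma pd_free: "vars_in (- {v}) f \<Longrightarrow> pd v f = 0"
proof (rule poly_mapping_eqI)
  fix m assume f: "vars_in (- {v}) f"
  have "m + evec v \<notin> keys f"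
    using vars_in_lookup[OF f, of "m + evec v" v] by (auto simp: lookup_add)
  then show "lookup (pd v f) m = lookup 0 m" by (simp add: lookup_pd in_keys_iff)
qed

lemma pd_nonzero: "\<not> vars_in (- {v}) f \<Longrightarrow> pd v f \<noteq> 0"
proof
  assume nf: "\<not> vars_in (- {v}) f" and 0: "pd v f = 0"
  obtain m where m: "m \<in> keys f" "v \<in> keys m" using nf by (auto simp: vars_in_def)
  have "m - evec v + evec v = m"
    using m(2) by (intro poly_mapping_eqI) (auto simp: lookup_add lookup_minus lookup_single when_def in_keys_iff)
  then have "lookup (pd v f) (m - evec v) = lookup f m * of_nat (lookup m v - 1 + 1)"
    by (simp add: lookup_pd lookup_minus)
  then show False using 0 m by (auto simp: in_keys_iff simp del: of_nat_Suc)
qed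

lemma pd_pweight: "f \<noteq> 0 \<Longrightarrow> pweight (pd v f) < pweight f"
proof -
  assume f: "f \<noteq> 0"
  have "pweight (pd v f) \<le> pweight f - 1"
  proof (rule pweight_le)
    fix m assume "m \<in> keys (pd v f)"
    from mweight_le_pweight[OF pd_keys[OF this]]
    have le: "mweight m * mweight (evec v) \<le> pweight f" unfolding mweight_add .
    have "mweight (evec v) \<ge> 2"
      using lookup_le_log_weight[of "evec v" v] by simp
    then have "mweight m * 2 \<le> mweight m * mweight (evec v)" by (rule mult_left_mono) simp
    then show "mweight m \<le> pweight f - 1" using le mweight_pos[of m] by linarith
  qed
  then show ?thesis using pweight_pos[OF f] by linarith
qed

lemma not_dvd_pd:
  assumes "\<not> vars_in (- {v}) F" shows "\<not> F dvd pd v F"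
proof
  assume "F dvd pd v F"
  then obtain k where k: "pd v F = F * k" by (rule dvdE)
  have nz: "k \<noteq> 0" "F \<noteq> 0" using k pd_nonzero[OF assms] by auto
  then have "pweight F \<le> pweight (pd v F)" unfolding k pweight_mult using pweight_pos[of k] by simp
  then show False using pd_pweight[OF nz(2), of v] by simp
qed

definition ideal_set :: "'a::comm_ring_1 set \<Rightarrow> bool" where
  "ideal_set I \<longleftrightarrow> 0 \<in> I \<and> (\<forall>a\<in>I. \<forall>b\<in>I. a + b \<in> I) \<and> (\<forall>a\<in>I. \<forall>r. r * a \<in> I)"

text \<open>In characteristic zero, differentiating with respect to a variable that occurs gives something
nonzero of smaller weight, so repeated differentiation ends at a nonzero constant.\<close>

lemma derivation_stable_ideal_trivial:
  fixes P :: "'s::finite mpoly set"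
  assumes P: "ideal_set P" and c: "c \<in> P" "c \<noteq> 0" "vars_in U c"
    and st: "\<And>f u. f \<in> P \<Longrightarrow> u \<in> U \<Longrightarrow> vars_in U f \<Longrightarrow> pd u f \<in> P"
  shows "1 \<in> P"
  using c
proof (induction "pweight c" arbitrary: c rule: less_induct)
  case less
  show ?case
  proof (cases "\<exists>u\<in>U. pd u c \<noteq> 0")
    case True
    then obtain u where u: "u \<in> U" "pd u c \<noteq> 0" by blast
    show ?thesis
      by (rule less.hyps[OF pd_pweight[OF less.prems(2)] _ u(2) pd_vars_in[OF less.prems(3)]])
         (rule st[OF less.prems(1) u(1) less.prems(3)])
  next
    case False
    then have "\<forall>u\<in>U. vars_in (- {u}) c" using pd_nonzero by blast
    then have "keys m = {}" if "m \<in> keys c" for m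
      using that less.prems(3) unfolding vars_in_def by blast
    then have "mweight m \<le> 1" if "m \<in> keys c" for m
      using that by (metis mweight_eq_1 keys_eq_empty order_refl)
    then have "pweight c \<le> 1" by (rule pweight_le)
    then have "c dvd 1" unfolding is_unit_mpoly using pweight_pos[OF less.prems(2)] by linarith
    then obtain u where "1 = c * u" by (rule dvdE)
    then have "u * c = 1" by (simp add: mult.commute)
    then show ?thesis using P less.prems(1) unfolding ideal_set_def by metis
  qed
qed

section \<open>A normal hypersurface has no divisor of singular points\<close>

lemma ideal_setD:
  assumes "ideal_set I"
  shows "0 \<in> I" "a \<in> I \<Longrightarrow> b \<in> I \<Longrightarrow> a + b \<in> I" "a \<in> I \<Longrightarrow> r * a \<in> I" "a \<in> I \<Longrightarrow> a * r \<in> I"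
    "a \<in> I \<Longrightarrow> b \<in> I \<Longrightarrow> a - b \<in> I"
proof -
  show 1: "0 \<in> I" "a \<in> I \<Longrightarrow> b \<in> I \<Longrightarrow> a + b \<in> I" and 2: "a \<in> I \<Longrightarrow> r * a \<in> I" for a b r
    using assms by (auto simp: ideal_set_def)
  show "a \<in> I \<Longrightarrow> a * r \<in> I" using 2[of a r] by (simp add: mult.commute)
  show "a \<in> I \<Longrightarrow> b \<in> I \<Longrightarrow> a - b \<in> I" using 1(2)[of a "(-1) * b"] 2[of b "-1"] by simp
qed

text \<open>The colon ideal \<open>((f, F) : a)\<close>.\<close>

lemma ideal_set_colon: "ideal_set {h. \<exists>x y. h * a = x * f + y * F}" for F :: "'a::comm_ring_1"
  unfolding ideal_set_def
proof (intro conjI ballI allI)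
  have "0 * a = 0 * f + 0 * F" by simp
  then show "0 \<in> {h. \<exists>x y. h * a = x * f + y * F}" by blast
next
  fix h k assume "h \<in> {h. \<exists>x y. h * a = x * f + y * F}" "k \<in> {h. \<exists>x y. h * a = x * f + y * F}"
  then obtain x y x' y' where "h * a = x * f + y * F" "k * a = x' * f + y' * F" by blast
  then have "(h + k) * a = (x + x') * f + (y + y') * F" by (simp add: algebra_simps)
  then show "h + k \<in> {h. \<exists>x y. h * a = x * f + y * F}" by blast
next
  fix h r assume "h \<in> {h. \<exists>x y. h * a = x * f + y * F}"
  then obtain x y where "h * a = x * f + y * F" by blast
  then have "r * (h * a) = r * (x * f + y * F)" by simp
  then have "(r * h) * a = (r * x) * f + (r * y) * F" by (simp only: distrib_left mult.assoc)
  then show "r * h \<in> {h. \<exists>x y. h * a = x * f + y * F}" by blast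
qed

text \<open>The ascending chain condition: elements showing that a chain of ideals increases strictly would
contradict \<open>noetherian_seq\<close>.\<close>

lemma ex_maximal_ideal:
  fixes C :: "'a \<Rightarrow> 's::finite mpoly set"
  assumes "A a0" "\<And>a. A a \<Longrightarrow> ideal_set (C a)"
  shows "\<exists>a. A a \<and> (\<forall>b. A b \<longrightarrow> C a \<subseteq> C b \<longrightarrow> C b = C a)"
proof (rule ccontr)
  assume "\<nexists>a. A a \<and> (\<forall>b. A b \<longrightarrow> C a \<subseteq> C b \<longrightarrow> C b = C a)"
  then have "\<forall>a. A a \<longrightarrow> (\<exists>b. A b \<and> C a \<subset> C b)" by blast
  then obtain s where s: "\<And>a. A a \<Longrightarrow> A (s a) \<and> C a \<subset> C (s a)" by metis
  define a where "a k = (s ^^ k) a0" for k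
  have A: "A (a k)" for k by (induction k) (use assms(1) s in \<open>auto simp: a_def\<close>)
  have step: "C (a k) \<subset> C (a (Suc k))" for k using s[OF A[of k]] by (simp add: a_def)
  have mono: "i \<le> k \<Longrightarrow> C (a i) \<subseteq> C (a k)" for i k
    by (rule lift_Suc_mono_le[of "\<lambda>k. C (a k)"]) (use step in auto)
  have "\<forall>k. \<exists>h. h \<in> C (a (Suc k)) \<and> h \<notin> C (a k)" using step by blast
  then obtain h where h: "\<And>k. h k \<in> C (a (Suc k)) \<and> h k \<notin> C (a k)" by metis
  obtain k c where kc: "h k = (\<Sum>i<k. c i * h i)" using noetherian_seq by blast
  note id = ideal_setD[OF assms(2)[OF A[of k]]]
  have "(\<Sum>i\<in>I. c i * h i) \<in> C (a k)" if "finite I" "I \<subseteq> {..<k}" for I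
    using that
  proof (induction I rule: finite_induct)
    case (insert i I)
    then have "h i \<in> C (a k)" using h[of i] mono[of "Suc i" k] by auto
    then show ?case using insert by (auto intro!: id(2,3))
  qed (simp add: id(1))
  then show False using h[of k] kc by auto
qed

text \<open>The last assumption says that in the local ring of \<open>X\<close> at \<open>p0\<close> every partial derivative of \<open>F\<close> has a
power divisible by \<open>f\<close>: near \<open>p0\<close> all zeros of \<open>f\<close> on \<open>X\<close> are singular. The fraction called \<open>\<theta>\<close> below is
\<open>a / f\<close>.\<close>

theorem normal_hypersurface_no_singular_divisor:
  fixes F :: "'s::finite mpoly"
  assumes F: "irreducible F" and nv: "normal_variety (zero_set {F})"
    and p0: "peval F p0 = 0" and f: "peval f p0 = 0" "\<not> F dvd f"
    and div: "\<And>v. \<exists>q k x y. peval q p0 \<noteq> 0 \<and> q * pd v F ^ k = x * f + y * F"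
  shows False
proof -
  \<comment> \<open>\<open>A a\<close>: the element \<open>a\<close> is nonzero in the local ring at \<open>p0\<close> modulo \<open>f\<close>; its annihilator \<open>C a\<close> is chosen maximal.\<close>
  define C where "C a = {h. \<exists>x y. h * a = x * f + y * F}" for a
  define A where "A a \<longleftrightarrow> (\<forall>h\<in>C a. peval h p0 = 0)" for a
  have F0: "F \<noteq> 0" using F by auto
  have Cid: "ideal_set (C a)" for a unfolding C_def by (rule ideal_set_colon)
  have "A 1" unfolding A_def C_def using p0 f by (auto simp: peval_add peval_mult)
  from ex_maximal_ideal[of A 1 C, OF this Cid] obtain a where
    a: "A a" "\<And>b. A b \<Longrightarrow> C a \<subseteq> C b \<Longrightarrow> C b = C a" by blast
  define P where "P = C a"
  note id = ideal_setD[OF Cid[of a], folded P_def]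
  have Pm: "peval h p0 = 0" if "h \<in> P" for h using a(1) that by (auto simp: A_def P_def)
  have one: "1 \<notin> P" using Pm[of 1] by auto
  have Cmul: "h \<in> C (a * b) \<longleftrightarrow> h * b \<in> P" for h b unfolding P_def C_def by (simp add: ac_simps)
  have prime: "c \<in> P" if bc: "b * c \<in> P" and b: "b \<notin> P" for b c
  proof (rule ccontr)
    assume c: "c \<notin> P"
    have sub: "C a \<subseteq> C (a * d)" for d unfolding Cmul using id(4) by (auto simp: P_def Cmul)
    have "c \<in> C (a * b)" unfolding Cmul using bc by (simp add: mult.commute)
    then have "\<not> A (a * b)" using a(2)[OF _ sub] c P_def by blast
    then obtain q where q: "q * b \<in> P" "peval q p0 \<noteq> 0" unfolding A_def by (auto simp: Cmul)
    have "A (a * q)" unfolding A_def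
    proof
      fix q' assume "q' \<in> C (a * q)"
      then have "peval (q' * q) p0 = 0" unfolding Cmul by (rule Pm)
      then show "peval q' p0 = 0" using q(2) by (simp add: peval_mult)
    qed
    then have "C (a * q) = P" using a(2)[OF _ sub] P_def by blast
    moreover have "b \<in> C (a * q)" unfolding Cmul using q(1) by (simp add: mult.commute)
    ultimately show False using b by simp
  qed
  have FP: "F \<in> P" and fP: "f \<in> P"
  proof -
    have "F * a = 0 * f + a * F" "f * a = a * f + 0 * F" by (simp_all add: mult.commute)
    then show "F \<in> P" "f \<in> P" unfolding P_def C_def by blast+
  qed
  have dFP: "pd v F \<in> P" for v
  proof -
    obtain q k x y where q: "peval q p0 \<noteq> 0" "q * pd v F ^ k = x * f + y * F" using div by blast
    have "q * pd v F ^ k \<in> P" unfolding q(2) by (intro id fP FP)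
    moreover have "q \<notin> P" using q(1) Pm by auto
    ultimately have "pd v F ^ k \<in> P" by (rule prime)
    then show ?thesis
    proof (induction k)
      case (Suc k)
      then show ?case using prime[of "pd v F" "pd v F ^ k"] by auto
    qed (use one in simp)
  qed
  have aC: "\<not> F dvd a - q * f" for q
  proof
    assume "F dvd a - q * f"
    then obtain k where "a - q * f = F * k" by (rule dvdE)
    then have "1 * a = q * f + k * F" by (simp add: algebra_simps)
    then have "1 \<in> P" unfolding P_def C_def by blast
    then show False using one by simp
  qed
  have van: "h \<in> vanishing_ideal (zero_set {F}) \<longleftrightarrow> F dvd h" for h
    using vanishing_ideal_hypersurface[OF F] by simp
  \<comment> \<open>By normality, \<open>\<theta>\<close> does not map \<open>P\<close> into itself.\<close>
  have "\<exists>g\<in>P. \<forall>b\<in>P. \<not> F dvd g * a - f * b"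
  proof (rule ccontr)
    assume "\<not> (\<exists>g\<in>P. \<forall>b\<in>P. \<not> F dvd g * a - f * b)"
    then obtain s where s: "\<And>g. g \<in> P \<Longrightarrow> s g \<in> P \<and> F dvd g * a - f * s g" by metis
    \<comment> \<open>\<open>h k\<close> represents \<open>\<theta>\<^sup>k f\<close>. All of these lie in \<open>P\<close>, so one of them is a combination of \<open>F\<close> and its predecessors, which makes \<open>\<theta>\<close> integral.\<close>
    define h where "h k = (s ^^ k) f" for k
    have hP: "h k \<in> P" for k by (induction k) (use fP s in \<open>auto simp: h_def\<close>)
    have hs: "F dvd h k * a - f * h (Suc k)" for k using s[OF hP[of k]] by (simp add: h_def)
    have hk: "F dvd f * a ^ k - f ^ k * h k" for k
    proof (induction k)
      case (Suc k)
      have "f * a ^ Suc k - f ^ Suc k * h (Suc k) = (f * a ^ k - f ^ k * h k) * a + f ^ k * (h k * a - f * h (Suc k))"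
        by (simp add: algebra_simps)
      then show ?case using Suc hs[of k] by (simp add: dvd_add)
    qed (simp add: h_def)
    obtain k c where kc: "case_nat F h k = (\<Sum>i<k. c i * case_nat F h i)"
      using noetherian_seq[of "case_nat F h"] by blast
    then have "k \<noteq> 0" using F0 by (intro notI) simp
    then obtain j where j: "k = Suc j" using not0_implies_Suc by blast
    have hj: "h j = c 0 * F + (\<Sum>i<j. c (Suc i) * h i)"
      using kc unfolding j sum.lessThan_Suc_shift by simp
    let ?E = "a ^ j + (\<Sum>i<j. - c (Suc i) * a ^ i * f ^ (j - i))"
    have "f * ?E = (f * a ^ j - f ^ j * h j) + f ^ j * (c 0 * F)
        - (\<Sum>i<j. c (Suc i) * f ^ (j - i) * (f * a ^ i - f ^ i * h i))"
    proof -
      have "f ^ j * (\<Sum>i<j. c (Suc i) * h i) = (\<Sum>i<j. c (Suc i) * f ^ (j - i) * (f ^ i * h i))"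
        unfolding sum_distrib_left
        by (intro sum.cong refl) (auto simp: algebra_simps simp flip: power_add)
      then show ?thesis
        unfolding hj by (simp add: algebra_simps sum_distrib_left sum_subtractf sum_negf)
    qed
    also have "F dvd \<dots>"
    proof (rule dvd_diff[OF dvd_add[OF hk] dvd_sum])
      show "F dvd f ^ j * (c 0 * F)" by (intro dvd_mult dvd_refl)
      show "F dvd c (Suc i) * f ^ (j - i) * (f * a ^ i - f ^ i * h i)" for i by (rule dvd_mult[OF hk])
    qed
    finally have "F dvd ?E" using irreducible_prime[OF F] f(2) by blast
    then have "f \<notin> vanishing_ideal (zero_set {F}) \<and> ?E \<in> vanishing_ideal (zero_set {F})"
      using f(2) van by blast
    then have "\<exists>q. a - q * f \<in> vanishing_ideal (zero_set {F})"
      by (rule nv[unfolded normal_variety_def, rule_format])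
    then show False using aC van by blast
  qed
  then obtain g where g: "g \<in> P" "\<And>b. b \<in> P \<Longrightarrow> \<not> F dvd g * a - f * b" by blast
  then obtain x y where xy: "g * a = x * f + y * F" unfolding P_def C_def by blast
  have xP: "x \<notin> P"
  proof
    assume "x \<in> P"
    from g(2)[OF this] show False unfolding xy by (simp add: mult.commute)
  qed
  \<comment> \<open>As \<open>x\<close> lies outside \<open>P\<close>, this says that \<open>g\<close> and \<open>F\<close> generate \<open>P\<close> locally.\<close>
  have rep: "\<exists>c e. h * x = g * c + F * e" if hP: "h \<in> P" for h
  proof -
    obtain c d where cd: "h * a = c * f + d * F" using hP unfolding P_def C_def by blast
    have "f * (h * x - g * c) = h * (x * f + y * F) - g * (c * f + d * F) - h * y * F + g * d * F"
      by (simp add: algebra_simps)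
    also have "\<dots> = F * (g * d - h * y)" unfolding cd[symmetric] xy[symmetric] by (simp add: algebra_simps)
    finally have "F dvd f * (h * x - g * c)" by simp
    then have "F dvd h * x - g * c" using irreducible_prime[OF F] f(2) by blast
    then obtain e where "h * x - g * c = F * e" by (rule dvdE)
    then have "h * x = g * c + F * e" by (simp add: algebra_simps)
    then show ?thesis by blast
  qed
  show False
  proof (cases "\<forall>v. pd v g \<in> P")
    case True
    have "pd v h \<in> P" if h: "h \<in> P" for h v
    proof -
      obtain c e where ce: "h * x = g * c + F * e" using rep[OF h] by blast
      have "pd v h * x + h * pd v x = pd v g * c + g * pd v c + (pd v F * e + F * pd v e)"
        using arg_cong[OF ce, of "pd v"] by (simp add: pd_mult pd_add)
      then have "x * pd v h = pd v g * c + g * pd v c + (pd v F * e + F * pd v e) - h * pd v x"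
        by (simp add: algebra_simps)
      also have "\<dots> \<in> P" by (intro id(2,4,5) True[rule_format] g(1) dFP FP h)
      finally show ?thesis using prime xP by blast
    qed
    then have "1 \<in> P"
      using derivation_stable_ideal_trivial[OF Cid[of a, folded P_def] FP F0, of UNIV] by simp
    then show False using one by simp
  next
    case False
    then obtain w where w: "pd w g \<notin> P" by blast
    \<comment> \<open>The derivation \<open>pd w g * pd u - pd u g * pd w\<close> kills \<open>g\<close>, so it maps \<open>P\<close> into itself; on polynomials free of \<open>w\<close> it acts as a multiple of \<open>pd u\<close>.\<close>
    have st: "pd u h \<in> P" if h: "h \<in> P" "vars_in (- {w}) h" for h u
    proof -
      obtain c e where ce: "h * x = g * c + F * e" using rep[OF h(1)] by blast
      have d: "pd v h * x + h * pd v x = pd v g * c + g * pd v c + (pd v F * e + F * pd v e)" for v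
        using arg_cong[OF ce, of "pd v"] by (simp add: pd_mult pd_add)
      have "x * (pd w g * pd u h) = pd w g * (pd u h * x + h * pd u x) - pd u g * (pd w h * x + h * pd w x)
          - h * (pd w g * pd u x - pd u g * pd w x)"
        by (simp add: pd_free[OF h(2)] algebra_simps)
      also have "\<dots> = g * (pd w g * pd u c - pd u g * pd w c) + pd w g * (pd u F * e + F * pd u e)
          - pd u g * (pd w F * e + F * pd w e) - h * (pd w g * pd u x - pd u g * pd w x)"
        unfolding d by (simp add: algebra_simps)
      also have "\<dots> \<in> P" by (intro id(2,4,5) id(3)[of "_ + _"] g(1) dFP FP h)
      finally have "pd w g * pd u h \<in> P" using prime xP by blast
      then show ?thesis using prime w by blast
    qed
    have "\<exists>c\<in>P. c \<noteq> 0 \<and> vars_in (- {w}) c"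
    proof (cases "vars_in (- {w}) F")
      case True then show ?thesis using FP F0 by blast
    next
      case nf: False
      have "\<not> F dvd pd w F" by (rule not_dvd_pd[OF nf])
      from eliminate_variable[OF F nf this] obtain b c where
        bc: "b * F + c * pd w F \<noteq> 0" "vars_in (- {w}) (b * F + c * pd w F)" by blast
      have "b * F + c * pd w F \<in> P" by (intro id FP dFP)
      then show ?thesis using bc by blast
    qed
    then obtain c where c: "c \<in> P" "c \<noteq> 0" "vars_in (- {w}) c" by blast
    have "1 \<in> P"
      by (rule derivation_stable_ideal_trivial[OF Cid[of a, folded P_def] c]) (rule st)
    then show False using one by simp
  qed
qed

section \<open>The dimension of a hypersurface\<close>

definition psubst :: "'v mpoly \<Rightarrow> ('v \<Rightarrow> 'w mpoly) \<Rightarrow> 'w mpoly" where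
  "psubst P g = (\<Sum>m\<in>keys P. pconst (lookup P m) *
     (\<Prod>v\<in>keys m. g v ^ lookup m v))"

lemma peval_prod: "peval (prod f A) x = (\<Prod>i\<in>A. peval (f i) x)"
  by (induction A rule: infinite_finite_induct) (auto simp: peval_mult)

lemma peval_psubst: "peval (psubst P g) x = peval P (\<lambda>v. peval (g v) x)"
  by (simp add: psubst_def peval_sum peval_mult peval_prod peval_power peval_def[of P] meval_def)

lemma vars_in_sum: "(\<And>i. i \<in> A \<Longrightarrow> vars_in V (f i)) \<Longrightarrow> vars_in V (sum f A)"
  by (induction A rule: infinite_finite_induct) (auto intro: vars_in_add)

lemma vars_in_one: "vars_in V 1"
  by (simp add: vars_in_def)

lemma vars_in_power: "vars_in V f \<Longrightarrow> vars_in V (f ^ k)"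
  by (induction k) (auto intro: vars_in_mult vars_in_one)

lemma vars_in_prod: "(\<And>i. i \<in> A \<Longrightarrow> vars_in V (f i)) \<Longrightarrow> vars_in V (prod f A)"
  by (induction A rule: infinite_finite_induct) (auto intro: vars_in_mult vars_in_one)

lemma vars_in_psubst:
  assumes "vars_in W P" "\<And>v. v \<in> W \<Longrightarrow> vars_in V (g v)" shows "vars_in V (psubst P g)"
  unfolding psubst_def pconst_def
proof (intro vars_in_sum vars_in_mult vars_in_prod vars_in_power vars_in_single)
  fix m v assume "m \<in> keys P" "v \<in> keys m"
  then have "v \<in> W" using assms(1) unfolding vars_in_def by blast
  then show "vars_in V (g v)" by (rule assms(2))
qed auto

definition Xvar :: "'v \<Rightarrow> 'v mpoly" where
  "Xvar v = single (single v (Suc 0)) 1"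

lemma peval_Xvar [simp]: "peval (Xvar v) x = x v"
  by (simp add: Xvar_def meval_def)

text \<open>All variables except one, \<open>y\<close>, that occurs in \<open>F\<close>: a relation between them on \<open>X\<close> would be a nonzero
multiple of \<open>F\<close> free of \<open>y\<close>.\<close>

lemma hypersurface_alg_indep:
  fixes F :: "'s::finite mpoly"
  assumes F: "irreducible F"
  shows "\<exists>g. alg_indep_on (zero_set {F}) (CARD('s) - 1) g"
proof -
  obtain y where y: "\<not> vars_in (- {y}) F" using irreducible_involves_variable[OF F] by blast
  have F0: "F \<noteq> 0" using F by auto
  let ?k = "CARD('s) - 1"
  have "card (- {y}) = ?k" by (simp add: Compl_eq_Diff_UNIV card_Diff_singleton)
  then obtain e where e: "bij_betw e {..<?k} (- {y})"
    using ex_bij_betw_nat_finite[of "- {y}"] by (auto simp: lessThan_atLeast0)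
  have "alg_indep_on (zero_set {F}) ?k (\<lambda>i. Xvar (e i))"
    unfolding alg_indep_on_def
  proof (intro allI impI, elim conjE)
    fix P :: "nat mpoly"
    assume P: "\<forall>m\<in>keys P. keys m \<subseteq> {..<?k}"
      and van: "\<forall>x\<in>zero_set {F}. peval P (\<lambda>i. peval (Xvar (e i)) x) = 0"
    have Pv: "vars_in {..<?k} P" using P by (simp add: vars_in_def)
    let ?Q = "psubst P (\<lambda>i. Xvar (e i))"
    have "?Q \<in> vanishing_ideal (zero_set {F})" using van by (simp add: vanishing_ideal_def peval_psubst)
    then have "F dvd ?Q" unfolding vanishing_ideal_hypersurface[OF F] by simp
    then obtain k where k: "?Q = F * k" by (rule dvdE)
    have Qv: "vars_in (- {y}) ?Q"
    proof (rule vars_in_psubst[OF Pv])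
      fix i assume "i \<in> {..<?k}"
      then have "e i \<in> - {y}" using bij_betwE[OF e] by blast
      then show "vars_in (- {y}) (Xvar (e i))" unfolding Xvar_def by (intro vars_in_single) auto
    qed
    have Q0: "?Q = 0"
    proof (rule ccontr)
      assume "?Q \<noteq> 0"
      then have "k \<noteq> 0" using k by auto
      then have "vars_in (- {y}) F" using vars_in_factor(1)[of "- {y}" F k] Qv F0 unfolding k by blast
      then show False using y by simp
    qed
    show "P = 0"
    proof (rule peval_identity)
      fix z
      have "peval P z = peval P (\<lambda>i. z (inv_into {..<?k} e (e i)))"
        by (rule peval_vars_cong[OF Pv]) (use e in \<open>simp add: bij_betw_inv_into_left\<close>)
      also have "\<dots> = peval ?Q (\<lambda>v. z (inv_into {..<?k} e v))" by (simp add: peval_psubst)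
      finally show "peval P z = 0" by (simp add: Q0)
    qed
  qed
  then show ?thesis by blast
qed

lemma linear_dependence:
  fixes A :: "'h \<Rightarrow> 'm \<Rightarrow> complex"
  assumes "finite S" "finite H" "card S < card H"
  shows "\<exists>c. (\<exists>h\<in>H. c h \<noteq> 0) \<and> (\<forall>m\<in>S. (\<Sum>h\<in>H. c h * A h m) = 0)"
  using assms
proof (induction S arbitrary: H A rule: finite_induct)
  case empty
  then have "H \<noteq> {}" by auto
  then show ?case by (intro exI[of _ "\<lambda>_. 1"]) auto
next
  case (insert m S)
  show ?case
  proof (cases "\<forall>h\<in>H. A h m = 0")
    case True
    have "card S < card H" using insert by simp
    from insert.IH[OF insert.prems(1) this] obtain c where
      "\<exists>h\<in>H. c h \<noteq> 0" "\<forall>m\<in>S. (\<Sum>h\<in>H. c h * A h m) = 0" by blast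
    then show ?thesis using True by (intro exI[of _ c]) simp
  next
    case False
    then obtain h0 where h0: "h0 \<in> H" "A h0 m \<noteq> 0" by blast
    let ?H = "H - {h0}"
    have "card S < card ?H" "finite ?H" using insert h0 by auto
    from insert.IH[OF this(2,1), of "\<lambda>h m'. A h m' - A h m / A h0 m * A h0 m'"] obtain c where
      c: "\<exists>h\<in>?H. c h \<noteq> 0" "\<And>m'. m' \<in> S \<Longrightarrow> (\<Sum>h\<in>?H. c h * (A h m' - A h m / A h0 m * A h0 m')) = 0" by blast
    define c' where "c' = c(h0 := - (\<Sum>h\<in>?H. c h * A h m / A h0 m))"
    have s: "(\<Sum>h\<in>H. c' h * A h m') = (\<Sum>h\<in>?H. c h * (A h m' - A h m / A h0 m * A h0 m'))" for m'
    proof -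
      have "(\<Sum>h\<in>H. c' h * A h m') = c' h0 * A h0 m' + (\<Sum>h\<in>?H. c' h * A h m')"
        using insert.prems(1) h0(1) by (rule sum.remove)
      also have "(\<Sum>h\<in>?H. c' h * A h m') = (\<Sum>h\<in>?H. c h * A h m')"
        by (intro sum.cong refl) (simp add: c'_def)
      finally show ?thesis
        by (simp add: c'_def right_diff_distrib sum_subtractf sum_distrib_right mult.assoc)
    qed
    have "(\<Sum>h\<in>H. c' h * A h m') = 0" if "m' \<in> insert m S" for m'
      using that h0(2) c(2) unfolding s by auto
    moreover have "\<exists>h\<in>H. c' h \<noteq> 0" using c(1) by (auto simp: c'_def)
    ultimately show ?thesis by blast
  qed
qed

lemma lead_mon_1: "lead_mon (1 :: 'v::countable mpoly) = 0"
  using lead_mon(1)[of "1 :: 'v mpoly"] by simp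

text \<open>A leading term divisible by that of \<open>F\<close> is cancelled, any other one is moved to the remainder; in
both cases the weight decreases.\<close>

lemma division_remainder:
  fixes F :: "'s::finite mpoly"
  assumes "F \<noteq> 0"
  shows "\<exists>q r. h = q * F + r \<and> pweight r \<le> pweight h \<and>
    (\<forall>m\<in>keys r. \<exists>v. lookup m v < lookup (lead_mon F) v)"
proof (induction "pweight h" arbitrary: h rule: less_induct)
  case less
  let ?std = "\<lambda>m. \<exists>v. lookup m v < lookup (lead_mon F) v"
  show ?case
  proof (cases "h = 0")
    case True
    have "h = 0 * F + 0 \<and> pweight 0 \<le> pweight h \<and> (\<forall>m\<in>keys 0. ?std m)" using True by simp
    then show ?thesis by blast
  next
    case nz: False
    show ?thesis
    proof (cases "?std (lead_mon h)")
      case True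
      obtain c where c: "pweight (h - single (lead_mon h) c * 1) < pweight h"
        using lead_cancel[OF nz, of 1 "lead_mon h"] by (auto simp: lead_mon_1)
      let ?s = "single (lead_mon h) c"
      obtain q r where qr: "h - ?s * 1 = q * F + r" "pweight r \<le> pweight (h - ?s * 1)" "\<forall>m\<in>keys r. ?std m"
        using less.hyps[OF c] by blast
      have k: "m \<in> keys r \<or> m = lead_mon h" if "m \<in> keys (r + ?s)" for m
        using subsetD[OF Poly_Mapping.keys_add that] by (auto split: if_splits)
      have "h = q * F + (r + ?s)" using qr(1) by (simp add: algebra_simps)
      moreover have "pweight (r + ?s) \<le> pweight h"
      proof (rule pweight_le)
        fix m assume "m \<in> keys (r + ?s)"
        then show "mweight m \<le> pweight h"
          using k[of m] mweight_le_pweight[of m r] qr(2) c lead_mon(2)[OF nz] by auto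
      qed
      moreover have "\<forall>m\<in>keys (r + ?s). ?std m" using k qr(3) True by blast
      ultimately show ?thesis by blast
    next
      case False
      then have "\<And>v. lookup (lead_mon F) v \<le> lookup (lead_mon h) v" by (meson not_le)
      then obtain k where "lead_mon h = k + lead_mon F" by (rule mon_le_split)
      from lead_cancel[OF nz assms this] obtain c where c: "pweight (h - single k c * F) < pweight h" by blast
      obtain q r where qr: "h - single k c * F = q * F + r"
         "pweight r \<le> pweight (h - single k c * F)" "\<forall>m\<in>keys r. ?std m"
        using less.hyps[OF c] by blast
      have "h = (q + single k c) * F + r" using qr(1) by (simp add: algebra_simps)
      then show ?thesis using qr(2,3) c by (metis dual_order.trans less_imp_le)
    qed
  qed
qed

text \<open>With \<open>k\<close> fixed, the growth in \<open>T\<close> is of order \<open>s - 1\<close>, which is what bounds the dimension of \<open>X\<close>.\<close>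

lemma card_bounded_monomials:
  fixes v :: "'s::finite"
  shows "finite {m :: 's \<Rightarrow>\<^sub>0 nat. lookup m v < k \<and> (\<forall>u. lookup m u < T)} \<and>
    card {m :: 's \<Rightarrow>\<^sub>0 nat. lookup m v < k \<and> (\<forall>u. lookup m u < T)} \<le> k * T ^ (CARD('s) - 1)"
proof -
  let ?B = "PiE UNIV (\<lambda>u. if u = v then {..<k} else {..<T})"
  let ?A = "{m :: 's \<Rightarrow>\<^sub>0 nat. lookup m v < k \<and> (\<forall>u. lookup m u < T)}"
  have inj: "inj_on lookup ?A" by (simp add: inj_on_def poly_mapping_eqI)
  have sub: "lookup ` ?A \<subseteq> ?B" by auto
  have fin: "finite ?B" by (auto intro: finite_PiE)
  have "card ?B = (\<Prod>u\<in>UNIV. if u = v then k else T)"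
    by (subst card_PiE) (auto intro!: prod.cong)
  also have "\<dots> = k * (\<Prod>u\<in>UNIV - {v}. if u = v then k else T)"
    by (subst prod.remove[of _ v]) auto
  also have "(\<Prod>u\<in>UNIV - {v}. if u = v then k else T) = (\<Prod>u\<in>UNIV - {v}. T)"
    by (intro prod.cong) auto
  finally have "card ?B = k * T ^ (CARD('s) - 1)" by (simp add: card_Diff_singleton)
  then show ?thesis
    using card_inj_on_le[OF inj sub fin] finite_imageD[OF finite_subset[OF sub fin] inj] by simp
qed

text \<open>Counting: there are \<open>L\<^sup>s\<close> monomials in \<open>s\<close> given functions with exponents below \<open>L\<close>. Modulo \<open>F\<close> they lie in
a space of dimension \<open>O(L\<^sup>s\<^sup>-\<^sup>1)\<close>, because each monomial of a remainder has in some variable a smaller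
degree than the leading monomial of \<open>F\<close>, and its other degrees are at most the logarithm of its
weight, which is linear in \<open>L\<close>. For large \<open>L\<close> this forces an algebraic relation on \<open>X\<close>.\<close>

lemma hypersurface_alg_indep_le:
  fixes F :: "'s::finite mpoly"
  assumes F: "F \<noteq> 0" and ind: "alg_indep_on (zero_set {F}) k g"
  shows "k \<le> CARD('s) - 1"
proof (rule ccontr)
  assume "\<not> k \<le> CARD('s) - 1"
  let ?s = "CARD('s)"
  have sk: "?s \<le> k" and s1: "?s \<ge> 1" using \<open>\<not> k \<le> CARD('s) - 1\<close> zero_less_card_finite[where 'a='s] by linarith+
  \<comment> \<open>The weights of the \<open>g i\<close> are at most \<open>2\<^sup>a\<close>, those of the monomials in them less than \<open>2\<^sup>T\<close>; \<open>L\<close> is chosen to make \<open>M T\<^sup>s\<^sup>-\<^sup>1 < L\<^sup>s\<close>.\<close>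
  define a where "a = (\<Sum>i<?s. pweight (g i))"
  have ga: "pweight (g i) \<le> 2 ^ a" if "i < ?s" for i
  proof -
    have "pweight (g i) \<le> a" unfolding a_def using that by (intro member_le_sum) auto
    also have "a \<le> 2 ^ a" by simp
    finally show ?thesis .
  qed
  define M where "M = (\<Sum>v\<in>UNIV. lookup (lead_mon F) v)"
  define L where "L = M * (a * ?s + 1) ^ (?s - 1) + 1"
  define T where "T = a * ?s * L + 1"
  define H where "H = PiE {..<?s} (\<lambda>_. {..<L})"
  define G where "G h = (\<Prod>i<?s. g i ^ h i)" for h :: "nat \<Rightarrow> nat"
  define S where "S = (\<Union>v::'s. {m. lookup m v < lookup (lead_mon F) v \<and>
     (\<forall>u. lookup m u < T)})"
  have finS: "finite S" unfolding S_def using card_bounded_monomials by auto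
  have "card S \<le> (\<Sum>v\<in>UNIV. lookup (lead_mon F) v * T ^ (?s - 1))"
    unfolding S_def by (rule order_trans[OF card_UN_le]) (simp, rule sum_mono, rule conjunct2[OF card_bounded_monomials])
  also have "\<dots> = M * T ^ (?s - 1)" by (simp add: M_def sum_distrib_right)
  also have "\<dots> \<le> M * ((a * ?s + 1) * L) ^ (?s - 1)"
    by (intro mult_left_mono power_mono) (simp_all add: T_def L_def)
  also have "\<dots> = M * (a * ?s + 1) ^ (?s - 1) * L ^ (?s - 1)" by (simp only: power_mult_distrib mult.assoc)
  also have "\<dots> < L * L ^ (?s - 1)" by (intro mult_strict_right_mono) (simp_all add: L_def)
  also have "\<dots> = L ^ ?s" using s1 by (simp flip: power_Suc)
  also have "\<dots> = card H" by (simp add: H_def card_PiE)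
  finally have card: "card S < card H" .
  have finH: "finite H" by (simp add: H_def finite_PiE)
  have "pweight (G h) \<le> 2 ^ (a * ?s * L)" if h: "h \<in> H" for h
  proof -
    have pw: "pweight (f ^ j) = pweight f ^ j" for f :: "'s mpoly" and j
      by (induction j) (simp_all add: pweight_mult, simp add: pweight_def mweight_def)
    have pp: "pweight (prod f A) = (\<Prod>i\<in>A. pweight (f i))" if "finite A" for f :: "nat \<Rightarrow> 's mpoly" and A
      using that by (induction A) (simp_all add: pweight_mult, simp add: pweight_def mweight_def)
    have "pweight (G h) = (\<Prod>i<?s. pweight (g i) ^ h i)" by (simp add: G_def pp pw)
    also have "\<dots> \<le> (\<Prod>i<?s. (2 ^ a) ^ L)"
    proof (rule prod_mono)
      fix i assume i: "i \<in> {..<?s}"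
      then have "h i < L" using h by (auto simp: H_def)
      have "pweight (g i) ^ h i \<le> (2 ^ a) ^ h i" using ga i by (intro power_mono) auto
      also have "\<dots> \<le> (2 ^ a) ^ L" using \<open>h i < L\<close> by (intro power_increasing) auto
      finally show "0 \<le> pweight (g i) ^ h i \<and> pweight (g i) ^ h i \<le> (2 ^ a) ^ L" by simp
    qed
    also have "\<dots> = 2 ^ (a * ?s * L)" by (simp flip: power_mult add: ac_simps)
    finally show ?thesis .
  qed
  moreover obtain q r where qr: "\<And>h. G h = q h * F + r h" "\<And>h. pweight (r h) \<le> pweight (G h)"
    "\<And>h m. m \<in> keys (r h) \<Longrightarrow> \<exists>v. lookup m v < lookup (lead_mon F) v"
    using division_remainder[OF F, of "G _"] by metis
  ultimately have rS: "keys (r h) \<subseteq> S" if h: "h \<in> H" for h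
  proof (intro subsetI)
    fix m assume m: "m \<in> keys (r h)"
    have "lookup m u < T" for u
    proof -
      have "2 ^ lookup m u \<le> mweight m" by (rule lookup_le_log_weight)
      also have "\<dots> \<le> pweight (r h)" by (rule mweight_le_pweight[OF m])
      also have "\<dots> \<le> 2 ^ (a * ?s * L)"
        using qr(2)[of h] \<open>\<And>h. h \<in> H \<Longrightarrow> pweight (G h) \<le> 2 ^ (a * ?s * L)\<close>[OF h] by linarith
      finally have "lookup m u \<le> a * ?s * L" by simp
      then show ?thesis by (simp add: T_def)
    qed
    then show "m \<in> S" using qr(3)[OF m] unfolding S_def by blast
  qed
  from linear_dependence[OF finS finH card, of "\<lambda>h. lookup (r h)"] obtain c where
    c: "\<exists>h\<in>H. c h \<noteq> 0" "\<And>m. m \<in> S \<Longrightarrow> (\<Sum>h\<in>H. c h * lookup (r h) m) = 0" by blast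
  have sc: "lookup (pconst b * f) m = b * lookup f m" for b and f :: "'s mpoly" and m
    by (simp add: pconst_mult lookup_sum lookup_single when_def sum.delta in_keys_iff)
  have "(\<Sum>h\<in>H. pconst (c h) * r h) = 0"
  proof (rule poly_mapping_eqI)
    fix m
    show "lookup (\<Sum>h\<in>H. pconst (c h) * r h) m = lookup 0 m"
    proof (cases "m \<in> S")
      case True then show ?thesis using c(2) by (simp add: lookup_sum sc)
    next
      case False
      then have "lookup (r h) m = 0" if "h \<in> H" for h using rS[OF that] by (auto simp: in_keys_iff)
      then show ?thesis by (simp add: lookup_sum sc)
    qed
  qed
  from arg_cong[OF this, of "\<lambda>P. peval P _"]
  have "(\<Sum>h\<in>H. c h * peval (r h) x) = 0" for x
    by (simp add: peval_sum peval_mult)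
  then have van: "(\<Sum>h\<in>H. c h * peval (G h) x) = 0" if "x \<in> zero_set {F}" for x
    using that by (simp add: qr(1) peval_add peval_mult zero_set_def)
  define mon where "mon h = (\<Sum>i<?s. single i (h i))" for h :: "nat \<Rightarrow> nat"
  have lmon: "lookup (mon h) i = (if i < ?s then h i else 0)" for h i
    by (simp add: mon_def lookup_sum lookup_single when_def)
  have kmon: "keys (mon h) \<subseteq> {..<?s}" for h
    by (auto simp: in_keys_iff lmon split: if_splits)
  have inj: "mon h = mon h' \<longleftrightarrow> h = h'" if "h \<in> H" "h' \<in> H" for h h'
  proof
    assume e: "mon h = mon h'"
    have "h i = h' i" if "i \<in> {..<?s}" for i
      using arg_cong[OF e, of "\<lambda>m. lookup m i"] that by (simp add: lmon)
    then show "h = h'" using that unfolding H_def by (intro PiE_ext) auto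
  qed simp
  \<comment> \<open>The linear relation between the monomials, as a polynomial in new variables.\<close>
  define P where "P = (\<Sum>h\<in>H. single (mon h) (c h))"
  have Pk: "keys m \<subseteq> {..<k}" if "m \<in> keys P" for m
  proof -
    have "m \<in> (\<Union>h\<in>H. keys (single (mon h) (c h)))"
      using that Poly_Mapping.keys_sum[of "\<lambda>h. single (mon h) (c h)" H] unfolding P_def by blast
    then have "\<exists>h. m = mon h" by (auto split: if_splits)
    then show ?thesis using kmon sk by (metis lessThan_subset_iff subset_trans)
  qed
  have "peval P (\<lambda>i. peval (g i) x) = 0" if "x \<in> zero_set {F}" for x
  proof -
    have "meval (mon h) (\<lambda>i. peval (g i) x) = peval (G h) x" for h
      by (subst meval_superset[OF _ kmon]) (simp_all add: lmon G_def peval_prod peval_power)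
    then show ?thesis using van[OF that] by (simp add: P_def peval_sum)
  qed
  then have "P = 0" using ind Pk unfolding alg_indep_on_def by blast
  obtain h where h: "h \<in> H" "c h \<noteq> 0" using c(1) by blast
  have "lookup P (mon h) = (\<Sum>h'\<in>H. if h' = h then c h' else 0)"
    unfolding P_def lookup_sum lookup_single when_def using inj[OF _ h(1)] by (intro sum.cong) auto
  then show False using h finH \<open>P = 0\<close> by simp
qed

theorem variety_dim_hypersurface:
  fixes F :: "'s::finite mpoly"
  assumes "irreducible F" shows "variety_dim (zero_set {F}) = CARD('s) - 1"
  unfolding variety_dim_def
proof (rule Greatest_equality)
  have "F \<noteq> 0" using assms by auto
  then show "k \<le> CARD('s) - 1" if "\<exists>g. alg_indep_on (zero_set {F}) k g" for k
    using that hypersurface_alg_indep_le by blast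
qed (rule hypersurface_alg_indep[OF assms])

section \<open>Higher tangent spaces of a hypersurface\<close>

lemma mdeg_add: "mdeg (a + b) = mdeg a + mdeg b"
  by (simp add: mdeg_def lookup_add sum.distrib)

lemma mdeg_0 [simp]: "mdeg 0 = 0"
  by (simp add: mdeg_def)

lemma mdeg_eq_0: "mdeg a = 0 \<longleftrightarrow> a = 0"
  by (auto simp: mdeg_def intro: poly_mapping_eqI)

lemma lookup_le_mdeg: "lookup a v \<le> mdeg a"
  unfolding mdeg_def by (rule member_le_sum) auto

lemma below_add: "\<beta> \<in> below \<alpha> \<Longrightarrow> \<beta> + (\<alpha> - \<beta>) = \<alpha>"
  by (rule poly_mapping_eqI) (simp add: below_def lookup_add lookup_minus)

lemma mdeg_below: "\<beta> \<in> below \<alpha> \<Longrightarrow> mdeg \<alpha> = mdeg \<beta> + mdeg (\<alpha> - \<beta>)"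
  using below_add[of \<beta> \<alpha>] mdeg_add[of \<beta> "\<alpha> - \<beta>"] by simp

lemma finite_mdeg_le [simp]: "finite {\<alpha> :: 's::finite \<Rightarrow>\<^sub>0 nat. mdeg \<alpha> \<le> n}"
proof (rule finite_subset[OF _ finite_below])
  show "{\<alpha> :: 's \<Rightarrow>\<^sub>0 nat. mdeg \<alpha> \<le> n} \<subseteq> below (Abs_poly_mapping (\<lambda>_. n))"
    using lookup_le_mdeg order_trans by (fastforce simp: below_def)
qed

lemma finite_multi_indices [simp]: "finite (multi_indices n)"
  by (rule finite_subset[OF _ finite_mdeg_le[of n]]) (auto simp: multi_indices_def)

text \<open>The \<open>k\<close>-th power of the maximal ideal at \<open>p\<close>, described by Taylor coefficients.\<close>

definition vanish_order :: "('s::finite \<Rightarrow> complex) \<Rightarrow> nat \<Rightarrow> 's mpoly set" where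
  "vanish_order p k = {f. \<forall>\<alpha>. mdeg \<alpha> < k \<longrightarrow> taylor_coeff \<alpha> f p = 0}"

lemma vanish_order_mult:
  assumes "f \<in> vanish_order p i" "g \<in> vanish_order p j" shows "f * g \<in> vanish_order p (i + j)"
  unfolding vanish_order_def mem_Collect_eq
proof (intro allI impI)
  fix \<alpha> :: "'a \<Rightarrow>\<^sub>0 nat" assume a: "mdeg \<alpha> < i + j"
  show "taylor_coeff \<alpha> (f * g) p = 0"
    unfolding taylor_leibniz
  proof (rule sum.neutral, rule ballI)
    fix \<beta> assume "\<beta> \<in> below \<alpha>"
    then have "mdeg \<beta> < i \<or> mdeg (\<alpha> - \<beta>) < j" using a mdeg_below by force
    then show "taylor_coeff \<beta> f p * taylor_coeff (\<alpha> - \<beta>) g p = 0"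
      using assms by (auto simp: vanish_order_def)
  qed
qed

lemma vanish_order_0: "vanish_order p 0 = UNIV"
  by (simp add: vanish_order_def)

lemma vanish_order_1: "vanish_order p (Suc 0) = max_ideal_at p"
  by (auto simp: vanish_order_def max_ideal_at_def mdeg_eq_0 taylor_0)

lemma vanish_order_ideal: "ideal_set (vanish_order p k)"
  unfolding ideal_set_def
proof (intro conjI ballI allI)
  fix f r assume "f \<in> vanish_order p k"
  then show "r * f \<in> vanish_order p k" using vanish_order_mult[of r p 0 f k] by (simp add: vanish_order_0)
qed (auto simp: vanish_order_def taylor_add)

lemma vanish_order_power: "f \<in> max_ideal_at p \<Longrightarrow> f ^ k \<in> vanish_order p k"
proof (induction k)
  case (Suc k)
  then show ?case using vanish_order_mult[of f p "Suc 0" "f ^ k" k] by (simp add: vanish_order_1)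
qed (simp add: vanish_order_0)

lemma module_mult: "Modules.module ((*) :: 'a::comm_ring_1 \<Rightarrow> 'a \<Rightarrow> 'a)"
  by unfold_locales (simp_all add: algebra_simps)

lemma ideal_power_vanish: "ideal_power (max_ideal_at p) k \<subseteq> vanish_order p k"
  unfolding ideal_power_def
proof (rule module.span_minimal[OF module_mult])
  have "prod_list fs \<in> vanish_order p (length fs)" if "set fs \<subseteq> max_ideal_at p" for fs
    using that
  proof (induction fs)
    case (Cons f fs)
    then show ?case using vanish_order_mult[of f p "Suc 0" "prod_list fs" "length fs"] by (simp add: vanish_order_1)
  qed (simp add: vanish_order_0)
  then show "{prod_list fs |fs. set fs \<subseteq> max_ideal_at p \<and> length fs = k} \<subseteq> vanish_order p k" by auto
  show "module.subspace (*) (vanish_order p k)"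
    unfolding module.subspace_def[OF module_mult]
    using ideal_setD[OF vanish_order_ideal[of p k]] by auto
qed

text \<open>A truncated geometric series in \<open>u = 1 - b / b(p)\<close>.\<close>

lemma ex_inverse_jet:
  assumes "peval b p \<noteq> 0" shows "\<exists>i. 1 - b * i \<in> vanish_order p k"
proof -
  let ?c = "pconst (inverse (peval b p))"
  let ?u = "1 - b * ?c"
  have "?u \<in> max_ideal_at p" using assms by (simp add: max_ideal_at_def peval_minus peval_mult)
  then have "?u ^ k \<in> vanish_order p k" by (rule vanish_order_power)
  moreover have "1 - ?u ^ k = b * ?c * (\<Sum>i<k. ?u ^ i)"
    using one_diff_power_eq[of ?u k] by simp
  then have "?u ^ k = 1 - b * (?c * (\<Sum>i<k. ?u ^ i))" by (simp add: algebra_simps)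
  ultimately show ?thesis by metis
qed

text \<open>The functional on polynomials that the vector \<open>v\<close> represents in Taylor coordinates.\<close>

definition jet_eval :: "nat \<Rightarrow> (('s::finite \<Rightarrow>\<^sub>0 nat) \<Rightarrow> complex) \<Rightarrow> ('s \<Rightarrow> complex) \<Rightarrow> 's mpoly \<Rightarrow> complex" where
  "jet_eval n v p f = (\<Sum>\<alpha>\<in>multi_indices n. v \<alpha> * taylor_coeff \<alpha> f p)"

lemma jet_eval_add: "jet_eval n v p (f + g) = jet_eval n v p f + jet_eval n v p g"
  by (simp add: jet_eval_def taylor_add distrib_left sum.distrib)

lemma jet_eval_vanish: "f \<in> vanish_order p (n + 1) \<Longrightarrow> jet_eval n v p f = 0"
  unfolding jet_eval_def by (rule sum.neutral) (auto simp: vanish_order_def multi_indices_def)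

lemma jet_eval_cong: "f - g \<in> vanish_order p (n + 1) \<Longrightarrow> jet_eval n v p f = jet_eval n v p g"
  using jet_eval_add[of n v p "f - g" g] jet_eval_vanish[of "f - g" p n v] by simp

lemma taylor_scale: "taylor_coeff \<alpha> (pconst c * f) p = c * taylor_coeff \<alpha> f p"
proof -
  have "taylor_coeff \<alpha> (pconst c * f) p = (\<Sum>m\<in>keys f. c * lookup f m * taylor_mon \<alpha> m p)"
    by (simp only: pconst_mult taylor_sum taylor_single)
  then show ?thesis by (simp add: taylor_coeff_mon[of \<alpha> f] sum_distrib_left mult.assoc)
qed

lemma jet_eval_scale: "jet_eval n v p (pconst c * f) = c * jet_eval n v p f"
  by (simp add: jet_eval_def taylor_scale sum_distrib_left mult.left_commute)

text \<open>The functional on fractions is \<open>a/b \<mapsto> jet_eval (a i(b))\<close>, where \<open>i(b)\<close> inverts \<open>b\<close> to order \<open>n\<close> at \<open>p\<close>. All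
conditions reduce to the fact that \<open>jet_eval\<close> kills the functions vanishing to order \<open>n + 1\<close>; killing
the multiples of \<open>F\<close> is what the third one needs.\<close>

lemma jet_functional_of_vector:
  assumes I: "vanishing_ideal X = {G. F dvd G}"
    and ker: "\<And>f. jet_eval n v p (f * F) = 0"
  shows "\<exists>\<phi>. jet_functional n X p \<phi> \<and> (\<forall>f\<in>max_ideal_at p. \<phi> f 1 = jet_eval n v p f)"
proof -
  let ?O = "vanish_order p (n + 1)"
  note O = ideal_setD[OF vanish_order_ideal[of p "n + 1"]]
  obtain i where i: "\<And>b. b \<notin> max_ideal_at p \<Longrightarrow> 1 - b * i b \<in> ?O"
    using ex_inverse_jet[of _ p "n + 1"] unfolding max_ideal_at_def mem_Collect_eq by metis
  have prime: "b * b' \<notin> max_ideal_at p" if "b \<notin> max_ideal_at p" "b' \<notin> max_ideal_at p" for b b'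
    using that by (simp add: max_ideal_at_def peval_mult)
  define \<phi> where "\<phi> a b = jet_eval n v p (a * i b)" for a b
  have add: "\<phi> (a * b' + a' * b) (b * b') = \<phi> a b + \<phi> a' b'"
    if b: "b \<notin> max_ideal_at p" "b' \<notin> max_ideal_at p" for a b a' b'
  proof -
    let ?j = "i (b * b')"
    have j: "1 - b * b' * ?j \<in> ?O" by (rule i[OF prime[OF b]])
    have "(a * b' + a' * b) * ?j - (a * i b + a' * i b') =
      (a * b' * ?j * (1 - b * i b) + a' * b * ?j * (1 - b' * i b')) - (a * i b + a' * i b') * (1 - b * b' * ?j)"
      by (simp add: algebra_simps)
    also have "\<dots> \<in> ?O"
      by (rule O(5)[OF O(2)[OF O(3)[OF i[OF b(1)]] O(3)[OF i[OF b(2)]]] O(3)[OF j]])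
    finally show ?thesis unfolding \<phi>_def jet_eval_add[symmetric] by (rule jet_eval_cong)
  qed
  have loc: "\<phi> a b = 0" if loc: "in_local_power X p (n + 1) a" for a b
  proof -
    obtain h t where h: "h \<notin> max_ideal_at p" "t \<in> ideal_power (max_ideal_at p) (n + 1)" "F dvd h * a - t"
      using loc I unfolding in_local_power_def by blast
    obtain g where g: "h * a - t = F * g" using h(3) by (rule dvdE)
    have t: "t \<in> ?O" using ideal_power_vanish h(2) by blast
    have "a * i b - (i h * i b * g) * F = a * i b * (1 - h * i h) + i h * i b * ((h * a - t) - F * g) + i h * i b * t"
      by (simp add: algebra_simps)
    also have "\<dots> \<in> ?O" unfolding g diff_self mult_zero_right add_0_right using i[OF h(1)] t by (intro O(2) O(3))
    finally have "\<phi> a b = jet_eval n v p ((i h * i b * g) * F)" unfolding \<phi>_def by (rule jet_eval_cong)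
    then show ?thesis by (simp add: ker)
  qed
  have "jet_functional n X p \<phi>"
    unfolding jet_functional_def using add loc
    by (auto simp: \<phi>_def mult.assoc jet_eval_scale)
  moreover have "\<phi> f 1 = jet_eval n v p f" for f
    unfolding \<phi>_def
  proof (rule jet_eval_cong)
    have "1 - 1 * i 1 \<in> ?O" by (rule i) (simp add: max_ideal_at_def)
    then have "f * (1 - 1 * i 1) \<in> ?O" by (rule O(3))
    then have "(-1) * (f * (1 - 1 * i 1)) \<in> ?O" by (rule O(3))
    then show "f * i 1 - f \<in> ?O" by (simp add: algebra_simps)
  qed
  ultimately show ?thesis by blast
qed

lemma higher_tangent_kernel:
  assumes I: "vanishing_ideal X = {G. F dvd G}" and p: "peval F p = 0"
  shows "higher_tangent n X p =
    {v \<in> coord_space (multi_indices n). \<forall>f. jet_eval n v p (f * F) = 0}"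
proof (intro equalityI subsetI)
  fix v assume "v \<in> higher_tangent n X p"
  then obtain \<phi> where v: "v \<in> coord_space (multi_indices n)" and \<phi>: "jet_functional n X p \<phi>"
    "\<And>f. f \<in> max_ideal_at p \<Longrightarrow> \<phi> f 1 = jet_eval n v p f"
    unfolding higher_tangent_def jet_eval_def by auto
  have "jet_eval n v p (f * F) = 0" for f
  proof -
    have m: "f * F \<in> max_ideal_at p" using p by (simp add: max_ideal_at_def peval_mult)
    have "0 \<in> ideal_power (max_ideal_at p) (n + 1)"
      unfolding ideal_power_def by (rule module.span_zero[OF module_mult])
    moreover have "1 \<notin> max_ideal_at p" by (simp add: max_ideal_at_def)
    moreover have "1 * (f * F) - 0 \<in> vanishing_ideal X" unfolding I by simp
    ultimately have "in_local_power X p (n + 1) (f * F)" unfolding in_local_power_def by blast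
    then have "\<phi> (f * F) 1 = 0"
      using \<phi>(1) m \<open>1 \<notin> max_ideal_at p\<close> unfolding jet_functional_def by blast
    then show ?thesis using \<phi>(2)[OF m] by simp
  qed
  then show "v \<in> {v \<in> coord_space (multi_indices n). \<forall>f. jet_eval n v p (f * F) = 0}" using v by blast
next
  fix v assume "v \<in> {v \<in> coord_space (multi_indices n). \<forall>f. jet_eval n v p (f * F) = 0}"
  then show "v \<in> higher_tangent n X p"
    using jet_functional_of_vector[OF I] unfolding higher_tangent_def jet_eval_def by blast
qed

text \<open>Row \<open>\<beta>\<close> evaluated at \<open>q\<close> lists the Taylor coefficients at \<open>q\<close> of \<open>(x - q)\<^sup>\<beta> F\<close>.\<close>

definition jac :: "'s::finite mpoly \<Rightarrow> ('s \<Rightarrow>\<^sub>0 nat) \<Rightarrow> ('s \<Rightarrow>\<^sub>0 nat) \<Rightarrow> 's mpoly" where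
  "jac F \<beta> \<alpha> = (if \<beta> \<in> below \<alpha> then hasse (\<alpha> - \<beta>) F else 0)"

lemma peval_jac: "peval (jac F \<beta> \<alpha>) p = (if \<beta> \<in> below \<alpha> then taylor_coeff (\<alpha> - \<beta>) F p else 0)"
  by (simp add: jac_def peval_hasse)

lemma jet_eval_jac:
  "jet_eval n v p (f * F) = (\<Sum>\<beta> | mdeg \<beta> \<le> n. taylor_coeff \<beta> f p *
     (\<Sum>\<alpha>\<in>multi_indices n. peval (jac F \<beta> \<alpha>) p * v \<alpha>))"
proof -
  have "jet_eval n v p (f * F) = (\<Sum>\<alpha>\<in>multi_indices n. \<Sum>\<beta>\<in>below \<alpha>. v \<alpha> * (taylor_coeff \<beta> f p * taylor_coeff (\<alpha> - \<beta>) F p))"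
    by (simp add: jet_eval_def taylor_leibniz sum_distrib_left)
  also have "\<dots> = (\<Sum>\<alpha>\<in>multi_indices n. \<Sum>\<beta> | mdeg \<beta> \<le> n. taylor_coeff \<beta> f p * (peval (jac F \<beta> \<alpha>) p * v \<alpha>))"
  proof (rule sum.cong[OF refl])
    fix \<alpha> :: "'a \<Rightarrow>\<^sub>0 nat" assume "\<alpha> \<in> multi_indices n"
    then have "below \<alpha> \<subseteq> {\<beta>. mdeg \<beta> \<le> n}" using mdeg_below by (fastforce simp: multi_indices_def)
    then show "(\<Sum>\<beta>\<in>below \<alpha>. v \<alpha> * (taylor_coeff \<beta> f p * taylor_coeff (\<alpha> - \<beta>) F p)) =
       (\<Sum>\<beta> | mdeg \<beta> \<le> n. taylor_coeff \<beta> f p * (peval (jac F \<beta> \<alpha>) p * v \<alpha>))"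
      by (intro sum.mono_neutral_cong_left) (auto simp: peval_jac)
  qed
  also have "\<dots> = (\<Sum>\<beta> | mdeg \<beta> \<le> n. taylor_coeff \<beta> f p * (\<Sum>\<alpha>\<in>multi_indices n. peval (jac F \<beta> \<alpha>) p * v \<alpha>))"
    by (subst sum.swap) (simp add: sum_distrib_left)
  finally show ?thesis .
qed

text \<open>The product of the \<open>(x\<^sub>v - p\<^sub>v)\<close> to the powers \<open>\<beta>\<^sub>v\<close>, built one factor at a time.\<close>

lemma ex_dual_jet: "\<exists>f. \<forall>\<gamma>. taylor_coeff \<gamma> f p = (if \<gamma> = \<beta> then 1 else 0)" for \<beta> :: "'s::finite \<Rightarrow>\<^sub>0 nat"
proof (induction "mdeg \<beta>" arbitrary: \<beta>)
  case 0
  then have "\<beta> = 0" by (simp add: mdeg_eq_0)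
  moreover have "taylor_mon \<gamma> 0 p = (if \<gamma> = 0 then 1 else 0)" for \<gamma> :: "'s \<Rightarrow>\<^sub>0 nat"
  proof (cases "\<gamma> = 0")
    case False
    then obtain v where "lookup \<gamma> v \<noteq> 0" by (metis lookup_zero poly_mapping_eqI)
    then show ?thesis unfolding taylor_mon_def using False
      by (auto simp: binomial_eq_0 intro!: bexI[of _ v])
  qed (simp add: taylor_mon_0 meval_def)
  ultimately have "\<forall>\<gamma>. taylor_coeff \<gamma> (single 0 1) p = (if \<gamma> = \<beta> then 1 else 0)"
    by (simp only: taylor_single) simp
  then show ?case by blast
next
  case (Suc k)
  then have "\<beta> \<noteq> 0" by (metis mdeg_0 nat.distinct(1))
  then obtain v where v: "lookup \<beta> v \<noteq> 0" by (metis lookup_zero poly_mapping_eqI)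
  let ?b = "\<beta> - evec v"
  have eb: "evec v + ?b = \<beta>"
    using v by (intro poly_mapping_eqI) (auto simp: lookup_add lookup_minus lookup_single when_def)
  have me: "mdeg (evec v) = 1" by (simp add: mdeg_def lookup_single when_def)
  have "k = mdeg ?b" using Suc(2) mdeg_add[of "evec v" ?b] me by (simp add: eb)
  from Suc(1)[OF this] obtain f where f: "\<And>\<gamma>. taylor_coeff \<gamma> f p = (if \<gamma> = ?b then 1 else 0)" by blast
  let ?g = "Xvar v - pconst (p v)"
  have g: "taylor_coeff \<gamma> ?g p = (if \<gamma> = evec v then 1 else 0)" for \<gamma>
  proof -
    have c: "taylor_coeff \<gamma> (pconst a) p = (if \<gamma> = 0 then a else 0)" for a
    proof (cases "\<gamma> = 0")
      case False
      then obtain u where "lookup \<gamma> u \<noteq> 0" by (metis lookup_zero poly_mapping_eqI)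
      then have "taylor_mon \<gamma> 0 p = 0" unfolding taylor_mon_def by (auto simp: binomial_eq_0 intro!: bexI[of _ u])
      then show ?thesis using False by (simp add: pconst_def taylor_single)
    qed (simp add: taylor_0)
    have x: "taylor_coeff \<gamma> (Xvar v) p = (if \<gamma> = 0 then p v else if \<gamma> = evec v then 1 else 0)"
    proof (cases "\<gamma> = 0")
      case nz: False
      show ?thesis
      proof (cases "\<gamma> = evec v")
        case True
        have "taylor_mon (evec v) (evec v) p = 1" unfolding taylor_mon_def by (rule prod.neutral) simp
        then show ?thesis using True nz by (simp add: Xvar_def taylor_single)
      next
        case False
        then have "\<gamma> \<notin> below (evec v)" using nz by (simp add: below_evec)
        then obtain u where "lookup (evec v) u < lookup \<gamma> u" by (auto simp: below_def not_le)
        then have "taylor_mon \<gamma> (evec v) p = 0" unfolding taylor_mon_def by (auto simp: binomial_eq_0 intro!: bexI[of _ u])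
        then show ?thesis using False nz by (simp add: Xvar_def taylor_single)
      qed
    qed (simp add: taylor_0)
    have "evec v \<noteq> 0" by (metis lookup_single_eq lookup_zero nat.distinct(1))
    then show ?thesis by (auto simp: taylor_minus c x)
  qed
  have "taylor_coeff \<gamma> (?g * f) p = (if \<gamma> = \<beta> then 1 else 0)" for \<gamma>
  proof -
    have "taylor_coeff \<gamma> (?g * f) p = (\<Sum>\<delta>\<in>below \<gamma>. if \<delta> = evec v then (if \<gamma> - evec v = ?b then 1 else 0) else 0)"
      unfolding taylor_leibniz by (intro sum.cong refl) (simp add: f g)
    also have "\<dots> = (if evec v \<in> below \<gamma> \<and> \<gamma> - evec v = ?b then 1 else 0)" by simp
    also have "evec v \<in> below \<gamma> \<and> \<gamma> - evec v = ?b \<longleftrightarrow> \<gamma> = \<beta>"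
    proof
      assume a: "evec v \<in> below \<gamma> \<and> \<gamma> - evec v = ?b"
      have "\<gamma> = evec v + (\<gamma> - evec v)" by (rule below_add[OF conjunct1[OF a], symmetric])
      also have "\<dots> = \<beta>" unfolding conjunct2[OF a] by (rule eb)
      finally show "\<gamma> = \<beta>" .
    next
      assume "\<gamma> = \<beta>"
      moreover have "evec v \<in> below \<beta>" using v by (auto simp: below_def lookup_single when_def)
      ultimately show "evec v \<in> below \<gamma> \<and> \<gamma> - evec v = ?b" by simp
    qed
    finally show ?thesis .
  qed
  then show ?case by blast
qed

definition jac_kernel :: "nat \<Rightarrow> 's::finite mpoly \<Rightarrow> ('s \<Rightarrow> complex) \<Rightarrow> (('s \<Rightarrow>\<^sub>0 nat) \<Rightarrow> complex) set" where
  "jac_kernel n F p = {v \<in> coord_space (multi_indices n).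
     \<forall>\<beta>. mdeg \<beta> < n \<longrightarrow> (\<Sum>\<alpha>\<in>multi_indices n. peval (jac F \<beta> \<alpha>) p * v \<alpha>) = 0}"

text \<open>By the Leibniz rule \<open>jet_eval\<close> of \<open>f F\<close> is the combination of the rows of \<open>jac\<close> with the Taylor
coefficients of \<open>f\<close> as weights. These can be prescribed. The rows of degree \<open>n\<close> contribute only the
entry \<open>F(p) = 0\<close>.\<close>

theorem higher_tangent_hypersurface:
  fixes F :: "'s::finite mpoly"
  assumes F: "irreducible F" and p: "peval F p = 0"
  shows "higher_tangent n (zero_set {F}) p = jac_kernel n F p"
proof -
  have "(\<forall>f. jet_eval n v p (f * F) = 0) \<longleftrightarrow>
     (\<forall>\<beta>. mdeg \<beta> < n \<longrightarrow> (\<Sum>\<alpha>\<in>multi_indices n. peval (jac F \<beta> \<alpha>) p * v \<alpha>) = 0)" for v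
  proof (intro iffI allI impI)
    fix \<beta> :: "'s \<Rightarrow>\<^sub>0 nat" assume a: "\<forall>f. jet_eval n v p (f * F) = 0" and b: "mdeg \<beta> < n"
    obtain f where f: "\<And>\<gamma>. taylor_coeff \<gamma> f p = (if \<gamma> = \<beta> then 1 else 0)"
      using ex_dual_jet[of p \<beta>] by blast
    have "0 = jet_eval n v p (f * F)" using a by simp
    also have "\<dots> = (\<Sum>\<gamma> | mdeg \<gamma> \<le> n. if \<gamma> = \<beta> then (\<Sum>\<alpha>\<in>multi_indices n. peval (jac F \<gamma> \<alpha>) p * v \<alpha>) else 0)"
      unfolding jet_eval_jac by (intro sum.cong refl) (simp add: f)
    also have "\<dots> = (\<Sum>\<alpha>\<in>multi_indices n. peval (jac F \<beta> \<alpha>) p * v \<alpha>)" using b by simp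
    finally show "(\<Sum>\<alpha>\<in>multi_indices n. peval (jac F \<beta> \<alpha>) p * v \<alpha>) = 0" by simp
  next
    fix f assume a: "\<forall>\<beta>. mdeg \<beta> < n \<longrightarrow> (\<Sum>\<alpha>\<in>multi_indices n. peval (jac F \<beta> \<alpha>) p * v \<alpha>) = 0"
    show "jet_eval n v p (f * F) = 0"
      unfolding jet_eval_jac
    proof (rule sum.neutral, rule ballI)
      fix \<beta> :: "'s \<Rightarrow>\<^sub>0 nat" assume b: "\<beta> \<in> {\<beta>. mdeg \<beta> \<le> n}"
      have "(\<Sum>\<alpha>\<in>multi_indices n. peval (jac F \<beta> \<alpha>) p * v \<alpha>) = 0"
      proof (cases "mdeg \<beta> < n")
        case False
        have "peval (jac F \<beta> \<alpha>) p = 0" if "\<alpha> \<in> multi_indices n" for \<alpha>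
        proof (cases "\<beta> \<in> below \<alpha>")
          case True
          have "mdeg \<alpha> \<le> n" using that by (simp add: multi_indices_def)
          then have "\<alpha> - \<beta> = 0" using mdeg_below[OF True] False by (simp add: mdeg_eq_0[symmetric])
          then show ?thesis using p by (simp add: peval_jac taylor_0)
        qed (simp add: peval_jac)
        then show ?thesis by (intro sum.neutral) simp
      next
        case True
        then show ?thesis by (rule a[rule_format])
      qed
      then show "taylor_coeff \<beta> f p * (\<Sum>\<alpha>\<in>multi_indices n. peval (jac F \<beta> \<alpha>) p * v \<alpha>) = 0" by simp
    qed
  qed
  then show ?thesis
    unfolding higher_tangent_kernel[OF vanishing_ideal_hypersurface[OF F] p] jac_kernel_def by simp
qed

section \<open>Determinants with rows and columns in arbitrary index sets\<close>

definition fmat :: "'a list \<Rightarrow> 'b list \<Rightarrow> ('a \<Rightarrow> 'b \<Rightarrow> 'c) \<Rightarrow> 'c Matrix.mat" where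
  "fmat rs cs K = Matrix.mat (length rs) (length cs) (\<lambda>(i, j). K (rs ! i) (cs ! j))"

text \<open>Minors of the higher Jacobian matrix have monomials as row and column indices; the lists put them
in an order. The lemmas on kernels and inverses below are formulated with the underlying sets.\<close>

definition fdet :: "'a list \<Rightarrow> 'b list \<Rightarrow> ('a \<Rightarrow> 'b \<Rightarrow> 'c::comm_ring_1) \<Rightarrow> 'c" where
  "fdet rs cs K = Determinant.det (fmat rs cs K)"

lemma fmat_carrier [simp]: "fmat rs cs K \<in> carrier_mat (length rs) (length cs)"
  by (simp add: fmat_def)

lemma fmat_index [simp]:
  "i < length rs \<Longrightarrow> j < length cs \<Longrightarrow> index_mat (fmat rs cs K) (i, j) = K (rs ! i) (cs ! j)"
  by (simp add: fmat_def)

lemma sum_set_nth: "distinct xs \<Longrightarrow> (\<Sum>x\<in>set xs. f x) = (\<Sum>i\<in>{0..<length xs}. f (xs ! i))"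
  by (rule sum.reindex_bij_betw[symmetric], rule bij_betw_nth) (auto simp: lessThan_atLeast0)

lemma fdet_mult:
  assumes "length rs = length ms" "length cs = length ms" "distinct ms"
  shows "fdet rs cs (\<lambda>r c. \<Sum>m\<in>set ms. A r m * B m c) = fdet rs ms A * fdet ms cs B"
proof -
  have "fmat rs cs (\<lambda>r c. \<Sum>m\<in>set ms. A r m * B m c) = fmat rs ms A * fmat ms cs B"
    by (rule eq_matI) (auto simp: fmat_def scalar_prod_def sum_set_nth[OF assms(3)])
  moreover have "Determinant.det (fmat rs ms A * fmat ms cs B) = fdet rs ms A * fdet ms cs B"
    unfolding fdet_def using assms by (intro Determinant.det_mult[of _ "length ms"]) (auto simp: fmat_def)
  ultimately show ?thesis by (simp add: fdet_def)
qed

lemma peval_fdet: "peval (fdet rs cs K) q = fdet rs cs (\<lambda>r c. peval (K r c) q)"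
proof -
  interpret comm_ring_hom "\<lambda>P. peval P q"
    by unfold_locales (simp_all add: peval_add peval_mult)
  have "map_mat (\<lambda>P. peval P q) (fmat rs cs K) = fmat rs cs (\<lambda>r c. peval (K r c) q)"
    by (rule eq_matI) (auto simp: fmat_def)
  then show ?thesis using hom_det[of "fmat rs cs K"] by (simp add: fdet_def)
qed

lemma fdet_cong:
  assumes "\<And>r c. r \<in> set rs \<Longrightarrow> c \<in> set cs \<Longrightarrow> A r c = B r c" shows "fdet rs cs A = fdet rs cs B"
proof -
  have "fmat rs cs A = fmat rs cs B" by (rule eq_matI) (use assms in \<open>auto simp: fmat_def\<close>)
  then show ?thesis by (simp add: fdet_def)
qed

lemma fdet_scale: "fdet rs cs (\<lambda>r c. a * K r c) = a ^ length cs * fdet rs cs K"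
proof -
  have "fmat rs cs (\<lambda>r c. a * K r c) = a \<cdot>\<^sub>m fmat rs cs K" by (rule eq_matI) (auto simp: fmat_def)
  then show ?thesis by (simp add: fdet_def det_smult fmat_def)
qed

lemma fdet_triangular:
  fixes key :: "'a \<Rightarrow> nat"
  assumes srt: "sorted (map key rs)" and d: "distinct rs"
    and tri: "\<And>r r'. r \<in> set rs \<Longrightarrow> r' \<in> set rs \<Longrightarrow> r \<noteq> r' \<Longrightarrow> K r (h r') \<noteq> 0 \<Longrightarrow> key r < key r'"
    and diag: "\<And>r. r \<in> set rs \<Longrightarrow> K r (h r) = a"
  shows "fdet rs (map h rs) K = a ^ length rs"
proof -
  let ?A = "fmat rs (map h rs) K"
  have "upper_triangular ?A"
  proof (rule upper_triangularI)
    fix i j assume ij: "j < i" "i < dim_row ?A"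
    then have len: "i < length rs" "j < length rs" by (auto simp: fmat_def)
    have "key (rs ! j) \<le> key (rs ! i)" using sorted_nth_mono[OF srt, of j i] ij len by simp
    moreover have "rs ! i \<noteq> rs ! j" using d len ij by (simp add: nth_eq_iff_index_eq)
    ultimately have "K (rs ! i) (h (rs ! j)) = 0" using tri[of "rs ! i" "rs ! j"] len by force
    then show "index_mat ?A (i, j) = 0" using len by simp
  qed
  then have "Determinant.det ?A = prod_list (diag_mat ?A)"
    using fmat_carrier[of rs "map h rs" K] by (intro det_upper_triangular[of _ "length rs"]) simp_all
  also have "diag_mat ?A = map (\<lambda>_. a) [0..<length rs]"
    unfolding diag_mat_def by (auto simp: fmat_def diag)
  also have "prod_list \<dots> = a ^ length rs" by (simp add: map_replicate_const)
  finally show ?thesis by (simp add: fdet_def)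
qed

definition pos_in :: "'a list \<Rightarrow> 'a \<Rightarrow> nat" where
  "pos_in xs = inv_into {0..<length xs} ((!) xs)"

lemma pos_in_nth: "distinct xs \<Longrightarrow> i < length xs \<Longrightarrow> pos_in xs (xs ! i) = i"
  unfolding pos_in_def by (rule inv_into_f_f) (auto simp: inj_on_nth)

text \<open>The adjugate matrix, with entries in the ring itself: this is what makes Cramer's rule polynomial.\<close>

lemma fdet_adjugate:
  assumes len: "length rs = length cs" and d: "distinct rs" "distinct cs"
  shows "\<exists>B. (\<forall>r\<in>set rs. \<forall>r'\<in>set rs. (\<Sum>c\<in>set cs. K r c * B c r') = (if r = r' then fdet rs cs K else 0)) \<and>
    (\<forall>c\<in>set cs. \<forall>c'\<in>set cs. (\<Sum>r\<in>set rs. B c r * K r c') = (if c = c' then fdet rs cs K else 0))"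
proof -
  let ?A = "fmat rs cs K" and ?k = "length cs"
  have A: "?A \<in> carrier_mat ?k ?k" using fmat_carrier[of rs cs K] len by simp
  note adj = adj_mat[OF A]
  define B where "B c r = index_mat (adj_mat ?A) (pos_in cs c, pos_in rs r)" for c r
  have dim: "dim_row (adj_mat ?A) = ?k" "dim_col (adj_mat ?A) = ?k" "dim_row ?A = ?k" "dim_col ?A = ?k"
    using adj(1) A by auto
  have 1: "(\<Sum>c\<in>set cs. K r c * B c r') = (if r = r' then fdet rs cs K else 0)" if rr: "r \<in> set rs" "r' \<in> set rs" for r r'
  proof -
    obtain i j where ij: "i < ?k" "r = rs ! i" "j < ?k" "r' = rs ! j" using rr len by (metis in_set_conv_nth)
    have "(\<Sum>c\<in>set cs. K r c * B c r') = index_mat (?A * adj_mat ?A) (i, j)"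
      using ij len d by (simp add: sum_set_nth scalar_prod_def B_def pos_in_nth dim)
    also have "\<dots> = (if r = r' then fdet rs cs K else 0)"
      unfolding adj(2) using ij len d by (simp add: fdet_def nth_eq_iff_index_eq)
    finally show ?thesis .
  qed
  have 2: "(\<Sum>r\<in>set rs. B c r * K r c') = (if c = c' then fdet rs cs K else 0)" if cc: "c \<in> set cs" "c' \<in> set cs" for c c'
  proof -
    obtain i j where ij: "i < ?k" "c = cs ! i" "j < ?k" "c' = cs ! j" using cc by (metis in_set_conv_nth)
    have "(\<Sum>r\<in>set rs. B c r * K r c') = index_mat (adj_mat ?A * ?A) (i, j)"
      using ij len d by (simp add: sum_set_nth scalar_prod_def B_def pos_in_nth dim)
    also have "\<dots> = (if c = c' then fdet rs cs K else 0)"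
      unfolding adj(3) using ij len d by (simp add: fdet_def nth_eq_iff_index_eq)
    finally show ?thesis .
  qed
  from 1 2 show ?thesis by (intro exI[of _ B]) simp
qed

lemma fdet_zero_kernel:
  fixes K :: "'a \<Rightarrow> 'b \<Rightarrow> 'c::field"
  assumes len: "length rs = length cs" and d: "distinct cs" and z: "fdet rs cs K = 0"
  shows "\<exists>x. (\<exists>c\<in>set cs. x c \<noteq> 0) \<and> (\<forall>r\<in>set rs. (\<Sum>c\<in>set cs. K r c * x c) = 0)"
proof -
  let ?A = "fmat rs cs K" and ?k = "length cs"
  have A: "?A \<in> carrier_mat ?k ?k" using fmat_carrier[of rs cs K] len by simp
  obtain v where v: "v \<in> carrier_vec ?k" "v \<noteq> 0\<^sub>v ?k" "?A *\<^sub>v v = 0\<^sub>v ?k"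
    using det_0_iff_vec_prod_zero_field[OF A] z unfolding fdet_def by blast
  define x where "x c = vec_index v (pos_in cs c)" for c
  have "\<exists>i<?k. vec_index v i \<noteq> 0"
  proof (rule ccontr)
    assume "\<not> (\<exists>i<?k. vec_index v i \<noteq> 0)"
    then have "v = 0\<^sub>v ?k" using v(1) by (intro eq_vecI) auto
    then show False using v(2) by simp
  qed
  then obtain i where "i < ?k" "vec_index v i \<noteq> 0" by blast
  then have "cs ! i \<in> set cs" "x (cs ! i) \<noteq> 0" using d by (simp_all add: x_def pos_in_nth)
  then have "\<exists>c\<in>set cs. x c \<noteq> 0" by blast
  moreover have "(\<Sum>c\<in>set cs. K r c * x c) = 0" if r: "r \<in> set rs" for r
  proof -
    obtain i where i: "i < ?k" "r = rs ! i" using r len by (metis in_set_conv_nth)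
    have "(\<Sum>c\<in>set cs. K r c * x c) = vec_index (?A *\<^sub>v v) i"
      using i len d v(1) by (simp add: sum_set_nth x_def pos_in_nth scalar_prod_def fmat_def)
    then show ?thesis unfolding v(3) using i by simp
  qed
  ultimately show ?thesis by blast
qed

lemma fdet_nz_kernel:
  fixes K :: "'a \<Rightarrow> 'b \<Rightarrow> 'c::field"
  assumes len: "length rs = length cs" and d: "distinct rs" "distinct cs" and nz: "fdet rs cs K \<noteq> 0"
    and x: "\<And>r. r \<in> set rs \<Longrightarrow> (\<Sum>c\<in>set cs. K r c * x c) = 0" and c: "c \<in> set cs"
  shows "x c = 0"
proof -
  from fdet_adjugate[OF len d, of K] obtain B where
    B: "\<forall>c\<in>set cs. \<forall>c'\<in>set cs. (\<Sum>r\<in>set rs. B c r * K r c') = (if c = c' then fdet rs cs K else 0)"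
    by (elim exE conjE)
  have "0 = (\<Sum>r\<in>set rs. B c r * (\<Sum>c'\<in>set cs. K r c' * x c'))" using x by simp
  also have "\<dots> = (\<Sum>c'\<in>set cs. (\<Sum>r\<in>set rs. B c r * K r c') * x c')"
    unfolding sum_distrib_left sum_distrib_right by (subst sum.swap) (simp add: mult.assoc)
  also have "\<dots> = (\<Sum>c'\<in>set cs. if c' = c then fdet rs cs K * x c else 0)"
    by (intro sum.cong refl) (simp add: B[rule_format, OF c])
  also have "\<dots> = fdet rs cs K * x c" using c by simp
  finally show ?thesis using nz by simp
qed

section \<open>Subspaces that project isomorphically onto coordinates\<close>

text \<open>The condition defining the chart \<open>J\<close> of the Grassmannian.\<close>

definition projects_onto :: "'i set \<Rightarrow> ('i \<Rightarrow> complex) set \<Rightarrow> bool" where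
  "projects_onto J W \<longleftrightarrow> (\<forall>u. \<exists>!w. w \<in> W \<and> (\<forall>j\<in>J. w j = u j))"

text \<open>The basis of \<open>W\<close> that projects to the standard basis; its entries are the chart coordinates of \<open>W\<close>.\<close>

definition chart_basis :: "'i set \<Rightarrow> ('i \<Rightarrow> complex) set \<Rightarrow> 'i \<Rightarrow> 'i \<Rightarrow> complex" where
  "chart_basis J W j = (THE w. w \<in> W \<and> (\<forall>l\<in>J. w l = (if l = j then 1 else 0)))"

lemma chart_basis:
  assumes "projects_onto J W"
  shows "chart_basis J W j \<in> W" "l \<in> J \<Longrightarrow> chart_basis J W j l = (if l = j then 1 else 0)"
  using theI'[OF assms[unfolded projects_onto_def, rule_format, of "\<lambda>l. if l = j then 1 else 0"]]
  by (auto simp: chart_basis_def)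

lemma projects_onto_eq:
  assumes "projects_onto J W" "w \<in> W" "w' \<in> W" "\<And>j. j \<in> J \<Longrightarrow> w j = w' j"
  shows "w = w'"
  using assms(1)[unfolded projects_onto_def, rule_format, of w'] assms(2-4) by blast

lemma fun_scale_apply [simp]: "fun_scale c v i = c * v i"
  by (simp add: fun_scale_def)

lemma fun_sum_apply: "(sum f A :: 'i \<Rightarrow> complex) i = (\<Sum>a\<in>A. f a i)"
  by (induction A rule: infinite_finite_induct) auto

lemma chart_basis_expand:
  assumes P: "projects_onto J W" and W: "fun_space.subspace W" and J: "finite J" and w: "w \<in> W"
  shows "w = (\<Sum>j\<in>J. fun_scale (w j) (chart_basis J W j))"
proof (rule projects_onto_eq[OF P w])
  show "(\<Sum>j\<in>J. fun_scale (w j) (chart_basis J W j)) \<in> W"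
    by (intro fun_space.subspace_sum[OF W] fun_space.subspace_scale[OF W] chart_basis(1)[OF P])
  fix l assume "l \<in> J"
  then show "w l = (\<Sum>j\<in>J. fun_scale (w j) (chart_basis J W j)) l"
    using J by (simp add: fun_sum_apply chart_basis(2)[OF P] if_distrib cong: if_cong)
qed

lemma inj_chart_basis:
  assumes P: "projects_onto J W" shows "inj_on (chart_basis J W) J"
proof (rule inj_onI)
  fix i j assume ij: "i \<in> J" "j \<in> J" "chart_basis J W i = chart_basis J W j"
  have "chart_basis J W i i = 1" "chart_basis J W j i = (if i = j then 1 else 0)"
    using chart_basis(2)[OF P ij(1)] by simp_all
  then show "i = j" using ij(3) by (simp split: if_splits)
qed

lemma independent_chart_basis:
  assumes P: "projects_onto J W" and J: "finite J"
  shows "fun_space.independent (chart_basis J W ` J)"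
proof (rule fun_space.independent_if_scalars_zero)
  let ?b = "chart_basis J W"
  show "finite (?b ` J)" using J by simp
  fix f x assume s: "(\<Sum>x\<in>?b ` J. fun_scale (f x) x) = 0" and x: "x \<in> ?b ` J"
  obtain j where j: "j \<in> J" "x = ?b j" using x by blast
  have "0 = (\<Sum>x\<in>?b ` J. fun_scale (f x) x) j" unfolding s by simp
  also have "\<dots> = (\<Sum>i\<in>J. f (?b i) * ?b i j)" by (simp add: sum.reindex[OF inj_chart_basis[OF P]] fun_sum_apply)
  also have "\<dots> = (\<Sum>i\<in>J. if i = j then f (?b j) else 0)"
    by (intro sum.cong refl) (auto simp: chart_basis(2)[OF P j(1)])
  also have "\<dots> = f x" using j J by simp
  finally show "f x = 0" by simp
qed

lemma chart_basis_spans: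
  assumes "projects_onto J W" "fun_space.subspace W" "finite J"
  shows "W \<subseteq> fun_space.span (chart_basis J W ` J)"
proof
  fix w assume "w \<in> W"
  then have "w = (\<Sum>j\<in>J. fun_scale (w j) (chart_basis J W j))" by (rule chart_basis_expand[OF assms])
  also have "\<dots> \<in> fun_space.span (chart_basis J W ` J)"
    by (intro fun_space.span_sum fun_space.span_scale fun_space.span_base) auto
  finally show "w \<in> fun_space.span (chart_basis J W ` J)" .
qed

lemma dim_projects_onto:
  assumes P: "projects_onto J W" and W: "fun_space.subspace W" and J: "finite J"
  shows "fun_space.dim W = card J"
proof -
  have "fun_space.dim W = card (chart_basis J W ` J)"
    by (rule fun_space.dim_unique[OF _ chart_basis_spans[OF assms] independent_chart_basis[OF P J]])
       (use chart_basis(1)[OF P] in auto)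
  then show ?thesis by (simp add: card_image[OF inj_chart_basis[OF P]])
qed

text \<open>Equality by dimension. The ambient space of functions may have infinite dimension, so the exchange
lemma is applied to the chart bases.\<close>

lemma projects_onto_subset_eq:
  assumes W: "projects_onto J W" "fun_space.subspace W" "finite J"
    and V: "projects_onto K V" "fun_space.subspace V" "finite K"
    and sub: "W \<subseteq> V" and card: "card J = card K"
  shows "W = V"
proof
  show "V \<subseteq> W"
  proof (rule ccontr)
    assume "\<not> V \<subseteq> W"
    then obtain x where x: "x \<in> V" "x \<notin> W" by blast
    let ?b = "chart_basis J W" and ?c = "chart_basis K V"
    have spW: "fun_space.span (?b ` J) \<subseteq> W"
      by (rule fun_space.span_minimal[OF _ W(2)]) (use chart_basis(1)[OF W(1)] in blast)
    then have "fun_space.independent (insert x (?b ` J))"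
      using x(2) independent_chart_basis[OF W(1,3)] by (intro fun_space.independent_insertI) blast+
    moreover have "insert x (?b ` J) \<subseteq> fun_space.span (?c ` K)"
      using chart_basis_spans[OF V] x(1) sub chart_basis(1)[OF W(1)] by blast
    ultimately have "card (insert x (?b ` J)) \<le> card (?c ` K)"
      using fun_space.independent_span_bound[of "?c ` K" "insert x (?b ` J)"] V(3) by simp
    also have "\<dots> \<le> card K" by (rule card_image_le[OF V(3)])
    also have "\<dots> = card (?b ` J)" by (simp add: card_image[OF inj_chart_basis[OF W(1)]] card)
    finally show False using x(2) W(3) chart_basis(1)[OF W(1)] by (simp add: card_insert_if split: if_splits) blast
  qed
qed (rule sub)

section \<open>Counting multi-indices\<close>

text \<open>A monomial in \<open>V \<union> {v}\<close> of degree at most \<open>n + 1\<close> is either free of \<open>v\<close> or \<open>v\<close> times a monomial of degree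
at most \<open>n\<close>; this is Pascal's rule.\<close>

lemma card_monomials_le:
  fixes V :: "'s::finite set"
  shows "card {\<alpha> :: 's \<Rightarrow>\<^sub>0 nat. keys \<alpha> \<subseteq> V \<and> mdeg \<alpha> \<le> n} = (card V + n) choose (card V)"
proof -
  have "finite V" by simp
  then show ?thesis
  proof (induction V arbitrary: n rule: finite_induct)
    case empty
    have "{\<alpha> :: 's \<Rightarrow>\<^sub>0 nat. keys \<alpha> \<subseteq> {} \<and> mdeg \<alpha> \<le> n} = {0}" by auto
    then show ?case by simp
  next
    case (insert v V)
    note outer = insert
    show ?case
    proof (induction n)
      case 0
      have "{\<alpha> :: 's \<Rightarrow>\<^sub>0 nat. keys \<alpha> \<subseteq> insert v V \<and> mdeg \<alpha> \<le> 0} = {0}" by (auto simp: mdeg_eq_0)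
      then show ?case by simp
    next
      case (Suc n)
      let ?S = "\<lambda>V n. {\<alpha> :: 's \<Rightarrow>\<^sub>0 nat. keys \<alpha> \<subseteq> V \<and> mdeg \<alpha> \<le> n}"
      have fin: "finite (?S V n)" for V n by (rule finite_subset[OF _ finite_mdeg_le[of n]]) auto
      have me: "mdeg (evec v) = 1" by (simp add: mdeg_def lookup_single when_def)
      have "?S (insert v V) (Suc n) = ?S V (Suc n) \<union> (\<lambda>\<beta>. \<beta> + evec v) ` ?S (insert v V) n"
      proof (intro equalityI subsetI)
        fix \<alpha> assume a: "\<alpha> \<in> ?S (insert v V) (Suc n)"
        show "\<alpha> \<in> ?S V (Suc n) \<union> (\<lambda>\<beta>. \<beta> + evec v) ` ?S (insert v V) n"
        proof (cases "v \<in> keys \<alpha>")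
          case True
          have e: "\<alpha> - evec v + evec v = \<alpha>"
            using True by (intro poly_mapping_eqI) (auto simp: lookup_add lookup_minus lookup_single when_def in_keys_iff)
          have "mdeg (\<alpha> - evec v) + 1 = mdeg \<alpha>" using mdeg_add[of "\<alpha> - evec v" "evec v"] me by (simp only: e)
          moreover have "keys (\<alpha> - evec v) \<subseteq> insert v V"
            using a by (auto simp: in_keys_iff lookup_minus lookup_single when_def subset_iff split: if_splits)
          ultimately have "\<alpha> - evec v \<in> ?S (insert v V) n" using a by auto
          then have "(\<alpha> - evec v) + evec v \<in> (\<lambda>\<beta>. \<beta> + evec v) ` ?S (insert v V) n" by (rule imageI)
          then show ?thesis unfolding e by blast
        next
          case False
          then show ?thesis using a by auto
        qed
      next
        fix \<alpha> assume "\<alpha> \<in> ?S V (Suc n) \<union> (\<lambda>\<beta>. \<beta> + evec v) ` ?S (insert v V) n"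
        then show "\<alpha> \<in> ?S (insert v V) (Suc n)"
        proof
          assume "\<alpha> \<in> (\<lambda>\<beta>. \<beta> + evec v) ` ?S (insert v V) n"
          then obtain \<beta> where b: "\<alpha> = \<beta> + evec v" "keys \<beta> \<subseteq> insert v V" "mdeg \<beta> \<le> n" by blast
          then have "keys \<alpha> \<subseteq> insert v V" using Poly_Mapping.keys_add[of \<beta> "evec v"] by auto
          then show ?thesis using b me by (simp add: mdeg_add)
        qed auto
      qed
      moreover have "?S V (Suc n) \<inter> (\<lambda>\<beta>. \<beta> + evec v) ` ?S (insert v V) n = {}"
      proof -
        have "v \<in> keys (\<beta> + evec v)" for \<beta> :: "'s \<Rightarrow>\<^sub>0 nat" by (simp add: in_keys_iff lookup_add)
        then show ?thesis using outer(2) by blast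
      qed
      ultimately have "card (?S (insert v V) (Suc n)) = card (?S V (Suc n)) + card ((\<lambda>\<beta>. \<beta> + evec v) ` ?S (insert v V) n)"
        using fin by (simp add: card_Un_disjoint)
      also have "card ((\<lambda>\<beta>. \<beta> + evec v) ` ?S (insert v V) n) = card (?S (insert v V) n)"
        by (rule card_image) (simp add: inj_on_def)
      also have "card (?S V (Suc n)) + card (?S (insert v V) n) = (card (insert v V) + Suc n) choose card (insert v V)"
        unfolding outer(3) Suc using outer(1,2) by simp
      finally show ?case .
    qed
  qed
qed

text \<open>The chart that contains the kernel of the higher Jacobian matrix at the points of \<open>X\<close> where \<open>\<partial>F/\<partial>v\<close>
does not vanish.\<close>

definition free_indices :: "nat \<Rightarrow> 's::finite \<Rightarrow> ('s \<Rightarrow>\<^sub>0 nat) set" where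
  "free_indices n v = {\<alpha> \<in> multi_indices n. lookup \<alpha> v = 0}"

lemma card_minus_zero:
  fixes S :: "('s::finite \<Rightarrow>\<^sub>0 nat) set"
  assumes "finite S" "0 \<in> S" shows "card (S - {0}) = card S - 1"
  using assms by (simp add: card_Diff_singleton)

lemma card_free_indices: "card (free_indices n v) = ((CARD('s) - 1 + n) choose (CARD('s) - 1)) - 1"
  for v :: "'s::finite"
proof -
  let ?S = "{\<alpha> :: 's \<Rightarrow>\<^sub>0 nat. keys \<alpha> \<subseteq> - {v} \<and> mdeg \<alpha> \<le> n}"
  have "free_indices n v = ?S - {0}"
    by (auto simp: free_indices_def multi_indices_def in_keys_iff mdeg_eq_0 Suc_le_eq) (metis gr0I mdeg_eq_0)
  moreover have "card (?S - {0}) = card ?S - 1"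
    by (rule card_minus_zero) (auto intro: finite_subset[OF _ finite_mdeg_le[of n]])
  moreover have "card (- {v}) = CARD('s) - 1" by (simp add: Compl_eq_Diff_UNIV card_Diff_singleton)
  ultimately show ?thesis unfolding card_monomials_le by simp
qed

lemma card_multi_indices: "card (multi_indices n :: ('s::finite \<Rightarrow>\<^sub>0 nat) set) = ((CARD('s) + n) choose CARD('s)) - 1"
proof -
  let ?S = "{\<alpha> :: 's \<Rightarrow>\<^sub>0 nat. keys \<alpha> \<subseteq> UNIV \<and> mdeg \<alpha> \<le> n}"
  have "multi_indices n = ?S - {0}"
    by (auto simp: multi_indices_def mdeg_eq_0 Suc_le_eq) (metis gr0I mdeg_eq_0)
  moreover have "card (?S - {0}) = card ?S - 1" by (rule card_minus_zero) auto
  ultimately show ?thesis using card_monomials_le[of "UNIV :: 's set" n] by simp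
qed

definition row_indices :: "nat \<Rightarrow> ('s::finite \<Rightarrow>\<^sub>0 nat) set" where
  "row_indices n = {\<beta>. mdeg \<beta> < n}"

lemma finite_row_indices [simp]: "finite (row_indices n)"
  by (rule finite_subset[OF _ finite_mdeg_le[of n]]) (auto simp: row_indices_def)

lemma shift_row_indices: "multi_indices n - free_indices n v = (\<lambda>\<beta>. \<beta> + evec v) ` row_indices n"
proof -
  have me: "mdeg (evec v) = 1" by (simp add: mdeg_def lookup_single when_def)
  show ?thesis
  proof (intro equalityI subsetI)
    fix \<alpha> assume a: "\<alpha> \<in> multi_indices n - free_indices n v"
    then have "lookup \<alpha> v \<noteq> 0" by (simp add: free_indices_def)
    then have e: "\<alpha> - evec v + evec v = \<alpha>"
      by (intro poly_mapping_eqI) (auto simp: lookup_add lookup_minus lookup_single when_def)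
    have "mdeg (\<alpha> - evec v) + 1 = mdeg \<alpha>" using mdeg_add[of "\<alpha> - evec v" "evec v"] me by (simp only: e)
    then have "\<alpha> - evec v \<in> row_indices n" using a by (simp add: row_indices_def multi_indices_def)
    then have "(\<alpha> - evec v) + evec v \<in> (\<lambda>\<beta>. \<beta> + evec v) ` row_indices n" by (rule imageI)
    then show "\<alpha> \<in> (\<lambda>\<beta>. \<beta> + evec v) ` row_indices n" unfolding e .
  next
    fix \<alpha> assume "\<alpha> \<in> (\<lambda>\<beta>. \<beta> + evec v) ` row_indices n"
    then show "\<alpha> \<in> multi_indices n - free_indices n v"
      by (auto simp: row_indices_def multi_indices_def free_indices_def mdeg_add me lookup_add)
  qed
qed

lemma card_row_indices:
  "card (multi_indices n - free_indices n v) = card (row_indices n :: ('s \<Rightarrow>\<^sub>0 nat) set)" for v :: "'s::finite"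
  unfolding shift_row_indices by (rule card_image) (simp add: inj_on_def)

section \<open>The kernel of the higher Jacobian matrix in charts\<close>

definition elems :: "'a set \<Rightarrow> 'a list" where
  "elems S = (SOME xs. set xs = S \<and> distinct xs)"

lemma elems: "finite S \<Longrightarrow> set (elems S) = S \<and> distinct (elems S)"
  unfolding elems_def by (rule someI_ex[OF finite_distinct_list])

lemma length_elems: "finite S \<Longrightarrow> length (elems S) = card S"
  using elems[of S] by (metis distinct_card)

text \<open>The maximal minor of \<open>jac\<close> that uses the columns outside \<open>J\<close>; it decides whether the kernel lies in
the chart \<open>J\<close>.\<close>

definition jac_minor :: "nat \<Rightarrow> 's::finite mpoly \<Rightarrow> ('s \<Rightarrow>\<^sub>0 nat) set \<Rightarrow> 's mpoly" where
  "jac_minor n F J = fdet (elems (row_indices n)) (elems (multi_indices n - J)) (jac F)"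

lemma subspace_coord_space: "fun_space.subspace (coord_space I)"
  by (auto simp: fun_space.subspace_def coord_space_def)

lemma subspace_jac_kernel: "fun_space.subspace (jac_kernel n F q)"
  using subspace_coord_space[of "multi_indices n"]
  unfolding fun_space.subspace_def jac_kernel_def
  by (auto simp: distrib_left sum.distrib mult.left_commute simp flip: sum_distrib_left)

lemma jac_kernel_split:
  assumes J: "J \<subseteq> multi_indices n" and w: "w \<in> coord_space (multi_indices n)"
  shows "w \<in> jac_kernel n F q \<longleftrightarrow> (\<forall>\<beta>\<in>row_indices n. (\<Sum>\<alpha>\<in>multi_indices n - J. peval (jac F \<beta> \<alpha>) q * w \<alpha>)
       = - (\<Sum>\<alpha>\<in>J. peval (jac F \<beta> \<alpha>) q * w \<alpha>))"
proof -
  have "(\<Sum>\<alpha>\<in>multi_indices n. peval (jac F \<beta> \<alpha>) q * w \<alpha>) = 0 \<longleftrightarrow>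
     (\<Sum>\<alpha>\<in>multi_indices n - J. peval (jac F \<beta> \<alpha>) q * w \<alpha>) = - (\<Sum>\<alpha>\<in>J. peval (jac F \<beta> \<alpha>) q * w \<alpha>)" for \<beta>
    unfolding sum.subset_diff[OF J finite_multi_indices] by (simp add: eq_neg_iff_add_eq_0)
  then show ?thesis using w by (simp add: jac_kernel_def row_indices_def)
qed

text \<open>A kernel vector with prescribed entries in \<open>J\<close> solves a square linear system for its other entries,
with determinant \<open>jac_minor n F J\<close>. Cramer's rule expresses the coordinates as polynomials over this
determinant.\<close>

lemma jac_kernel_chart:
  fixes F :: "'s::finite mpoly"
  assumes J: "J \<subseteq> multi_indices n" and card: "card (multi_indices n - J) = card (row_indices n :: ('s \<Rightarrow>\<^sub>0 nat) set)"
  shows "projects_onto J (jac_kernel n F q) \<longleftrightarrow> peval (jac_minor n F J) q \<noteq> 0" (is ?iff)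
    and "\<exists>N. \<forall>q. peval (jac_minor n F J) q \<noteq> 0 \<longrightarrow> (\<forall>j\<in>J. \<forall>i\<in>multi_indices n - J.
       peval (jac_minor n F J) q * chart_basis J (jac_kernel n F q) j i = peval (N j i) q)" (is ?coord)
proof -
  let ?I = "multi_indices n" and ?R = "row_indices n :: ('s \<Rightarrow>\<^sub>0 nat) set"
  let ?rs = "elems ?R" and ?cs = "elems (?I - J)"
  have fin: "finite (?I - J)" "finite J" using finite_subset[OF J finite_multi_indices] by auto
  have len: "length ?rs = length ?cs" using card by (simp add: length_elems)
  have rs: "set ?rs = ?R" "distinct ?rs" using elems[of ?R] by auto
  have cs: "set ?cs = ?I - J" "distinct ?cs" using elems[OF fin(1)] by auto
  from fdet_adjugate[OF len rs(2) cs(2), of "jac F"] obtain B where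
    B: "\<forall>r\<in>?R. \<forall>r'\<in>?R. (\<Sum>c\<in>?I - J. jac F r c * B c r') = (if r = r' then jac_minor n F J else 0)"
    "\<forall>c\<in>?I - J. \<forall>c'\<in>?I - J. (\<Sum>r\<in>?R. B c r * jac F r c') = (if c = c' then jac_minor n F J else 0)"
    unfolding rs(1) cs(1) jac_minor_def[symmetric] by (elim exE conjE)
  note B1 = B(1)[rule_format] and B2 = B(2)[rule_format]
  let ?d = "\<lambda>q. peval (jac_minor n F J) q"
  have dq: "?d q = fdet ?rs ?cs (\<lambda>r c. peval (jac F r c) q)" for q
    by (simp add: jac_minor_def peval_fdet)
  have b1: "(\<Sum>c\<in>?I - J. peval (jac F r c) q * peval (B c r') q) = (if r = r' then ?d q else 0)"
    if "r \<in> ?R" "r' \<in> ?R" for r r' q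
    using arg_cong[OF B1[OF that], of "\<lambda>P. peval P q"] by (simp add: peval_sum peval_mult split: if_splits)
  have solve: "?d q * w i = - (\<Sum>j\<in>J. (\<Sum>\<beta>\<in>?R. peval (B i \<beta>) q * peval (jac F \<beta> j) q) * w j)"
    if w: "w \<in> jac_kernel n F q" and i: "i \<in> ?I - J" for w i q
  proof -
    have k: "(\<Sum>\<alpha>\<in>?I - J. peval (jac F \<beta> \<alpha>) q * w \<alpha>) = - (\<Sum>\<alpha>\<in>J. peval (jac F \<beta> \<alpha>) q * w \<alpha>)" if "\<beta> \<in> ?R" for \<beta>
      using jac_kernel_split[OF J, of w F q] w that by (auto simp: jac_kernel_def)
    have b2: "(\<Sum>r\<in>?R. peval (B i r) q * peval (jac F r c') q) = (if i = c' then ?d q else 0)" if "c' \<in> ?I - J" for c'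
      using arg_cong[OF B2[OF i that], of "\<lambda>P. peval P q"] by (simp add: peval_sum peval_mult split: if_splits)
    have "?d q * w i = (\<Sum>c\<in>?I - J. if c = i then ?d q * w i else 0)" using i fin by simp
    also have "\<dots> = (\<Sum>c\<in>?I - J. (\<Sum>r\<in>?R. peval (B i r) q * peval (jac F r c) q) * w c)"
      by (intro sum.cong refl) (auto simp: b2)
    also have "\<dots> = (\<Sum>r\<in>?R. peval (B i r) q * (\<Sum>c\<in>?I - J. peval (jac F r c) q * w c))"
      unfolding sum_distrib_left sum_distrib_right by (subst sum.swap) (simp add: mult.assoc)
    also have "\<dots> = (\<Sum>r\<in>?R. peval (B i r) q * - (\<Sum>\<alpha>\<in>J. peval (jac F r \<alpha>) q * w \<alpha>))"
      by (intro sum.cong refl) (simp add: k)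
    also have "\<dots> = - (\<Sum>r\<in>?R. \<Sum>\<alpha>\<in>J. peval (B i r) q * (peval (jac F r \<alpha>) q * w \<alpha>))"
      by (simp add: sum_negf sum_distrib_left)
    also have "(\<Sum>r\<in>?R. \<Sum>\<alpha>\<in>J. peval (B i r) q * (peval (jac F r \<alpha>) q * w \<alpha>)) =
        (\<Sum>j\<in>J. (\<Sum>\<beta>\<in>?R. peval (B i \<beta>) q * peval (jac F \<beta> j) q) * w j)"
      unfolding sum_distrib_right by (subst sum.swap) (simp add: mult.assoc)
    finally show ?thesis .
  qed
  have onto: "projects_onto J (jac_kernel n F q)" if nz: "?d q \<noteq> 0" for q
    unfolding projects_onto_def
  proof
    fix u :: "('s \<Rightarrow>\<^sub>0 nat) \<Rightarrow> complex"
    define y where "y \<beta> = (\<Sum>j\<in>J. peval (jac F \<beta> j) q * u j)" for \<beta>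
    \<comment> \<open>Cramer's rule.\<close>
    define w where "w \<alpha> = (if \<alpha> \<in> J then u \<alpha> else if \<alpha> \<in> ?I then - (\<Sum>\<beta>\<in>?R. peval (B \<alpha> \<beta>) q * y \<beta>) / ?d q else 0)" for \<alpha>
    have wc: "w \<in> coord_space ?I" using J by (auto simp: coord_space_def w_def)
    have "(\<Sum>\<alpha>\<in>?I - J. peval (jac F \<beta> \<alpha>) q * w \<alpha>) = - y \<beta>" if b: "\<beta> \<in> ?R" for \<beta>
    proof -
      have "(\<Sum>\<alpha>\<in>?I - J. peval (jac F \<beta> \<alpha>) q * w \<alpha>) =
         - (\<Sum>\<alpha>\<in>?I - J. \<Sum>\<beta>'\<in>?R. peval (jac F \<beta> \<alpha>) q * (peval (B \<alpha> \<beta>') q * y \<beta>')) / ?d q"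
        unfolding sum_negf[symmetric] sum_divide_distrib
        by (intro sum.cong refl) (simp add: w_def sum_distrib_left sum_negf sum_divide_distrib)
      also have "(\<Sum>\<alpha>\<in>?I - J. \<Sum>\<beta>'\<in>?R. peval (jac F \<beta> \<alpha>) q * (peval (B \<alpha> \<beta>') q * y \<beta>')) =
          (\<Sum>\<beta>'\<in>?R. (\<Sum>\<alpha>\<in>?I - J. peval (jac F \<beta> \<alpha>) q * peval (B \<alpha> \<beta>') q) * y \<beta>')"
        unfolding sum_distrib_right by (subst sum.swap) (simp add: mult.assoc)
      also have "\<dots> = (\<Sum>\<beta>'\<in>?R. if \<beta>' = \<beta> then ?d q * y \<beta> else 0)"
        by (intro sum.cong refl) (auto simp: b1[OF b])
      also have "\<dots> = ?d q * y \<beta>" using b by simp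
      finally show ?thesis using nz by simp
    qed
    moreover have "(\<Sum>\<alpha>\<in>J. peval (jac F \<beta> \<alpha>) q * w \<alpha>) = y \<beta>" for \<beta>
      unfolding y_def by (intro sum.cong refl) (simp add: w_def)
    ultimately have wk: "w \<in> jac_kernel n F q" unfolding jac_kernel_split[OF J wc] by simp
    show "\<exists>!w. w \<in> jac_kernel n F q \<and> (\<forall>j\<in>J. w j = u j)"
    proof (rule ex1I[of _ w])
      show "w \<in> jac_kernel n F q \<and> (\<forall>j\<in>J. w j = u j)" using wk by (simp add: w_def)
      fix w' assume w': "w' \<in> jac_kernel n F q \<and> (\<forall>j\<in>J. w' j = u j)"
      show "w' = w"
      proof
        fix \<alpha>
        consider "\<alpha> \<in> J" | "\<alpha> \<in> ?I - J" | "\<alpha> \<notin> ?I" using J by blast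
        then show "w' \<alpha> = w \<alpha>"
        proof cases
          case 1 then show ?thesis using w' by (simp add: w_def)
        next
          case 2
          have "(\<Sum>j\<in>J. (\<Sum>\<beta>\<in>?R. peval (B \<alpha> \<beta>) q * peval (jac F \<beta> j) q) * w' j) =
             (\<Sum>j\<in>J. (\<Sum>\<beta>\<in>?R. peval (B \<alpha> \<beta>) q * peval (jac F \<beta> j) q) * w j)"
            by (intro sum.cong refl) (use w' in \<open>simp add: w_def\<close>)
          then have "?d q * w' \<alpha> = ?d q * w \<alpha>"
            using solve[of w' q \<alpha>] solve[of w q \<alpha>] w' wk 2 by simp
          then show ?thesis using nz by simp
        next
          case 3 then show ?thesis using w' wc by (auto simp: coord_space_def jac_kernel_def)
        qed
      qed
    qed
  qed
  show ?iff
  proof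
    assume P: "projects_onto J (jac_kernel n F q)"
    show "?d q \<noteq> 0"
    proof
      assume "?d q = 0"
      from fdet_zero_kernel[OF len cs(2) this[unfolded dq]]
      obtain x where "(\<exists>c\<in>?I - J. x c \<noteq> 0) \<and> (\<forall>r\<in>?R. (\<Sum>c\<in>?I - J. peval (jac F r c) q * x c) = 0)"
        unfolding rs(1) cs(1) by (elim exE)
      then have x: "\<exists>c\<in>?I - J. x c \<noteq> 0" "\<And>r. r \<in> ?R \<Longrightarrow> (\<Sum>c\<in>?I - J. peval (jac F r c) q * x c) = 0" by simp_all
      define w where "w \<alpha> = (if \<alpha> \<in> ?I - J then x \<alpha> else 0)" for \<alpha>
      have wc: "w \<in> coord_space ?I" by (auto simp: coord_space_def w_def)
      have "(\<Sum>\<alpha>\<in>?I - J. peval (jac F \<beta> \<alpha>) q * w \<alpha>) = (\<Sum>\<alpha>\<in>?I - J. peval (jac F \<beta> \<alpha>) q * x \<alpha>)" for \<beta>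
        by (intro sum.cong refl) (simp add: w_def)
      moreover have "(\<Sum>\<alpha>\<in>J. peval (jac F \<beta> \<alpha>) q * w \<alpha>) = 0" for \<beta>
        by (rule sum.neutral) (simp add: w_def)
      ultimately have "w \<in> jac_kernel n F q" unfolding jac_kernel_split[OF J wc] using x(2) by simp
      moreover have "0 \<in> jac_kernel n F q" by (rule fun_space.subspace_0[OF subspace_jac_kernel])
      ultimately have "w = 0" by (rule projects_onto_eq[OF P]) (simp add: w_def)
      then show False using x(1) by (auto simp: w_def fun_eq_iff split: if_splits)
    qed
  qed (rule onto)
  define N where "N j i = - (\<Sum>\<beta>\<in>?R. B i \<beta> * jac F \<beta> j)" for j i
  have "?d q * chart_basis J (jac_kernel n F q) j i = peval (N j i) q"
    if nz: "?d q \<noteq> 0" and j: "j \<in> J" and i: "i \<in> ?I - J" for q j i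
  proof -
    let ?w = "chart_basis J (jac_kernel n F q) j"
    note cb = chart_basis[OF onto[OF nz]]
    have "?d q * ?w i = - (\<Sum>l\<in>J. (\<Sum>\<beta>\<in>?R. peval (B i \<beta>) q * peval (jac F \<beta> l) q) * ?w l)"
      by (rule solve[OF cb(1) i])
    also have "(\<Sum>l\<in>J. (\<Sum>\<beta>\<in>?R. peval (B i \<beta>) q * peval (jac F \<beta> l) q) * ?w l) =
       (\<Sum>l\<in>J. if l = j then (\<Sum>\<beta>\<in>?R. peval (B i \<beta>) q * peval (jac F \<beta> j) q) else 0)"
      by (intro sum.cong refl) (simp add: cb(2))
    finally show ?thesis using j fin(2) by (simp add: N_def peval_uminus peval_sum peval_mult)
  qed
  then show ?coord by blast
qed

lemma mdeg_1:
  fixes \<alpha> :: "'s::finite \<Rightarrow>\<^sub>0 nat"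
  assumes a: "mdeg \<alpha> = 1" shows "\<exists>u. \<alpha> = evec u"
proof -
  have me: "mdeg (evec v) = 1" for v :: 's by (simp add: mdeg_def lookup_single when_def)
  have "\<alpha> \<noteq> 0" using a by auto
  then obtain v where v: "lookup \<alpha> v \<noteq> 0" by (metis lookup_zero poly_mapping_eqI)
  have e: "(\<alpha> - evec v) + evec v = \<alpha>"
    by (rule poly_mapping_eqI) (use v in \<open>auto simp: lookup_add lookup_minus lookup_single when_def\<close>)
  then have "mdeg (\<alpha> - evec v) = 0" using mdeg_add[of "\<alpha> - evec v" "evec v"] a me[of v] by simp
  then have "\<alpha> = evec v" using e by (simp add: mdeg_eq_0)
  then show ?thesis by blast
qed

text \<open>The entry is the Taylor coefficient at \<open>\<gamma> = \<beta>' + e\<^sub>v - \<beta>\<close>, and \<open>\<gamma> \<noteq> 0\<close> as \<open>F(q) = 0\<close>. So \<open>|\<beta>| \<le> |\<beta>'|\<close>, and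
in case of equality \<open>\<gamma>\<close> is a unit vector \<open>e\<^sub>u\<close> with \<open>u \<noteq> v\<close>, whence \<open>\<beta>\<^sub>v = \<beta>'\<^sub>v + 1\<close>. The key encodes the
lexicographic order by \<open>|\<beta>|\<close> and then decreasing \<open>\<beta>\<^sub>v\<close>.\<close>

lemma jac_triangular:
  assumes q: "peval F q = 0" and K: "\<beta> \<in> row_indices n" "\<beta>' \<in> row_indices n" "\<beta> \<noteq> \<beta>'"
    and nz: "peval (jac F \<beta> (\<beta>' + evec v)) q \<noteq> 0"
  shows "mdeg \<beta> * (n + 1) + (n - lookup \<beta> v) < mdeg \<beta>' * (n + 1) + (n - lookup \<beta>' v)"
proof -
  let ?l = lookup
  let ?\<gamma> = "\<beta>' + evec v - \<beta>"
  have me: "mdeg (evec u) = 1" for u :: 'a by (simp add: mdeg_def lookup_single when_def)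
  have bel: "\<beta> \<in> below (\<beta>' + evec v)" using nz by (auto simp: peval_jac split: if_splits)
  then have "taylor_coeff ?\<gamma> F q \<noteq> 0" using nz by (simp add: peval_jac)
  then have "?\<gamma> \<noteq> 0" using q taylor_0 by metis
  then have g: "mdeg ?\<gamma> \<ge> 1" by (simp add: Suc_le_eq neq0_conv[symmetric] mdeg_eq_0)
  have sum: "\<beta> + ?\<gamma> = \<beta>' + evec v" by (rule below_add[OF bel])
  have deg: "mdeg \<beta> + mdeg ?\<gamma> = mdeg \<beta>' + 1" using arg_cong[OF sum, of mdeg] by (simp only: mdeg_add me)
  have len: "?l \<beta> v \<le> n" "?l \<beta>' v \<le> n"
    using lookup_le_mdeg[of \<beta> v] lookup_le_mdeg[of \<beta>' v] K by (auto simp: row_indices_def)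
  show ?thesis
  proof (cases "mdeg \<beta> = mdeg \<beta>'")
    case False
    then have "mdeg \<beta> + 1 \<le> mdeg \<beta>'" using deg g by linarith
    then have "(mdeg \<beta> + 1) * (n + 1) \<le> mdeg \<beta>' * (n + 1)" by (rule mult_le_mono1)
    then show ?thesis by (simp add: algebra_simps)
  next
    case True
    then have "mdeg ?\<gamma> = 1" using deg by linarith
    then obtain u where "?\<gamma> = evec u" using mdeg_1 by blast
    then have e: "\<beta> + evec u = \<beta>' + evec v" using sum by simp
    have "u \<noteq> v" using e K(3) by auto
    then have "?l \<beta> v = ?l \<beta>' v + 1" using arg_cong[OF e, of "\<lambda>m. ?l m v"] by (simp add: lookup_add lookup_single when_def)
    then show ?thesis using True len by simp
  qed
qed

lemma ex_sorted_rows: "\<exists>rs. set rs = row_indices n \<and> distinct rs \<and>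
   (\<forall>F q. peval F q = 0 \<longrightarrow> fdet rs (map (\<lambda>\<beta>. \<beta> + evec v) rs) (\<lambda>r c. peval (jac F r c) q)
      = peval (pd v F) q ^ card (row_indices n :: ('s \<Rightarrow>\<^sub>0 nat) set))" for v :: "'s::finite"
proof -
  let ?R = "row_indices n :: ('s \<Rightarrow>\<^sub>0 nat) set"
  \<comment> \<open>The key of \<open>jac_triangular\<close>.\<close>
  define key where "key \<beta> = mdeg \<beta> * (n + 1) + (n - lookup \<beta> v)" for \<beta>
  define rs where "rs = sort_key key (elems ?R)"
  have rs: "set rs = ?R" "distinct rs" "sorted (map key rs)" using elems[of ?R] by (simp_all add: rs_def)
  have "fdet rs (map (\<lambda>\<beta>. \<beta> + evec v) rs) (\<lambda>r c. peval (jac F r c) q) = peval (pd v F) q ^ length rs"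
    if q: "peval F q = 0" for F q
  proof (rule fdet_triangular[OF rs(3,2)])
    fix r r' assume "r \<in> set rs" "r' \<in> set rs" "r \<noteq> r'" "peval (jac F r (r' + evec v)) q \<noteq> 0"
    then show "key r < key r'" using jac_triangular[OF q, of r n r' v] unfolding rs(1) key_def by blast
  next
    fix r :: "'s \<Rightarrow>\<^sub>0 nat"
    have "r \<in> below (r + evec v)" by (simp add: below_def lookup_add)
    then show "peval (jac F r (r + evec v)) q = peval (pd v F) q"
      by (simp add: peval_jac peval_hasse)
  qed
  moreover have "length rs = card ?R" using rs(1,2) by (metis distinct_card)
  ultimately show ?thesis using rs by auto
qed

lemma jac_minor_free_indices:
  fixes F :: "'s::finite mpoly"
  assumes q: "peval F q = 0" and nz: "peval (pd v F) q \<noteq> 0"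
  shows "peval (jac_minor n F (free_indices n v)) q \<noteq> 0"
proof
  let ?R = "row_indices n :: ('s \<Rightarrow>\<^sub>0 nat) set" and ?C = "multi_indices n - free_indices n v"
  assume z: "peval (jac_minor n F (free_indices n v)) q = 0"
  from ex_sorted_rows[of n v] obtain rs where rs0: "set rs = ?R" "distinct rs"
      "\<forall>F q. peval F q = 0 \<longrightarrow> fdet rs (map (\<lambda>\<beta>. \<beta> + evec v) rs) (\<lambda>r c. peval (jac F r c) q) = peval (pd v F) q ^ card ?R"
    by (elim exE conjE)
  note rs = rs0(1,2) rs0(3)[rule_format, OF q]
  have len: "length (elems ?R) = length (elems ?C)" by (simp add: length_elems card_row_indices)
  have fC: "finite ?C" by simp
  note eC = elems[OF fC] and eR = elems[OF finite_row_indices[of n, where 'a='s]]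
  from fdet_zero_kernel[OF len conjunct2[OF eC] z[unfolded jac_minor_def peval_fdet]]
  obtain x where "(\<exists>c\<in>?C. x c \<noteq> 0) \<and> (\<forall>r\<in>?R. (\<Sum>c\<in>?C. peval (jac F r c) q * x c) = 0)"
    unfolding conjunct1[OF eC] conjunct1[OF eR] by (elim exE)
  then have x: "\<exists>c\<in>?C. x c \<noteq> 0" "\<And>r. r \<in> ?R \<Longrightarrow> (\<Sum>c\<in>?C. peval (jac F r c) q * x c) = 0" by simp_all
  have cs: "set (map (\<lambda>\<beta>. \<beta> + evec v) rs) = ?C" "distinct (map (\<lambda>\<beta>. \<beta> + evec v) rs)"
    using rs by (simp_all add: shift_row_indices distinct_map inj_on_def)
  have "x c = 0" if "c \<in> ?C" for c
    by (rule fdet_nz_kernel[of rs "map (\<lambda>\<beta>. \<beta> + evec v) rs" "\<lambda>r c. peval (jac F r c) q"])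
       (use rs nz cs x that in \<open>simp_all only: cs length_map rs power_not_zero not_False_eq_True\<close>)
  then show False using x(1) by blast
qed

text \<open>For \<open>n = 1\<close> the matrix has the gradient as its only row, so the tangent space has dimension \<open>s - 1\<close> or
\<open>s\<close>.\<close>

theorem singular_locus_hypersurface:
  fixes F :: "'s::finite mpoly"
  assumes F: "irreducible F" and p: "peval F p = 0"
  shows "p \<in> singular_locus (zero_set {F}) \<longleftrightarrow> (\<forall>v. peval (pd v F) p = 0)"
proof -
  have dimX: "variety_dim (zero_set {F}) = CARD('s) - 1" by (rule variety_dim_hypersurface[OF F])
  have pX: "p \<in> zero_set {F}" using p by (simp add: zero_set_def)
  have T: "higher_tangent 1 (zero_set {F}) p = jac_kernel 1 F p" by (rule higher_tangent_hypersurface[OF F p])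
  have s: "CARD('s) \<ge> 1" using zero_less_card_finite[where 'a='s] by linarith
  have card_ne: "CARD('s) \<noteq> CARD('s) - Suc 0" using s by linarith
  show ?thesis
  proof (cases "\<forall>v. peval (pd v F) p = 0")
    case False
    then obtain v where v: "peval (pd v F) p \<noteq> 0" by blast
    have "projects_onto (free_indices 1 v) (jac_kernel 1 F p)"
      using jac_kernel_chart(1)[of "free_indices 1 v" 1] card_row_indices[of 1 v] jac_minor_free_indices[OF p v]
      by (auto simp: free_indices_def)
    from dim_projects_onto[OF this subspace_jac_kernel]
    have "fun_space.dim (jac_kernel 1 F p) = card (free_indices 1 v)" by (auto simp: free_indices_def)
    also have "\<dots> = CARD('s) - 1"
    proof -
      obtain d where "CARD('s) = Suc d" using s by (cases "CARD('s)") auto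
      then show ?thesis unfolding card_free_indices by simp
    qed
    finally show ?thesis using False by (simp add: singular_locus_def T[unfolded One_nat_def] dimX)
  next
    case True
    have "peval (jac F \<beta> \<alpha>) p = 0" if "mdeg \<beta> < 1" "\<alpha> \<in> multi_indices 1" for \<alpha> \<beta>
    proof -
      have b: "\<beta> = 0" using that(1) by (simp add: mdeg_eq_0)
      have "mdeg \<alpha> = 1" using that(2) by (auto simp: multi_indices_def)
      then obtain v where "\<alpha> = evec v" using mdeg_1 by blast
      then show ?thesis using True by (simp add: peval_jac b peval_hasse)
    qed
    then have "jac_kernel 1 F p = coord_space (multi_indices 1)" by (auto simp: jac_kernel_def)
    moreover have "projects_onto I (coord_space I)" for I :: "('s \<Rightarrow>\<^sub>0 nat) set"
      unfolding projects_onto_def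
    proof
      fix u :: "('s \<Rightarrow>\<^sub>0 nat) \<Rightarrow> complex"
      show "\<exists>!w. w \<in> coord_space I \<and> (\<forall>j\<in>I. w j = u j)"
        by (rule ex1I[of _ "\<lambda>i. if i \<in> I then u i else 0"]) (auto simp: coord_space_def fun_eq_iff)
    qed
    ultimately have "fun_space.dim (jac_kernel 1 F p) = card (multi_indices 1 :: ('s \<Rightarrow>\<^sub>0 nat) set)"
      using dim_projects_onto[OF _ subspace_coord_space finite_multi_indices] by metis
    also have "\<dots> = CARD('s)" by (simp add: card_multi_indices)
    finally show ?thesis using True card_ne pX by (simp add: singular_locus_def T[unfolded One_nat_def] dimX)
  qed
qed

section \<open>Zariski open sets\<close>

text \<open>A polynomial in the point \<open>x\<close>, read as a polynomial in the chart coordinates of a pair \<open>(x, W)\<close>.\<close>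

definition lift_poly :: "'s mpoly \<Rightarrow> ('s + 'i) mpoly" where
  "lift_poly P = psubst P (\<lambda>v. Xvar (Inl v))"

lemma peval_lift_poly [simp]: "peval (lift_poly P) (case_sum x y) = peval P x"
  by (simp add: lift_poly_def peval_psubst)

lemma openin_subtopology_zariski:
  "openin (subtopology (zariski A) V) N \<longleftrightarrow> (\<exists>U. zariski_open A U \<and> N = U \<inter> V)"
  by (simp add: openin_subtopology openin_zariski)

lemma zariski_open_domains: "zariski_open A (\<Union> (fst ` A))"
  unfolding zariski_open_def
proof (intro conjI ballI, simp)
  fix a assume a: "a \<in> A"
  obtain D c where ac: "a = (D, c)" by fastforce
  have "D \<subseteq> \<Union> (fst ` A)" using a ac by force
  then have "\<forall>p\<in>D. p \<in> \<Union> (fst ` A) \<longleftrightarrow> c p \<notin> zero_set {1}" by (auto simp: zero_set_def)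
  then show "case a of (D, c) \<Rightarrow> \<exists>S. \<forall>p\<in>D. p \<in> \<Union> (fst ` A) \<longleftrightarrow> c p \<notin> zero_set S" using ac by auto
qed

lemma topspace_zariski: "topspace (zariski A) = \<Union> (fst ` A)"
proof
  have "zariski_open A (topspace (zariski A))" by (simp only: openin_topspace openin_zariski[symmetric])
  then show "topspace (zariski A) \<subseteq> \<Union> (fst ` A)" by (simp add: zariski_open_def)
  show "\<Union> (fst ` A) \<subseteq> topspace (zariski A)"
    by (rule openin_subset) (simp only: openin_zariski zariski_open_domains)
qed

lemma zariski_open_affine: "zariski_open affine_atlas U \<longleftrightarrow> (\<exists>S. U = - zero_set S)"
  unfolding zariski_open_def affine_atlas_def by auto

lemma topspace_affine [simp]: "topspace (subtopology (zariski affine_atlas) X) = X"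
  by (simp add: topspace_zariski affine_atlas_def)

lemma openin_affine_basic: "openin (subtopology (zariski affine_atlas) X) {q \<in> X. peval h q \<noteq> 0}"
  unfolding openin_subtopology_zariski zariski_open_affine
  by (rule exI[of _ "- zero_set {h}"]) (auto simp: zero_set_def)

lemma openin_affine_contains_basic:
  assumes "openin (subtopology (zariski affine_atlas) X) N" "p \<in> N"
  obtains h where "peval h p \<noteq> 0" "\<And>q. q \<in> X \<Longrightarrow> peval h q \<noteq> 0 \<Longrightarrow> q \<in> N"
proof -
  obtain S where S: "N = - zero_set S \<inter> X"
    using assms(1) unfolding openin_subtopology_zariski zariski_open_affine by blast
  then obtain h where h: "h \<in> S" "peval h p \<noteq> 0" using assms(2) by (auto simp: zero_set_def)
  have "q \<in> N" if "q \<in> X" "peval h q \<noteq> 0" for q using that h(1) by (auto simp: S zero_set_def)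
  then show thesis using that h(2) by blast
qed

lemma regular_on_iff:
  "regular_on A V U f \<longleftrightarrow> (\<forall>p\<in>U. \<exists>a\<in>A. \<exists>N P Q. openin (subtopology (zariski A) V) N \<and> p \<in> N \<and> N \<subseteq> U \<inter> fst a \<and>
     (\<forall>q\<in>N. peval Q (snd a q) \<noteq> 0 \<and> f q = peval P (snd a q) / peval Q (snd a q)))"
  by (simp only: regular_on_def case_prod_unfold)

lemma regular_on_affine:
  "regular_on affine_atlas X U f \<longleftrightarrow> (\<forall>p\<in>U. \<exists>N P Q. openin (subtopology (zariski affine_atlas) X) N \<and> p \<in> N \<and> N \<subseteq> U \<and>
     (\<forall>q\<in>N. peval Q q \<noteq> 0 \<and> f q = peval P q / peval Q q))"
  by (simp add: regular_on_def affine_atlas_def)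

section \<open>Charts of the Grassmannian\<close>

lemma grass_chart_dom_iff: "W \<in> grass_chart_dom I k J \<longleftrightarrow> W \<in> grassmannian I k \<and> projects_onto J W"
  by (simp add: grass_chart_dom_def projects_onto_def)

lemma grass_coord_eq: "grass_coord J W (j, i) = chart_basis J W j i"
  by (simp add: grass_coord_def chart_basis_def)

lemma grass_coord_trivial:
  assumes W: "W \<in> grass_chart_dom I k J"
  shows "j \<notin> J \<Longrightarrow> grass_coord J W (j, i) = 0"
    and "i \<in> J \<Longrightarrow> grass_coord J W (j, i) = (if i = j then 1 else 0)"
    and "i \<notin> I \<Longrightarrow> grass_coord J W (j, i) = 0"
proof -
  have W': "W \<subseteq> coord_space I" "fun_space.subspace W" "projects_onto J W"
    using W by (auto simp: grass_chart_dom_iff grassmannian_def)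
  note cb = chart_basis[OF W'(3)]
  show "grass_coord J W (j, i) = 0" if "j \<notin> J"
  proof -
    have "chart_basis J W j = 0"
      by (rule projects_onto_eq[OF W'(3) cb(1) fun_space.subspace_0[OF W'(2)]]) (use cb(2) that in auto)
    then show ?thesis by (simp add: grass_coord_eq)
  qed
  show "i \<in> J \<Longrightarrow> grass_coord J W (j, i) = (if i = j then 1 else 0)" by (simp add: grass_coord_eq cb(2))
  show "grass_coord J W (j, i) = 0" if "i \<notin> I"
    using cb(1)[of j] W'(1) that unfolding grass_coord_eq coord_space_def by blast
qed

text \<open>In terms of the basis of \<open>W\<close> attached to \<open>J\<close>, the projection to the coordinates in \<open>K\<close> is a square
matrix.\<close>

lemma projects_onto_iff_det:
  assumes W: "projects_onto J W" "fun_space.subspace W" and fin: "finite J" "finite K" and card: "card K = card J"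
  shows "projects_onto K W \<longleftrightarrow> fdet (elems K) (elems J) (\<lambda>l j. chart_basis J W j l) \<noteq> 0" (is "_ \<longleftrightarrow> ?d \<noteq> 0")
proof -
  let ?b = "chart_basis J W"
  note eK = elems[OF fin(2)] and eJ = elems[OF fin(1)]
  have len: "length (elems K) = length (elems J)" using card by (simp add: length_elems fin)
  define comb where "comb x = (\<Sum>j\<in>J. fun_scale (x j) (?b j))" for x
  have combW: "comb x \<in> W" for x unfolding comb_def
    by (intro fun_space.subspace_sum[OF W(2)] fun_space.subspace_scale[OF W(2)] chart_basis(1)[OF W(1)])
  have comb_at: "comb x l = (\<Sum>j\<in>J. ?b j l * x j)" for x l by (simp add: comb_def fun_sum_apply mult.commute)
  have combJ: "comb x j = x j" if "j \<in> J" for x j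
  proof -
    have "comb x j = (\<Sum>i\<in>J. if i = j then x j else 0)"
      unfolding comb_at by (intro sum.cong refl) (auto simp: chart_basis(2)[OF W(1) that])
    then show ?thesis using that fin by simp
  qed
  show ?thesis
  proof
    assume P: "projects_onto K W"
    show "?d \<noteq> 0"
    proof
      assume z: "?d = 0"
      from fdet_zero_kernel[OF len conjunct2[OF eJ] z]
      obtain x where "(\<exists>j\<in>J. x j \<noteq> 0) \<and> (\<forall>l\<in>K. (\<Sum>j\<in>J. ?b j l * x j) = 0)"
        unfolding conjunct1[OF eJ] conjunct1[OF eK] by (elim exE)
      then have x: "\<exists>j\<in>J. x j \<noteq> 0" "\<And>l. l \<in> K \<Longrightarrow> comb x l = 0" by (simp_all add: comb_at)
      have "comb x = 0"
        by (rule projects_onto_eq[OF P combW fun_space.subspace_0[OF W(2)]]) (simp add: x(2))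
      then show False using x(1) combJ by (metis zero_fun_apply)
    qed
  next
    assume nz: "?d \<noteq> 0"
    from fdet_adjugate[OF len conjunct2[OF eK] conjunct2[OF eJ], of "\<lambda>l j. ?b j l"] obtain B where
      B: "\<forall>l\<in>K. \<forall>l'\<in>K. (\<Sum>j\<in>J. ?b j l * B j l') = (if l = l' then ?d else 0)"
      unfolding conjunct1[OF eJ] conjunct1[OF eK] by (elim exE conjE)
    show "projects_onto K W"
      unfolding projects_onto_def
    proof
      fix u
      define x where "x j = (\<Sum>l'\<in>K. B j l' * u l') / ?d" for j
      have at: "comb x l = u l" if l: "l \<in> K" for l
      proof -
        have "comb x l = (\<Sum>j\<in>J. \<Sum>l'\<in>K. ?b j l * (B j l' * u l')) / ?d"
          unfolding comb_at sum_divide_distrib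
          by (intro sum.cong refl) (simp add: x_def sum_distrib_left sum_divide_distrib)
        also have "(\<Sum>j\<in>J. \<Sum>l'\<in>K. ?b j l * (B j l' * u l')) = (\<Sum>l'\<in>K. (\<Sum>j\<in>J. ?b j l * B j l') * u l')"
          unfolding sum_distrib_right by (subst sum.swap) (simp add: mult.assoc)
        also have "\<dots> = (\<Sum>l'\<in>K. if l' = l then ?d * u l else 0)"
          by (intro sum.cong refl) (auto simp: B[rule_format, OF l])
        also have "\<dots> = ?d * u l" using l fin by simp
        finally show ?thesis using nz by simp
      qed
      show "\<exists>!w. w \<in> W \<and> (\<forall>j\<in>K. w j = u j)"
      proof (rule ex1I[of _ "comb x"])
        show "comb x \<in> W \<and> (\<forall>j\<in>K. comb x j = u j)" using combW at by simp
        fix w assume w: "w \<in> W \<and> (\<forall>j\<in>K. w j = u j)"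
        then have we: "w = comb w" unfolding comb_def using chart_basis_expand[OF W fin(1)] by blast
        have z: "(w - comb x) j = 0" if "j \<in> J" for j
        proof (rule fdet_nz_kernel[OF len conjunct2[OF eK] conjunct2[OF eJ] nz])
          show "j \<in> set (elems J)" using that eJ by simp
          fix l assume "l \<in> set (elems K)"
          then have l: "l \<in> K" using eK by simp
          have "(\<Sum>c\<in>J. ?b c l * (w - comb x) c) = (\<Sum>c\<in>J. ?b c l * w c) - (\<Sum>c\<in>J. ?b c l * x c)"
            by (simp add: combJ right_diff_distrib sum_subtractf)
          also have "\<dots> = w l - comb x l"
            unfolding comb_at[symmetric] using we by simp
          also have "\<dots> = 0" using w at l by simp
          finally show "(\<Sum>c\<in>set (elems J). ?b c l * (w - comb x) c) = 0" using eJ by simp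
        qed
        show "w = comb x" by (rule projects_onto_eq[OF W(1) _ combW]) (use w z in auto)
      qed
    qed
  qed
qed

text \<open>In the coordinates of another chart the domain is the set where a determinant of coordinates does
not vanish.\<close>

lemma zariski_open_chart:
  assumes I: "finite I" and J: "J \<subseteq> I" "card J = k"
  shows "zariski_open (affine_grass_atlas I k) (UNIV \<times> grass_chart_dom I k J)"
  unfolding zariski_open_def
proof (intro conjI ballI)
  show "UNIV \<times> grass_chart_dom I k J \<subseteq> \<Union> (fst ` affine_grass_atlas I k)"
    by (rule Union_upper) (use J in \<open>auto simp: affine_grass_atlas_def image_iff\<close>)
next
  fix a :: "(('b \<Rightarrow> complex) \<times> ('a \<Rightarrow> complex) set) set \<times>
      (('b \<Rightarrow> complex) \<times> ('a \<Rightarrow> complex) set \<Rightarrow> 'b + 'a \<times> 'a \<Rightarrow> complex)"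
  assume "a \<in> affine_grass_atlas I k"
  then obtain K where K: "a = (UNIV \<times> grass_chart_dom I k K, \<lambda>(x, W). case_sum x (grass_coord K W))"
    "K \<subseteq> I" "card K = k" unfolding affine_grass_atlas_def by blast
  have fin: "finite K" "finite J" using finite_subset I K(2) J(1) by auto
  let ?P = "fdet (elems J) (elems K) (\<lambda>l j. Xvar (Inr (j, l))) :: ('b + 'a \<times> 'a) mpoly"
  have "W \<in> grass_chart_dom I k J \<longleftrightarrow> case_sum x (grass_coord K W) \<notin> zero_set {?P}"
    if W: "W \<in> grass_chart_dom I k K" for x W
  proof -
    have "peval ?P (case_sum x (grass_coord K W)) = fdet (elems J) (elems K) (\<lambda>l j. chart_basis K W j l)"
      unfolding peval_fdet by (simp add: grass_coord_eq)
    moreover have "projects_onto K W" "fun_space.subspace W" "W \<in> grassmannian I k"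
      using W by (auto simp: grass_chart_dom_iff grassmannian_def)
    ultimately show ?thesis
      using projects_onto_iff_det[of K W J] fin J(2) K(3) by (simp add: grass_chart_dom_iff zero_set_def)
  qed
  then show "case a of (D, c) \<Rightarrow> \<exists>S. \<forall>p\<in>D. p \<in> UNIV \<times> grass_chart_dom I k J \<longleftrightarrow> c p \<notin> zero_set S"
    unfolding K(1) by auto
qed

lemma zariski_open_pullback:
  fixes S :: "'s mpoly set" and I :: "'i set"
  shows "zariski_open (affine_grass_atlas I k) {p \<in> \<Union> (fst ` affine_grass_atlas I k). fst p \<notin> zero_set S}"
  unfolding zariski_open_def
proof (intro conjI ballI)
  fix a :: "(('s \<Rightarrow> complex) \<times> ('i \<Rightarrow> complex) set) set \<times>
      (('s \<Rightarrow> complex) \<times> ('i \<Rightarrow> complex) set \<Rightarrow> 's + 'i \<times> 'i \<Rightarrow> complex)"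
  assume a: "a \<in> affine_grass_atlas I k"
  then obtain K where K: "a = (UNIV \<times> grass_chart_dom I k K, \<lambda>(x, W). case_sum x (grass_coord K W))"
    "K \<subseteq> I" "card K = k" unfolding affine_grass_atlas_def by blast
  have dom: "p \<in> \<Union> (fst ` affine_grass_atlas I k)" if "p \<in> fst a" for p :: "('s \<Rightarrow> complex) \<times> ('i \<Rightarrow> complex) set"
    using a that by blast
  have "\<forall>p\<in>fst a. p \<in> {p \<in> \<Union> (fst ` affine_grass_atlas I k). fst p \<notin> zero_set S} \<longleftrightarrow> snd a p \<notin> zero_set (lift_poly ` S)"
    using dom unfolding K(1) by (auto simp: zero_set_def)
  then show "case a of (D, c) \<Rightarrow> \<exists>S'. \<forall>p\<in>D. p \<in> {p \<in> \<Union> (fst ` affine_grass_atlas I k). fst p \<notin> zero_set S} \<longleftrightarrow> c p \<notin> zero_set S'"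
    by (auto simp: case_prod_beta)
qed auto

text \<open>In a chart, the inclusion in the kernel means that each of the basis vectors is annihilated by
each row: these are polynomial equations.\<close>

lemma zariski_open_not_kernel:
  fixes F :: "'s::finite mpoly"
  shows "zariski_open (affine_grass_atlas (multi_indices n) k)
    {p \<in> \<Union> (fst ` affine_grass_atlas (multi_indices n) k). \<not> snd p \<subseteq> jac_kernel n F (fst p)}"
    (is "zariski_open ?A {p \<in> ?dom. _}")
  unfolding zariski_open_def
proof (intro conjI ballI)
  let ?I = "multi_indices n :: ('s \<Rightarrow>\<^sub>0 nat) set"
  fix a assume a: "a \<in> ?A"
  then obtain K where K: "a = (UNIV \<times> grass_chart_dom ?I k K, \<lambda>(x, W). case_sum x (grass_coord K W))"
    "K \<subseteq> ?I" "card K = k" unfolding affine_grass_atlas_def by blast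
  have dom: "p \<in> ?dom" if "p \<in> fst a" for p using a that by blast
  define S where "S = (\<lambda>(j, \<beta>). \<Sum>\<alpha>\<in>?I. lift_poly (jac F \<beta> \<alpha>) * Xvar (Inr (j, \<alpha>))) ` (K \<times> row_indices n)"
  have "\<not> W \<subseteq> jac_kernel n F x \<longleftrightarrow> case_sum x (grass_coord K W) \<notin> zero_set S"
    if W: "W \<in> grass_chart_dom ?I k K" for x W
  proof -
    have W': "W \<subseteq> coord_space ?I" "fun_space.subspace W" "projects_onto K W"
      using W by (auto simp: grass_chart_dom_iff grassmannian_def)
    note cb = chart_basis[OF W'(3)]
    have fK: "finite K" using finite_subset[OF K(2)] by simp
    have "W \<subseteq> jac_kernel n F x \<longleftrightarrow> (\<forall>j\<in>K. chart_basis K W j \<in> jac_kernel n F x)"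
    proof
      assume b: "\<forall>j\<in>K. chart_basis K W j \<in> jac_kernel n F x"
      show "W \<subseteq> jac_kernel n F x"
      proof
        fix w assume w: "w \<in> W"
        show "w \<in> jac_kernel n F x"
          by (subst chart_basis_expand[OF W'(3,2) fK w])
             (intro fun_space.subspace_sum[OF subspace_jac_kernel] fun_space.subspace_scale[OF subspace_jac_kernel] b[rule_format])
      qed
    qed (use cb(1) in blast)
    also have "\<dots> \<longleftrightarrow> (\<forall>j\<in>K. \<forall>\<beta>\<in>row_indices n. (\<Sum>\<alpha>\<in>?I. peval (jac F \<beta> \<alpha>) x * chart_basis K W j \<alpha>) = 0)"
      using cb(1) W'(1) by (auto simp: jac_kernel_def row_indices_def)
    also have "\<dots> \<longleftrightarrow> case_sum x (grass_coord K W) \<in> zero_set S"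
      unfolding S_def zero_set_def by (auto simp: peval_sum peval_mult grass_coord_eq)
    finally show ?thesis by simp
  qed
  then have "\<forall>p\<in>fst a. p \<in> {p \<in> ?dom. \<not> snd p \<subseteq> jac_kernel n F (fst p)} \<longleftrightarrow> snd a p \<notin> zero_set S"
    using dom unfolding K(1) by auto
  then show "case a of (D, c) \<Rightarrow> \<exists>S'. \<forall>p\<in>D. p \<in> {p \<in> ?dom. \<not> snd p \<subseteq> jac_kernel n F (fst p)} \<longleftrightarrow> c p \<notin> zero_set S'"
    by (auto simp: case_prod_beta)
qed auto

text \<open>Functions that become polynomial after multiplication with a power of \<open>D\<close> form a ring.\<close>

lemma rational_substitution:
  fixes x :: "('s \<Rightarrow> complex) \<Rightarrow> 'v \<Rightarrow> complex" and D :: "'s mpoly"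
  assumes x: "\<And>v. \<exists>G. \<forall>q\<in>S. x q v * peval D q = peval G q"
  shows "\<exists>G k. \<forall>q\<in>S. peval P (x q) * peval D q ^ k = peval G q"
proof -
  define R where "R h \<longleftrightarrow> (\<exists>G k. \<forall>q\<in>S. h q * peval D q ^ k = peval G q)" for h
  have add: "R (\<lambda>q. h q + h' q)" if hh: "R h" "R h'" for h h'
  proof -
    obtain G k G' k' where G: "\<forall>q\<in>S. h q * peval D q ^ k = peval G q" "\<forall>q\<in>S. h' q * peval D q ^ k' = peval G' q" using hh unfolding R_def by blast
    have "\<forall>q\<in>S. (h q + h' q) * peval D q ^ (k + k') = peval (G * D ^ k' + G' * D ^ k) q"
    proof
      fix q assume q: "q \<in> S"
      have "(h q + h' q) * peval D q ^ (k + k') = (h q * peval D q ^ k) * peval D q ^ k' + (h' q * peval D q ^ k') * peval D q ^ k"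
        by (simp add: power_add algebra_simps)
      then show "(h q + h' q) * peval D q ^ (k + k') = peval (G * D ^ k' + G' * D ^ k) q" using G q by (simp add: peval_add peval_mult peval_power)
    qed
    then show ?thesis unfolding R_def by blast
  qed
  have mul: "R (\<lambda>q. h q * h' q)" if hh: "R h" "R h'" for h h'
  proof -
    obtain G k G' k' where G: "\<forall>q\<in>S. h q * peval D q ^ k = peval G q" "\<forall>q\<in>S. h' q * peval D q ^ k' = peval G' q" using hh unfolding R_def by blast
    have "\<forall>q\<in>S. (h q * h' q) * peval D q ^ (k + k') = peval (G * G') q"
    proof
      fix q assume q: "q \<in> S"
      have "(h q * h' q) * peval D q ^ (k + k') = (h q * peval D q ^ k) * (h' q * peval D q ^ k')" by (simp add: power_add ac_simps)
      then show "(h q * h' q) * peval D q ^ (k + k') = peval (G * G') q" using G q by (simp add: peval_mult)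
    qed
    then show ?thesis unfolding R_def by blast
  qed
  have const: "R (\<lambda>_. c)" for c
    unfolding R_def by (intro exI[of _ "pconst c"] exI[of _ 0]) simp
  have coord: "R (\<lambda>q. x q v)" for v
  proof -
    obtain G where "\<forall>q\<in>S. x q v * peval D q = peval G q" using x by blast
    then show ?thesis unfolding R_def by (intro exI[of _ G] exI[of _ 1]) simp
  qed
  have pow: "R (\<lambda>q. h q ^ k)" if "R h" for h k
    by (induction k) (use const[of 1] mul[OF that] in auto)
  have mev: "R (\<lambda>q. meval m (x q))" for m
  proof -
    have "R (\<lambda>q. \<Prod>v\<in>V. x q v ^ lookup m v)" if "finite V" for V
      using that by (induction V rule: finite_induct) (use const[of 1] mul pow coord in auto)
    then show ?thesis unfolding meval_def by simp
  qed
  have "R (\<lambda>q. \<Sum>m\<in>M. lookup P m * meval m (x q))" if "finite M" for M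
    using that by (induction M rule: finite_induct) (use const mul add mev in auto)
  then have "R (\<lambda>q. peval P (x q))" unfolding peval_def by simp
  then show ?thesis unfolding R_def .
qed

section \<open>The higher Nash blowup of a hypersurface\<close>

context
  fixes n :: nat and F :: "'s::finite mpoly" and X :: "('s \<Rightarrow> complex) set"
  assumes n: "n \<ge> 1" and F: "irreducible F" and X: "X = zero_set {F}"
begin

abbreviation (input) "jidx \<equiv> multi_indices n :: ('s \<Rightarrow>\<^sub>0 nat) set"
abbreviation (input) "tdim \<equiv> nash_rank n X"
abbreviation (input) "ambient \<equiv> nash_atlas n X"
abbreviation (input) "Nash \<equiv> nash_blowup n X"
abbreviation (input) "cdom J \<equiv> grass_chart_dom jidx tdim J"
abbreviation (input) "coords J \<equiv> \<lambda>(x, W). case_sum x (grass_coord J W)"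
abbreviation (input) "ker \<equiv> jac_kernel n F"

lemma in_X: "q \<in> X \<longleftrightarrow> peval F q = 0"
  by (simp add: X zero_set_def)

lemma vanishing: "h \<in> vanishing_ideal X \<longleftrightarrow> F dvd h"
  unfolding X vanishing_ideal_hypersurface[OF F] by simp

lemma rank_eq: "tdim = card (free_indices n v)" for v :: 's
  unfolding nash_rank_def X variety_dim_hypersurface[OF F] card_free_indices ..

lemma chart_card: "J \<subseteq> jidx \<Longrightarrow> card J = tdim \<Longrightarrow> card (jidx - J) = card (row_indices n :: ('s \<Rightarrow>\<^sub>0 nat) set)"
proof -
  assume J: "J \<subseteq> jidx" "card J = tdim"
  fix v :: 's
  have "card (jidx - J) = card jidx - card J" using J(1) by (intro card_Diff_subset finite_subset[OF J(1)]) auto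
  also have "\<dots> = card jidx - card (free_indices n v)" using J(2) rank_eq by simp
  also have "\<dots> = card (jidx - free_indices n v)"
    by (intro card_Diff_subset[symmetric] finite_subset[of "free_indices n v" jidx]) (auto simp: free_indices_def)
  finally show ?thesis by (simp add: card_row_indices)
qed

lemma atlas_iff: "a \<in> ambient \<longleftrightarrow> (\<exists>J. a = (UNIV \<times> cdom J, coords J) \<and> J \<subseteq> jidx \<and> card J = tdim)"
  unfolding nash_atlas_def affine_grass_atlas_def by auto

lemma tangent: "q \<in> X \<Longrightarrow> higher_tangent n X q = ker q"
  using higher_tangent_hypersurface[OF F] in_X X by blast

lemma kernel_chart: "J \<subseteq> jidx \<Longrightarrow> card J = tdim \<Longrightarrow> ker q \<in> cdom J \<longleftrightarrow> peval (jac_minor n F J) q \<noteq> 0"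
proof -
  assume J: "J \<subseteq> jidx" "card J = tdim"
  have fJ: "finite J" by (rule finite_subset[OF J(1)]) simp
  have iff: "projects_onto J (ker q) \<longleftrightarrow> peval (jac_minor n F J) q \<noteq> 0" by (rule jac_kernel_chart(1)[OF J(1) chart_card[OF J]])
  have "ker q \<in> grassmannian jidx tdim" if "projects_onto J (ker q)"
    using dim_projects_onto[OF that subspace_jac_kernel fJ] J(2) subspace_jac_kernel
    by (auto simp: grassmannian_def jac_kernel_def)
  then show ?thesis using iff by (auto simp: grass_chart_dom_iff)
qed

lemma smooth_chart: "q \<in> X \<Longrightarrow> q \<notin> singular_locus X \<Longrightarrow> \<exists>J. J \<subseteq> jidx \<and> card J = tdim \<and> ker q \<in> cdom J"
proof -
  assume q: "q \<in> X" "q \<notin> singular_locus X"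
  then obtain v where v: "peval (pd v F) q \<noteq> 0"
    using singular_locus_hypersurface[OF F, of q] in_X X by auto
  have J: "free_indices n v \<subseteq> jidx" "card (free_indices n v) = tdim" using rank_eq by (auto simp: free_indices_def)
  have "ker q \<in> cdom (free_indices n v)"
    unfolding kernel_chart[OF J] using q(1) v by (intro jac_minor_free_indices) (simp_all add: in_X)
  then show ?thesis using J by blast
qed

lemma gauss_graph_eq: "gauss_graph n X = (\<lambda>q. (q, ker q)) ` (X - singular_locus X)"
  unfolding gauss_graph_def by (intro image_cong refl) (simp add: tangent)

lemma gauss_graph_subset: "gauss_graph n X \<subseteq> Nash"
proof -
  have "gauss_graph n X \<subseteq> topspace (subtopology (zariski ambient) (X \<times> grassmannian jidx tdim))"
  proof
    fix p assume "p \<in> gauss_graph n X"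
    then obtain q where q: "p = (q, ker q)" "q \<in> X" "q \<notin> singular_locus X" unfolding gauss_graph_eq by blast
    obtain J where J: "J \<subseteq> jidx" "card J = tdim" "ker q \<in> cdom J" using smooth_chart q by blast
    have "(UNIV \<times> cdom J, coords J) \<in> ambient" using J unfolding atlas_iff by blast
    then have "p \<in> \<Union> (fst ` ambient)" using J(3) q(1) by force
    moreover have "p \<in> X \<times> grassmannian jidx tdim" using q J(3) by (auto simp: grass_chart_dom_iff)
    ultimately show "p \<in> topspace (subtopology (zariski ambient) (X \<times> grassmannian jidx tdim))"
      by (simp add: topspace_zariski)
  qed
  then show ?thesis unfolding nash_blowup_def by (rule closure_of_subset)
qed

text \<open>The pairs \<open>(q, W)\<close> with \<open>W \<subseteq> ker q\<close> form a closed set that contains the graph of the Gauss map.\<close>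

lemma nash_cases:
  assumes p: "(q, W) \<in> Nash"
  shows "q \<in> X" "W \<subseteq> ker q" "\<exists>J. J \<subseteq> jidx \<and> card J = tdim \<and> W \<in> cdom J"
proof -
  let ?T = "subtopology (zariski ambient) (X \<times> grassmannian jidx tdim)"
  have pt: "(q, W) \<in> topspace ?T"
    using p closure_of_subset_topspace[of ?T "gauss_graph n X"] unfolding nash_blowup_def by blast
  then show "q \<in> X" by simp
  have dom: "(q, W) \<in> \<Union> (fst ` ambient)" using pt by (simp add: topspace_zariski)
  then obtain a where "a \<in> ambient" "(q, W) \<in> fst a" by blast
  then show "\<exists>J. J \<subseteq> jidx \<and> card J = tdim \<and> W \<in> cdom J" unfolding atlas_iff by auto
  let ?O = "{p \<in> \<Union> (fst ` ambient). \<not> snd p \<subseteq> ker (fst p)}"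
  show "W \<subseteq> ker q"
  proof (rule ccontr)
    assume "\<not> W \<subseteq> ker q"
    then have mem: "(q, W) \<in> ?O \<inter> (X \<times> grassmannian jidx tdim)" using dom pt by simp
    have "zariski_open ambient ?O" unfolding nash_atlas_def by (rule zariski_open_not_kernel)
    then have op: "openin ?T (?O \<inter> (X \<times> grassmannian jidx tdim))" unfolding openin_subtopology_zariski by blast
    have cl: "\<forall>T. (q, W) \<in> T \<and> openin ?T T \<longrightarrow> (\<exists>y. y \<in> gauss_graph n X \<and> y \<in> T)"
      using p unfolding nash_blowup_def in_closure_of by (rule conjunct2)
    have "\<exists>y. y \<in> gauss_graph n X \<and> y \<in> ?O \<inter> (X \<times> grassmannian jidx tdim)"
      by (rule cl[rule_format, OF conjI[OF mem op]])
    then show False unfolding gauss_graph_eq by auto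
  qed
qed

lemma topspace_nash: "topspace (subtopology (zariski ambient) Nash) = Nash"
proof -
  have "Nash \<subseteq> \<Union> (fst ` ambient)"
  proof
    fix p assume p: "p \<in> Nash"
    obtain q W where qW: "p = (q, W)" by fastforce
    obtain J where J: "J \<subseteq> jidx" "card J = tdim" "W \<in> cdom J" using nash_cases(3) p qW by blast
    have "(UNIV \<times> cdom J, coords J) \<in> ambient" using J unfolding atlas_iff by blast
    then show "p \<in> \<Union> (fst ` ambient)" using J(3) qW by force
  qed
  then show ?thesis by (auto simp: topspace_zariski)
qed

text \<open>Over a non-singular point both spaces have the dimension of the Grassmannian.\<close>

lemma nash_nonsingular: "(q, W) \<in> Nash \<Longrightarrow> q \<notin> singular_locus X \<Longrightarrow> W = ker q"
proof -
  assume p: "(q, W) \<in> Nash" and ns: "q \<notin> singular_locus X"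
  note c = nash_cases[OF p]
  obtain J where J: "J \<subseteq> jidx" "card J = tdim" "W \<in> cdom J" using c(3) by blast
  obtain K where K: "K \<subseteq> jidx" "card K = tdim" "ker q \<in> cdom K" using smooth_chart[OF c(1) ns] by blast
  have fin: "finite J" "finite K" using finite_subset[OF J(1)] finite_subset[OF K(1)] by simp_all
  show ?thesis
    by (rule projects_onto_subset_eq[of J W K "ker q"])
       (use J K fin c(2) in \<open>auto simp: grass_chart_dom_iff grassmannian_def\<close>)
qed

lemma openin_chart: "J \<subseteq> jidx \<Longrightarrow> card J = tdim \<Longrightarrow> openin (subtopology (zariski ambient) Nash) ((UNIV \<times> cdom J) \<inter> Nash)"
  unfolding openin_subtopology_zariski nash_atlas_def
  using zariski_open_chart[OF finite_multi_indices] by blast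

lemma continuous_projection:
  "continuous_map (subtopology (zariski ambient) Nash) (subtopology (zariski affine_atlas) X) nash_projection"
  unfolding continuous_map_def topspace_nash topspace_affine
proof (intro conjI allI impI)
  show "nash_projection \<in> Nash \<rightarrow> X" using nash_cases(1) by (auto simp: nash_projection_def)
  fix U assume "openin (subtopology (zariski affine_atlas) X) U"
  then obtain S where S: "U = - zero_set S \<inter> X" unfolding openin_subtopology_zariski zariski_open_affine by blast
  let ?O = "{p \<in> \<Union> (fst ` ambient). fst p \<notin> zero_set S}"
  have "{p \<in> Nash. nash_projection p \<in> U} = ?O \<inter> Nash"
    using nash_cases(1) topspace_nash unfolding S by (auto simp: nash_projection_def topspace_zariski)
  moreover have "zariski_open ambient ?O" unfolding nash_atlas_def by (rule zariski_open_pullback)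
  ultimately show "openin (subtopology (zariski ambient) Nash) {p \<in> Nash. nash_projection p \<in> U}"
    unfolding openin_subtopology_zariski by blast
qed

lemma projection_morphism: "is_morphism ambient Nash affine_atlas X nash_projection"
  unfolding is_morphism_def
proof (intro conjI allI impI, rule continuous_projection)
  fix U f assume U: "openin (subtopology (zariski affine_atlas) X) U \<and> regular_on affine_atlas X U f"
  show "regular_on ambient Nash (Nash \<inter> nash_projection -` U) (f \<circ> nash_projection)"
    unfolding regular_on_iff
  proof
    fix p assume p: "p \<in> Nash \<inter> nash_projection -` U"
    obtain q W where qW: "p = (q, W)" by fastforce
    have qU: "q \<in> U" using p qW by (simp add: nash_projection_def)
    obtain J where J: "J \<subseteq> jidx" "card J = tdim" "W \<in> cdom J" using nash_cases(3) p qW by blast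
    from bspec[OF conjunct2[OF U, unfolded regular_on_affine] qU]
    obtain N P Q where N: "openin (subtopology (zariski affine_atlas) X) N" "q \<in> N" "N \<subseteq> U"
      "\<forall>x\<in>N. peval Q x \<noteq> 0 \<and> f x = peval P x / peval Q x"
      by (elim exE conjE)
    let ?N = "{p \<in> Nash. nash_projection p \<in> N} \<inter> ((UNIV \<times> cdom J) \<inter> Nash)"
    have "openin (subtopology (zariski ambient) Nash) {p \<in> Nash. nash_projection p \<in> N}"
      using continuous_projection N(1) unfolding continuous_map_def topspace_nash by blast
    then have o: "openin (subtopology (zariski ambient) Nash) ?N" by (intro openin_Int openin_chart J)
    have "p \<in> ?N" using p qW N(2) J(3) by (simp add: nash_projection_def)
    moreover have "?N \<subseteq> Nash \<inter> nash_projection -` U \<inter> (UNIV \<times> cdom J)" using N(3) by auto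
    moreover have "\<forall>z\<in>?N. peval (lift_poly Q) (coords J z) \<noteq> 0 \<and>
        (f \<circ> nash_projection) z = peval (lift_poly P) (coords J z) / peval (lift_poly Q) (coords J z)"
      using N(4) by (auto simp: nash_projection_def)
    moreover have "(UNIV \<times> cdom J, coords J) \<in> ambient" using J unfolding atlas_iff by blast
    ultimately show "\<exists>a\<in>ambient. \<exists>N P Q. openin (subtopology (zariski ambient) Nash) N \<and> p \<in> N \<and>
        N \<subseteq> Nash \<inter> nash_projection -` U \<inter> fst a \<and>
        (\<forall>z\<in>N. peval Q (snd a z) \<noteq> 0 \<and> (f \<circ> nash_projection) z = peval P (snd a z) / peval Q (snd a z))"
      using o by - (rule bexI[of _ "(UNIV \<times> cdom J, coords J)"], rule exI[of _ ?N], rule exI[of _ "lift_poly P"],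
          rule exI[of _ "lift_poly Q"], simp_all only: fst_conv snd_conv simp_thms)
  qed
qed

text \<open>Substitute the coordinates given by Cramer's rule.\<close>

lemma kernel_coords_rational:
  assumes J: "J \<subseteq> jidx" "card J = tdim"
  shows "\<exists>G k. \<forall>q. peval (jac_minor n F J) q \<noteq> 0 \<longrightarrow>
     peval P (coords J (q, ker q)) * peval (jac_minor n F J) q ^ k = peval G q"
proof -
  let ?d = "jac_minor n F J"
  from jac_kernel_chart(2)[OF J(1) chart_card[OF J]] obtain N where
    N: "\<And>q j i. peval ?d q \<noteq> 0 \<Longrightarrow> j \<in> J \<Longrightarrow> i \<in> jidx - J \<Longrightarrow> peval ?d q * chart_basis J (ker q) j i = peval (N j i) q"
    by blast
  have "\<exists>G k. \<forall>q\<in>{q. peval ?d q \<noteq> 0}. peval P (coords J (q, ker q)) * peval ?d q ^ k = peval G q"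
  proof (rule rational_substitution)
    fix v :: "'s + ('s \<Rightarrow>\<^sub>0 nat) \<times> ('s \<Rightarrow>\<^sub>0 nat)"
    show "\<exists>G. \<forall>q\<in>{q. peval ?d q \<noteq> 0}. coords J (q, ker q) v * peval ?d q = peval G q"
    proof (cases v)
      case (Inl u)
      then show ?thesis by (intro exI[of _ "Xvar u * ?d"]) (simp add: peval_mult)
    next
      case (Inr ji)
      obtain j i where ji: "ji = (j, i)" by fastforce
      let ?G = "if j \<notin> J \<or> i \<notin> jidx then 0 else if i \<in> J then (if i = j then ?d else 0) else N j i"
      have "coords J (q, ker q) v * peval ?d q = peval ?G q" if q: "peval ?d q \<noteq> 0" for q
      proof -
        have "ker q \<in> cdom J" using q kernel_chart[OF J] by simp
        note t = grass_coord_trivial[OF this]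
        have c: "coords J (q, ker q) v = grass_coord J (ker q) (j, i)" by (simp add: Inr ji)
        show ?thesis unfolding c using t(1)[of j i] t(2)[of i j] t(3)[of i j] N[OF q, of j i]
          by (auto simp: grass_coord_eq mult.commute)
      qed
      then show ?thesis by blast
    qed
  qed
  then show ?thesis by blast
qed

section \<open>Non-singular hypersurfaces\<close>

text \<open>Both continuity and regularity are checked near a point in one chart containing its image; there,
any polynomial in the chart coordinates becomes a polynomial on \<open>X\<close> divided by a power of the minor
of that chart.\<close>

lemma section_morphism:
  assumes ns: "singular_locus X = {}"
  shows "is_morphism affine_atlas X ambient Nash (\<lambda>q. (q, ker q))" (is "is_morphism _ _ _ _ ?\<psi>")
proof -
  have in_Nash: "?\<psi> q \<in> Nash" if "q \<in> X" for q
    using gauss_graph_subset that ns unfolding gauss_graph_eq by blast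
  have cont: "continuous_map (subtopology (zariski affine_atlas) X) (subtopology (zariski ambient) Nash) ?\<psi>"
    unfolding continuous_map_def topspace_nash topspace_affine
  proof (intro conjI allI impI)
    show "?\<psi> \<in> X \<rightarrow> Nash" using in_Nash by blast
    fix U assume "openin (subtopology (zariski ambient) Nash) U"
    then obtain U' where U': "zariski_open ambient U'" "U = U' \<inter> Nash" unfolding openin_subtopology_zariski by blast
    show "openin (subtopology (zariski affine_atlas) X) {q \<in> X. ?\<psi> q \<in> U}"
    proof (subst openin_subopen, intro ballI)
      fix q0 assume q0: "q0 \<in> {q \<in> X. ?\<psi> q \<in> U}"
      obtain J where J: "J \<subseteq> jidx" "card J = tdim" "ker q0 \<in> cdom J" using smooth_chart ns q0 by blast
      let ?d = "jac_minor n F J"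
      have "(UNIV \<times> cdom J, coords J) \<in> ambient" using J unfolding atlas_iff by blast
      with U'(1) have "\<exists>S. \<forall>p\<in>UNIV \<times> cdom J. p \<in> U' \<longleftrightarrow> coords J p \<notin> zero_set S"
        unfolding zariski_open_def by blast
      then obtain S where S: "\<And>p. p \<in> UNIV \<times> cdom J \<Longrightarrow> p \<in> U' \<longleftrightarrow> coords J p \<notin> zero_set S" by blast
      have "?\<psi> q0 \<in> U'" using q0 U'(2) by blast
      then have "coords J (?\<psi> q0) \<notin> zero_set S" using S[of "?\<psi> q0"] J(3) by blast
      then obtain g where g: "g \<in> S" "peval g (coords J (?\<psi> q0)) \<noteq> 0" unfolding zero_set_def by blast
      obtain G k where G: "\<And>q. peval ?d q \<noteq> 0 \<Longrightarrow> peval g (coords J (?\<psi> q)) * peval ?d q ^ k = peval G q"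
        using kernel_coords_rational[OF J(1,2), of g] by blast
      let ?N = "{q \<in> X. peval (G * ?d) q \<noteq> 0}"
      have d0: "peval ?d q0 \<noteq> 0" using J kernel_chart by blast
      have "q0 \<in> ?N" using q0 g(2) d0 G[OF d0] by (auto simp: peval_mult simp flip: G[OF d0])
      moreover have "?N \<subseteq> {q \<in> X. ?\<psi> q \<in> U}"
      proof
        fix q assume q: "q \<in> ?N"
        then have d: "peval ?d q \<noteq> 0" "peval G q \<noteq> 0" by (auto simp: peval_mult)
        then have "peval g (coords J (?\<psi> q)) \<noteq> 0" using G[OF d(1)] by auto
        then have "coords J (?\<psi> q) \<notin> zero_set S" using g(1) unfolding zero_set_def by blast
        moreover have "?\<psi> q \<in> UNIV \<times> cdom J" using d(1) kernel_chart[OF J(1,2)] by blast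
        ultimately have "?\<psi> q \<in> U'" using S by blast
        then show "q \<in> {q \<in> X. ?\<psi> q \<in> U}" using q in_Nash U'(2) by blast
      qed
      ultimately show "\<exists>T. openin (subtopology (zariski affine_atlas) X) T \<and> q0 \<in> T \<and> T \<subseteq> {q \<in> X. ?\<psi> q \<in> U}"
        using openin_affine_basic by blast
    qed
  qed
  show ?thesis
    unfolding is_morphism_def
  proof (intro conjI allI impI, rule cont)
    fix U f assume U: "openin (subtopology (zariski ambient) Nash) U \<and> regular_on ambient Nash U f"
    show "regular_on affine_atlas X (X \<inter> ?\<psi> -` U) (f \<circ> ?\<psi>)"
      unfolding regular_on_affine
    proof
      fix q0 assume q0: "q0 \<in> X \<inter> ?\<psi> -` U"
      then have "?\<psi> q0 \<in> U" by blast
      from bspec[OF conjunct2[OF U, unfolded regular_on_iff] this]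
      obtain a N P Q where aN: "a \<in> ambient" "openin (subtopology (zariski ambient) Nash) N" "?\<psi> q0 \<in> N" "N \<subseteq> U \<inter> fst a"
        "\<forall>z\<in>N. peval Q (snd a z) \<noteq> 0 \<and> f z = peval P (snd a z) / peval Q (snd a z)"
        by (elim bexE exE conjE)
      obtain J where J: "a = (UNIV \<times> cdom J, coords J)" "J \<subseteq> jidx" "card J = tdim" using aN(1) unfolding atlas_iff by blast
      let ?d = "jac_minor n F J"
      obtain GP k where GP: "\<And>q. peval ?d q \<noteq> 0 \<Longrightarrow> peval P (coords J (?\<psi> q)) * peval ?d q ^ k = peval GP q"
        using kernel_coords_rational[OF J(2,3), of P] by blast
      obtain GQ l where GQ: "\<And>q. peval ?d q \<noteq> 0 \<Longrightarrow> peval Q (coords J (?\<psi> q)) * peval ?d q ^ l = peval GQ q"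
        using kernel_coords_rational[OF J(2,3), of Q] by blast
      let ?M = "{q \<in> X. ?\<psi> q \<in> N}"
      have M: "openin (subtopology (zariski affine_atlas) X) ?M"
        using cont aN(2) unfolding continuous_map_def topspace_affine by blast
      have val: "peval (GQ * ?d ^ k) q \<noteq> 0 \<and> (f \<circ> ?\<psi>) q = peval (GP * ?d ^ l) q / peval (GQ * ?d ^ k) q"
        if q: "q \<in> ?M" for q
      proof -
        have "ker q \<in> cdom J" using q aN(4) J(1) by auto
        then have d: "peval ?d q \<noteq> 0" using kernel_chart[OF J(2,3)] by blast
        have "?\<psi> q \<in> N" using q by blast
        from bspec[OF aN(5) this] have z: "peval Q (coords J (?\<psi> q)) \<noteq> 0"
            "f (?\<psi> q) = peval P (coords J (?\<psi> q)) / peval Q (coords J (?\<psi> q))" using J(1) by auto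
        have "peval GQ q * peval ?d q ^ k \<noteq> 0" using z(1) d by (simp flip: GQ[OF d])
        moreover have "f (?\<psi> q) = (peval GP q * peval ?d q ^ l) / (peval GQ q * peval ?d q ^ k)"
          using z d by (simp add: field_simps flip: GQ[OF d] GP[OF d])
        ultimately show ?thesis by (simp add: peval_mult peval_power)
      qed
      have "openin (subtopology (zariski affine_atlas) X) ?M \<and> q0 \<in> ?M \<and> ?M \<subseteq> X \<inter> ?\<psi> -` U \<and>
        (\<forall>q\<in>?M. peval (GQ * ?d ^ k) q \<noteq> 0 \<and> (f \<circ> ?\<psi>) q = peval (GP * ?d ^ l) q / peval (GQ * ?d ^ k) q)"
        using M q0 aN(3,4) val by blast
      then show "\<exists>N P Q. openin (subtopology (zariski affine_atlas) X) N \<and> q0 \<in> N \<and>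
          N \<subseteq> X \<inter> ?\<psi> -` U \<and> (\<forall>q\<in>N. peval Q q \<noteq> 0 \<and> (f \<circ> ?\<psi>) q = peval P q / peval Q q)"
        by - (rule exI[of _ ?M], rule exI[of _ "GP * ?d ^ l"], rule exI[of _ "GQ * ?d ^ k"])
    qed
  qed
qed

lemma nonsingular_imp_isomorphism:
  assumes ns: "singular_locus X = {}"
  shows "is_isomorphism ambient Nash affine_atlas X nash_projection"
  unfolding is_isomorphism_def
proof (intro conjI exI[of _ "\<lambda>q. (q, ker q)"] ballI)
  fix p assume p: "p \<in> Nash"
  obtain q W where qW: "p = (q, W)" by fastforce
  have "W = ker q" using nash_nonsingular p ns qW by blast
  then show "(nash_projection p, ker (nash_projection p)) = p" by (simp add: qW nash_projection_def)
next
  show "nash_projection (q, ker q) = q" for q by (simp add: nash_projection_def)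
qed (rule projection_morphism section_morphism[OF ns])+

section \<open>Singular points obstruct the isomorphism\<close>

text \<open>A row with \<open>|\<beta>| = n - 1\<close> has only values of \<open>F\<close> and of its first derivatives as entries, so at a
singular point it is zero.\<close>

lemma jac_minor_singular:
  assumes p: "p \<in> X" "\<And>v. peval (pd v F) p = 0" and J: "J \<subseteq> jidx" "card J = tdim"
  shows "peval (jac_minor n F J) p = 0"
proof -
  let ?R = "row_indices n :: ('s \<Rightarrow>\<^sub>0 nat) set" and ?C = "jidx - J"
  fix v :: 's
  define r where "r = (single v (n - 1) :: 's \<Rightarrow>\<^sub>0 nat)"
  have mr: "mdeg r = n - 1" by (simp add: r_def mdeg_def lookup_single when_def)
  have rR: "r \<in> ?R" using n by (simp add: row_indices_def mr)
  have z: "peval (jac F r \<alpha>) p = 0" if a: "\<alpha> \<in> jidx" for \<alpha>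
  proof (cases "r \<in> below \<alpha>")
    case True
    have "mdeg \<alpha> \<le> n" using a by (simp add: multi_indices_def)
    then have "mdeg (\<alpha> - r) = 0 \<or> mdeg (\<alpha> - r) = 1" using mdeg_below[OF True] mr n by linarith
    then show ?thesis
    proof
      assume "mdeg (\<alpha> - r) = 0"
      then have "\<alpha> - r = 0" by (simp add: mdeg_eq_0)
      then show ?thesis using p(1) by (simp add: peval_jac taylor_0 in_X)
    next
      assume "mdeg (\<alpha> - r) = 1"
      then obtain u where "\<alpha> - r = evec u" using mdeg_1 by blast
      then show ?thesis using p(2)[of u] by (simp add: peval_jac peval_hasse)
    qed
  qed (simp add: peval_jac)
  have fC: "finite ?C" by simp
  note eC = elems[OF fC] and eR = elems[OF finite_row_indices[of n, where 'a='s]]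
  have len: "length (elems ?R) = length (elems ?C)" by (simp add: length_elems chart_card[OF J])
  from fdet_adjugate[OF len conjunct2[OF eR] conjunct2[OF eC], of "\<lambda>r c. peval (jac F r c) p"] obtain B where
    B: "\<forall>r\<in>?R. \<forall>r'\<in>?R. (\<Sum>c\<in>?C. peval (jac F r c) p * B c r') = (if r = r' then peval (jac_minor n F J) p else 0)"
    unfolding conjunct1[OF eC] conjunct1[OF eR] jac_minor_def peval_fdet by (elim exE conjE)
  have "(\<Sum>c\<in>?C. peval (jac F r c) p * B c r) = 0" using z by (intro sum.neutral) simp
  then show ?thesis using B[rule_format, OF rR rR] by simp
qed

text \<open>The inverse of the projection sends \<open>q\<close> to \<open>(q, W q)\<close>. Near \<open>p0\<close> the coordinates of \<open>W q\<close> in a chart \<open>J\<close> are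
quotients of polynomials. As \<open>W q\<close> is annihilated by \<open>jac\<close>, each column in \<open>J\<close> is a combination of the
columns outside \<open>J\<close>, the coefficients being these coordinates up to sign. So the triangular minor, a
power of \<open>pd v F\<close>, is up to sign \<open>jac_minor n F J\<close> times the determinant of the coefficients. The
polynomial \<open>h\<close> collects the denominators and the condition of being near \<open>p0\<close>.\<close>

lemma isomorphism_imp_divisibility:
  assumes iso: "is_isomorphism ambient Nash affine_atlas X nash_projection" and p0: "p0 \<in> X"
  shows "\<exists>J h. J \<subseteq> jidx \<and> card J = tdim \<and> peval h p0 \<noteq> 0 \<and>
     (\<forall>v. \<exists>G. F dvd h * pd v F ^ card (row_indices n :: ('s \<Rightarrow>\<^sub>0 nat) set) - G * jac_minor n F J)"
proof -
  let ?R = "row_indices n :: ('s \<Rightarrow>\<^sub>0 nat) set"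
  from iso obtain \<psi> where mor: "is_morphism affine_atlas X ambient Nash \<psi>"
    and sec: "\<And>q. q \<in> X \<Longrightarrow> nash_projection (\<psi> q) = q" unfolding is_isomorphism_def by blast
  define W where "W q = snd (\<psi> q)" for q
  have \<psi>: "\<psi> q = (q, W q)" if "q \<in> X" for q
    using sec[OF that] by (simp add: W_def nash_projection_def prod_eq_iff)
  have cont: "continuous_map (subtopology (zariski affine_atlas) X) (subtopology (zariski ambient) Nash) \<psi>"
    using mor unfolding is_morphism_def by blast
  have in_Nash: "(q, W q) \<in> Nash" if "q \<in> X" for q
    using cont that \<psi> unfolding continuous_map_def topspace_nash topspace_affine by (metis Pi_mem)
  obtain J where J: "J \<subseteq> jidx" "card J = tdim" "W p0 \<in> cdom J" using nash_cases(3)[OF in_Nash[OF p0]] by blast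
  let ?C = "jidx - J" and ?U = "(UNIV \<times> cdom J) \<inter> Nash"
  have fJ: "finite J" by (rule finite_subset[OF J(1)]) simp
  have Uo: "openin (subtopology (zariski ambient) Nash) ?U" by (rule openin_chart[OF J(1,2)])
  have UA: "(UNIV \<times> cdom J, coords J) \<in> ambient" using J unfolding atlas_iff by blast
  have "openin (subtopology (zariski affine_atlas) X) {q \<in> X. \<psi> q \<in> ?U}"
    using cont Uo unfolding continuous_map_def topspace_affine by blast
  moreover have "p0 \<in> {q \<in> X. \<psi> q \<in> ?U}" using p0 J(3) in_Nash by (simp add: \<psi>)
  ultimately obtain h0 where h0: "peval h0 p0 \<noteq> 0" "\<And>q. q \<in> X \<Longrightarrow> peval h0 q \<noteq> 0 \<Longrightarrow> \<psi> q \<in> ?U"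
    using openin_affine_contains_basic by (metis (no_types, lifting) mem_Collect_eq)
  have "\<exists>h P Q. peval h p0 \<noteq> 0 \<and> (\<forall>q\<in>X. peval h q \<noteq> 0 \<longrightarrow>
      peval Q q \<noteq> 0 \<and> chart_basis J (W q) j i = peval P q / peval Q q)" for j i
  proof -
    let ?\<kappa> = "\<lambda>p. grass_coord J (snd p) (j, i)"
    have "regular_on ambient Nash ?U ?\<kappa>"
      unfolding regular_on_iff
    proof
      fix p assume p: "p \<in> ?U"
      have "openin (subtopology (zariski ambient) Nash) ?U \<and> p \<in> ?U \<and> ?U \<subseteq> ?U \<inter> (UNIV \<times> cdom J) \<and>
         (\<forall>z\<in>?U. peval 1 (coords J z) \<noteq> 0 \<and> ?\<kappa> z = peval (Xvar (Inr (j, i))) (coords J z) / peval 1 (coords J z))"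
        using Uo p by auto
      then show "\<exists>a\<in>ambient. \<exists>N P Q. openin (subtopology (zariski ambient) Nash) N \<and> p \<in> N \<and> N \<subseteq> ?U \<inter> fst a \<and>
          (\<forall>z\<in>N. peval Q (snd a z) \<noteq> 0 \<and> ?\<kappa> z = peval P (snd a z) / peval Q (snd a z))"
        by - (rule bexI[OF _ UA], rule exI[of _ ?U], rule exI[of _ "Xvar (Inr (j, i))"], rule exI[of _ 1],
             unfold fst_conv snd_conv, assumption)
    qed
    then have reg: "regular_on affine_atlas X (X \<inter> \<psi> -` ?U) (?\<kappa> \<circ> \<psi>)"
      using mor Uo unfolding is_morphism_def by blast
    have p0U: "p0 \<in> X \<inter> \<psi> -` ?U" using p0 J(3) in_Nash by (simp add: \<psi>)
    from bspec[OF reg[unfolded regular_on_affine] p0U] obtain N P Q where N: "openin (subtopology (zariski affine_atlas) X) N" "p0 \<in> N"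
      "\<forall>q\<in>N. peval Q q \<noteq> 0 \<and> (?\<kappa> \<circ> \<psi>) q = peval P q / peval Q q"
      by (elim exE conjE)
    obtain h where "peval h p0 \<noteq> 0" "\<And>q. q \<in> X \<Longrightarrow> peval h q \<noteq> 0 \<Longrightarrow> q \<in> N"
      using openin_affine_contains_basic[OF N(1,2)] by blast
    then have "peval h p0 \<noteq> 0 \<and> (\<forall>q\<in>X. peval h q \<noteq> 0 \<longrightarrow>
      peval Q q \<noteq> 0 \<and> chart_basis J (W q) j i = peval P q / peval Q q)"
      using N(3) by (simp add: W_def grass_coord_eq)
    then show ?thesis by blast
  qed
  then obtain hh PP QQ where hPQ: "\<And>j i. peval (hh j i) p0 \<noteq> 0"
    "\<And>j i q. q \<in> X \<Longrightarrow> peval (hh j i) q \<noteq> 0 \<Longrightarrow> peval (QQ j i) q \<noteq> 0 \<and> chart_basis J (W q) j i = peval (PP j i) q / peval (QQ j i) q"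
    by metis
  \<comment> \<open>Where \<open>H\<close> does not vanish, \<open>W q\<close> lies in the chart \<open>J\<close> and all of its coordinates are given by the quotients; \<open>Q\<close> is a common denominator.\<close>
  define H where "H = h0 * (\<Prod>(j, i)\<in>J \<times> jidx. hh j i)"
  define Q where "Q = (\<Prod>(j, i)\<in>J \<times> jidx. QQ j i)"
  have H0: "peval H p0 \<noteq> 0" using h0(1) hPQ(1) fJ by (simp add: H_def peval_mult peval_prod case_prod_beta)
  have good: "peval (QQ j i) q \<noteq> 0" "chart_basis J (W q) j i = peval (PP j i) q / peval (QQ j i) q"
    if "q \<in> X" "peval H q \<noteq> 0" "j \<in> J" "i \<in> jidx" for q j i
  proof -
    have "peval (hh j i) q \<noteq> 0" using that fJ by (auto simp: H_def peval_mult peval_prod case_prod_beta)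
    from hPQ(2)[OF that(1) this] show "peval (QQ j i) q \<noteq> 0" "chart_basis J (W q) j i = peval (PP j i) q / peval (QQ j i) q" by auto
  qed
  have Q0: "peval Q p0 \<noteq> 0"
    using good(1)[OF p0 H0] fJ by (auto simp: Q_def peval_prod case_prod_beta)
  let ?r = "card ?R"
  have fC: "finite ?C" by simp
  note eC = elems[OF fC] and eR = elems[OF finite_row_indices[of n, where 'a='s]]
  have len: "length (elems ?R) = ?r" "length (elems ?C) = ?r" by (simp_all add: length_elems chart_card[OF J(1,2)])
  have "\<exists>G. F dvd (H * Q ^ ?r) * pd v F ^ ?r - G * jac_minor n F J" for v
  proof -
    from ex_sorted_rows[of n v] obtain rs where rs: "set rs = ?R" "distinct rs"
      "\<forall>F q. peval F q = 0 \<longrightarrow> fdet rs (map (\<lambda>\<beta>. \<beta> + evec v) rs) (\<lambda>r c. peval (jac F r c) q) = peval (pd v F) q ^ ?r"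
      by (elim exE conjE)
    let ?cs = "map (\<lambda>\<beta>. \<beta> + evec v) rs"
    have lrs: "length rs = ?r" using rs(1,2) by (metis distinct_card)
    have cs: "set ?cs \<subseteq> jidx" using rs(1) shift_row_indices[of n v] by auto
    \<comment> \<open>Column \<open>\<alpha>\<close> of \<open>jac\<close> as a combination of the columns \<open>i\<close> outside \<open>J\<close>; \<open>LP\<close> is the same with denominators cleared.\<close>
    define L where "L q i \<alpha> = (if \<alpha> \<in> J then - chart_basis J (W q) \<alpha> i else if i = \<alpha> then 1 else 0)" for q i \<alpha>
    define LP where "LP i \<alpha> = (if \<alpha> \<in> J then - (PP \<alpha> i * (\<Prod>(j, k)\<in>J \<times> jidx - {(\<alpha>, i)}. QQ j k)) else if i = \<alpha> then Q else 0)" for i \<alpha>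
    \<comment> \<open>The rows \<open>rs\<close> are ordered to suit \<open>v\<close>, those of \<open>jac_minor\<close> are not; \<open>c\<close> is the determinant of the permutation matrix between them.\<close>
    define c where "c = (fdet rs (elems ?R) (\<lambda>r m. if r = m then 1 else 0) :: complex)"
    define G where "G = H * (pconst c * fdet (elems ?C) ?cs LP)"
    have "peval ((H * Q ^ ?r) * pd v F ^ ?r - G * jac_minor n F J) q = 0" if q: "q \<in> X" for q
    proof (cases "peval H q = 0")
      case False
      let ?jac = "\<lambda>r c. peval (jac F r c) q"
      have "peval h0 q \<noteq> 0" using False by (simp add: H_def peval_mult)
      then have Wd: "W q \<in> cdom J" using h0(2)[OF q] by (simp add: \<psi>[OF q])
      then have P: "projects_onto J (W q)" by (simp add: grass_chart_dom_iff)
      have sub: "W q \<subseteq> ker q" by (rule nash_cases(2)[OF in_Nash[OF q]])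
      have fac: "?jac r \<alpha> = (\<Sum>m\<in>set (elems ?C). ?jac r m * L q m \<alpha>)" if r: "r \<in> ?R" and a: "\<alpha> \<in> jidx" for r \<alpha>
      proof (cases "\<alpha> \<in> J")
        case True
        let ?w = "chart_basis J (W q) \<alpha>"
        have "?w \<in> ker q" using chart_basis(1)[OF P] sub by blast
        then have "(\<Sum>m\<in>?C. ?jac r m * ?w m) = - (\<Sum>m\<in>J. ?jac r m * ?w m)"
          using jac_kernel_split[OF J(1), of ?w F q] r by (auto simp: jac_kernel_def)
        moreover have "(\<Sum>m\<in>J. ?jac r m * ?w m) = (\<Sum>m\<in>J. if m = \<alpha> then ?jac r \<alpha> else 0)"
          by (intro sum.cong refl) (simp add: chart_basis(2)[OF P])
        ultimately show ?thesis using True fJ eC by (simp add: L_def sum_negf)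
      next
        case False
        then have "(\<Sum>m\<in>?C. ?jac r m * L q m \<alpha>) = (\<Sum>m\<in>?C. if m = \<alpha> then ?jac r \<alpha> else 0)"
          by (intro sum.cong refl) (auto simp: L_def)
        then show ?thesis using False a eC by simp
      qed
      have "peval (pd v F) q ^ ?r = fdet rs ?cs ?jac" using rs(3) q in_X by simp
      also have "\<dots> = fdet rs ?cs (\<lambda>r \<alpha>. \<Sum>m\<in>set (elems ?C). ?jac r m * L q m \<alpha>)"
        by (rule fdet_cong) (use fac rs(1) cs in blast)
      also have "\<dots> = fdet rs (elems ?C) ?jac * fdet (elems ?C) ?cs (L q)"
        by (rule fdet_mult) (simp_all add: len lrs eC)
      also have "fdet rs (elems ?C) ?jac = fdet rs (elems ?C) (\<lambda>r \<alpha>. \<Sum>m\<in>set (elems ?R). (if r = m then 1 else 0) * ?jac m \<alpha>)"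
        by (rule fdet_cong) (use rs(1) eR in \<open>simp add: if_distrib if_distribR cong: if_cong\<close>)
      also have "\<dots> = c * fdet (elems ?R) (elems ?C) ?jac"
        unfolding c_def by (rule fdet_mult) (simp_all add: len lrs eR)
      also have "fdet (elems ?R) (elems ?C) ?jac = peval (jac_minor n F J) q" by (simp add: jac_minor_def peval_fdet)
      finally have e: "peval (pd v F) q ^ ?r = c * peval (jac_minor n F J) q * fdet (elems ?C) ?cs (L q)" .
      have QL: "peval (LP i \<alpha>) q = peval Q q * L q i \<alpha>" if i: "i \<in> ?C" for i \<alpha>
      proof (cases "\<alpha> \<in> J")
        case True
        have "peval Q q = peval (QQ \<alpha> i) q * (\<Prod>(j, k)\<in>J \<times> jidx - {(\<alpha>, i)}. peval (QQ j k) q)"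
          unfolding Q_def peval_prod case_prod_beta using True i fJ by (subst prod.remove[of _ "(\<alpha>, i)"]) auto
        then show ?thesis using True i good[OF q False True, of i]
          by (simp add: LP_def L_def peval_uminus peval_mult peval_prod case_prod_beta)
      qed (simp add: LP_def L_def)
      have "peval (fdet (elems ?C) ?cs LP) q = fdet (elems ?C) ?cs (\<lambda>i \<alpha>. peval Q q * L q i \<alpha>)"
        unfolding peval_fdet by (rule fdet_cong) (use QL eC in simp)
      also have "\<dots> = peval Q q ^ ?r * fdet (elems ?C) ?cs (L q)" by (simp add: fdet_scale lrs)
      finally show ?thesis
        by (simp add: G_def peval_minus peval_mult peval_power e)
    qed (simp add: G_def peval_minus peval_mult)
    then have "F dvd (H * Q ^ ?r) * pd v F ^ ?r - G * jac_minor n F J"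
      unfolding vanishing[symmetric] vanishing_ideal_def by blast
    then show ?thesis by blast
  qed
  moreover have "peval (H * Q ^ ?r) p0 \<noteq> 0" using H0 Q0 by (simp add: peval_mult peval_power)
  ultimately show ?thesis using J(1,2) by blast
qed

text \<open>At a singular point the minor \<open>f\<close> of a suitable chart vanishes and divides a power of every partial
derivative of \<open>F\<close> in the local ring, which is impossible on a normal hypersurface.\<close>

lemma isomorphism_imp_nonsingular:
  assumes nv: "normal_variety X" and iso: "is_isomorphism ambient Nash affine_atlas X nash_projection"
  shows "singular_locus X = {}"
proof (rule ccontr)
  assume "singular_locus X \<noteq> {}"
  then obtain p0 where p0: "p0 \<in> singular_locus X" by blast
  then have p0X: "p0 \<in> X" by (simp add: singular_locus_def)
  have sing: "peval (pd v F) p0 = 0" for v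
    using p0 singular_locus_hypersurface[OF F, of p0] p0X in_X X by auto
  let ?r = "card (row_indices n :: ('s \<Rightarrow>\<^sub>0 nat) set)"
  obtain J h where J: "J \<subseteq> jidx" "card J = tdim" and h: "peval h p0 \<noteq> 0"
    and div: "\<And>v. \<exists>G. F dvd h * pd v F ^ ?r - G * jac_minor n F J"
    using isomorphism_imp_divisibility[OF iso p0X] by blast
  let ?f = "jac_minor n F J"
  have f0: "peval ?f p0 = 0" by (rule jac_minor_singular[OF p0X sing J])
  have rel: "\<exists>x y. h * pd v F ^ ?r = x * ?f + y * F" for v
  proof -
    obtain G k where "h * pd v F ^ ?r - G * ?f = F * k" using div by (meson dvdE)
    then have "h * pd v F ^ ?r = G * ?f + k * F" by (simp add: algebra_simps)
    then show ?thesis by blast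
  qed
  have nd: "\<not> F dvd ?f"
  proof
    assume "F dvd ?f"
    obtain v where v: "\<not> vars_in (- {v}) F" using irreducible_involves_variable[OF F] by blast
    obtain x y where "h * pd v F ^ ?r = x * ?f + y * F" using rel by blast
    then have "F dvd h * pd v F ^ ?r" using \<open>F dvd ?f\<close> by simp
    moreover have "\<not> F dvd h"
    proof
      assume "F dvd h"
      then obtain k where "h = F * k" by (rule dvdE)
      then show False using h p0X by (simp add: in_X peval_mult)
    qed
    ultimately have "F dvd pd v F ^ ?r" using irreducible_prime[OF F] by blast
    moreover have "\<not> F dvd pd v F" by (rule not_dvd_pd[OF v])
    moreover have "F dvd pd v F ^ k \<Longrightarrow> F dvd pd v F" for k
    proof (induction k)
      case 0
      then show ?case using irreducible_not_unit[OF F] by simp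
    next
      case (Suc k)
      then show ?case using irreducible_prime[OF F, of "pd v F" "pd v F ^ k"] by auto
    qed
    ultimately show False by blast
  qed
  show False
  proof (rule normal_hypersurface_no_singular_divisor[OF F nv[unfolded X] _ f0 nd])
    show "peval F p0 = 0" using p0X in_X by simp
    show "\<exists>q k x y. peval q p0 \<noteq> 0 \<and> q * pd v F ^ k = x * ?f + y * F" for v
      using h rel by blast
  qed
qed

end

theorem theorem4p13:
  fixes n :: nat and F :: "'s::finite mpoly" and X :: "('s \<Rightarrow> complex) set"
  assumes "n \<ge> 1"
    and "irreducible F"
    and "X = zero_set {F}"
    and "normal_variety X"
  shows "is_isomorphism (nash_atlas n X) (nash_blowup n X) affine_atlas X nash_projection
           \<longleftrightarrow> nonsingular X"
  using isomorphism_imp_nonsingular[OF assms] nonsingular_imp_isomorphism[OF assms(1-3)] by blast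

end
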